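(* There exists a constant $\lambda_0>0$ such that for each $\lambda>\lambda_0$ there are constants $s_0(\lambda)>0$ and $C>0$ such that, with $\varphi(t)=e^{\lambda t}$, $$\begin{aligned} &\int_{Q} \left(\frac{1}{a(x)}| u_{t}|^2+ a(x)| u_{xx}|^2+ s\lambda \varphi | u_{x}|^2+ \frac{s^2\lambda^2\varphi^2}{a(x)}| u|^2\right)e^{2s\varphi}\,dx\,dt\\ &\leq C \int_{Q}s\varphi\frac{1}{a(x)}| F|^2 e^{2s\varphi}\,dx\,dt +Cs\left( s\lambda\varphi(T)\| u(\cdot,T)\|_{\frac{1}{a}}^2+\| u(\cdot,T)\|_{1,\frac{1}{a}}^2 \right)e^{2s\varphi(T)}\\ &\quad +Cs\left( s\lambda\| u(\cdot,0)\|_{\frac{1}{a}}^2+\| u(\cdot,0)\|_{1,\frac{1}{a}}^2\right)e^{2s} \end{aligned}$$ for all $s\geq s_0(\lambda)$ and all $u\in H^1(0,T;L^2_{\frac1a}(0,1))\cap L^2(0,T;H^2_{\frac1a}(0,1))$ solving the backward degenerate equation $$u_t(x,t)+a(x)u_{xx}(x,t)=F(x,t)\ \text{ in } Q,\qquad u=0\ \text{ on }\Sigma,\qquad u(\cdot,T)=u_T\ \text{ in }(0,1).$$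
   Context: Let $T>0$, $Q=(0,1)\times(0,T)$, $\Sigma=\{0,1\}\times(0,T)$. The coefficient $a$ satisfies $a\in C([0,1])\cap C^1(0,1)$, $a(x)>0$ for $x\in(0,1)$ and $a(0)=a(1)=0$. All functions are real-valued. The constants $\lambda_0,s_0(\lambda),C$ do not depend on $u$, $F$ or $u_T$, and $C$ does not depend on $s$. Weighted spaces: $L^2_{\frac1a}(0,1)=\{u\in L^2(0,1): \|u\|_{\frac1a}<\infty\}$ with $\|u\|_{\frac1a}^2=\int_0^1 \frac{u^2}{a}\,dx$; $H^1_{\frac1a}(0,1)=L^2_{\frac1a}(0,1)\cap H^1_0(0,1)$ with $\|u\|_{1,\frac1a}^2=\|u\|_{\frac1a}^2+\|u_x\|_{L^2(0,1)}^2$; $H^2_{\frac1a}(0,1)=\{u\in H^1_{\frac1a}(0,1): a u_{xx}\in L^2_{\frac1a}(0,1)\}$ with $\|u\|_{2,\frac1a}^2=\|u\|_{1,\frac1a}^2+\int_0^1 a\,u_{xx}^2\,dx$. *)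

theory Defs
  imports "HOL-Analysis.Analysis"
begin

section \<open>Sobolev spaces on an interval\<close>

definition test_fun :: "real \<Rightarrow> real \<Rightarrow> (real \<Rightarrow> real) \<Rightarrow> bool" where
  "test_fun l r \<psi> \<longleftrightarrow>
     (\<forall>n. (deriv ^^ n) \<psi> differentiable_on UNIV) \<and>
     (\<exists>c d. l < c \<and> c \<le> d \<and> d < r \<and> (\<forall>x. x \<notin> {c..d} \<longrightarrow> \<psi> x = 0))"

definition locally_integrable :: "real \<Rightarrow> real \<Rightarrow> (real \<Rightarrow> real) \<Rightarrow> bool" where
  "locally_integrable l r f \<longleftrightarrow>
     (\<forall>c d. l < c \<and> c \<le> d \<and> d < r \<longrightarrow> set_integrable lebesgue {c..d} f)"

definition weak_deriv :: "real \<Rightarrow> real \<Rightarrow> (real \<Rightarrow> real) \<Rightarrow> (real \<Rightarrow> real) \<Rightarrow> bool" where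
  "weak_deriv l r f g \<longleftrightarrow>
     locally_integrable l r f \<and> locally_integrable l r g \<and>
     (\<forall>\<psi>. test_fun l r \<psi> \<longrightarrow>
        (LINT x:{l<..<r}|lebesgue. f x * deriv \<psi> x) = - (LINT x:{l<..<r}|lebesgue. g x * \<psi> x))"

abbreviation I01 :: "real measure" where
  "I01 \<equiv> lebesgue_on {0<..<1}"

definition L2 :: "(real \<Rightarrow> real) set" where
  "L2 = {f \<in> borel_measurable I01. integrable I01 (\<lambda>x. (f x)\<^sup>2)}"

text \<open>The closure of the test functions in the norm of \<open>H\<^sup>1(0,1)\<close>.\<close>

definition H10 :: "(real \<Rightarrow> real) set" where
  "H10 = {f \<in> L2. \<exists>g\<in>L2. weak_deriv 0 1 f g \<and>
     (\<exists>\<psi>. (\<forall>n::nat. test_fun 0 1 (\<psi> n)) \<and>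
        (\<lambda>n. LINT x|I01. (\<psi> n x - f x)\<^sup>2) \<longlonglongrightarrow> 0 \<and>
        (\<lambda>n. LINT x|I01. (deriv (\<psi> n) x - g x)\<^sup>2) \<longlonglongrightarrow> 0)}"

text \<open>A choice of weak derivative on \<open>(0,1)\<close>; it is unique up to a null set if it exists.\<close>

definition wderiv :: "(real \<Rightarrow> real) \<Rightarrow> real \<Rightarrow> real" where
  "wderiv f = (SOME g. weak_deriv 0 1 f g)"


section \<open>Weighted spaces\<close>

definition L2w :: "(real \<Rightarrow> real) \<Rightarrow> (real \<Rightarrow> real) set" where
  "L2w a = {f \<in> L2. integrable I01 (\<lambda>x. (f x)\<^sup>2 / a x)}"

definition L2w_norm :: "(real \<Rightarrow> real) \<Rightarrow> (real \<Rightarrow> real) \<Rightarrow> real" where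
  "L2w_norm a f = sqrt (LINT x|I01. (f x)\<^sup>2 / a x)"

definition H1w :: "(real \<Rightarrow> real) \<Rightarrow> (real \<Rightarrow> real) set" where
  "H1w a = L2w a \<inter> H10"

definition H1w_norm :: "(real \<Rightarrow> real) \<Rightarrow> (real \<Rightarrow> real) \<Rightarrow> real" where
  "H1w_norm a f = sqrt ((L2w_norm a f)\<^sup>2 + (LINT x|I01. (wderiv f x)\<^sup>2))"

definition H2w :: "(real \<Rightarrow> real) \<Rightarrow> (real \<Rightarrow> real) set" where
  "H2w a = {f \<in> H1w a. \<exists>g. weak_deriv 0 1 (wderiv f) g \<and> (\<lambda>x. a x * g x) \<in> L2w a}"

definition H2w_norm :: "(real \<Rightarrow> real) \<Rightarrow> (real \<Rightarrow> real) \<Rightarrow> real" where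
  "H2w_norm a f = sqrt ((H1w_norm a f)\<^sup>2 + (LINT x|I01. a x * (wderiv (wderiv f) x)\<^sup>2))"


section \<open>Bochner spaces over a time interval\<close>

text \<open>
  The values are functions of the space variable. The value space is given by a carrier \<open>X\<close>,
  which is a set of representatives (not of classes modulo null sets), and a norm \<open>N\<close> on it.
\<close>

definition simple_in ::
  "real \<Rightarrow> (real \<Rightarrow> real) set \<Rightarrow> (real \<Rightarrow> real \<Rightarrow> real) \<Rightarrow> bool" where
  "simple_in T X S \<longleftrightarrow> simple_function (lebesgue_on {0<..<T}) S \<and> S ` {0<..<T} \<subseteq> X"

definition simple_integral ::
  "real \<Rightarrow> (real \<Rightarrow> real \<Rightarrow> real) \<Rightarrow> real \<Rightarrow> real" where
  "simple_integral T S x =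
     (\<Sum>v\<in>S ` {0<..<T}. measure lebesgue (S -` {v} \<inter> {0<..<T}) * v x)"

definition strongly_measurable_in ::
  "real \<Rightarrow> (real \<Rightarrow> real) set \<Rightarrow> ((real \<Rightarrow> real) \<Rightarrow> real) \<Rightarrow> (real \<Rightarrow> real \<Rightarrow> real) \<Rightarrow> bool" where
  "strongly_measurable_in T X N U \<longleftrightarrow>
     (AE t in lebesgue_on {0<..<T}. U t \<in> X) \<and>
     (\<exists>S. (\<forall>n::nat. simple_in T X (S n)) \<and>
        (AE t in lebesgue_on {0<..<T}. (\<lambda>n. N (\<lambda>x. S n t x - U t x)) \<longlonglongrightarrow> 0))"

definition bochner_L2 ::
  "real \<Rightarrow> (real \<Rightarrow> real) set \<Rightarrow> ((real \<Rightarrow> real) \<Rightarrow> real) \<Rightarrow> (real \<Rightarrow> real \<Rightarrow> real) set" where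
  "bochner_L2 T X N = {U. strongly_measurable_in T X N U \<and>
     (\<integral>\<^sup>+ t. ennreal ((N (U t))\<^sup>2) \<partial>lebesgue_on {0<..<T}) < \<infinity>}"

definition has_bochner_integral_in ::
  "real \<Rightarrow> (real \<Rightarrow> real) set \<Rightarrow> ((real \<Rightarrow> real) \<Rightarrow> real) \<Rightarrow>
     (real \<Rightarrow> real \<Rightarrow> real) \<Rightarrow> (real \<Rightarrow> real) \<Rightarrow> bool" where
  "has_bochner_integral_in T X N U z \<longleftrightarrow>
     strongly_measurable_in T X N U \<and> z \<in> X \<and>
     (\<exists>S. (\<forall>n::nat. simple_in T X (S n)) \<and>
        (\<lambda>n. \<integral>\<^sup>+ t. ennreal (N (\<lambda>x. S n t x - U t x)) \<partial>lebesgue_on {0<..<T}) \<longlonglongrightarrow> 0 \<and>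
        (\<lambda>n. N (\<lambda>x. simple_integral T (S n) x - z x)) \<longlonglongrightarrow> 0)"

text \<open>\<open>V\<close> is the \<open>X\<close>-valued weak time derivative of \<open>U\<close>.\<close>

definition weak_time_deriv ::
  "real \<Rightarrow> (real \<Rightarrow> real) set \<Rightarrow> ((real \<Rightarrow> real) \<Rightarrow> real) \<Rightarrow>
     (real \<Rightarrow> real \<Rightarrow> real) \<Rightarrow> (real \<Rightarrow> real \<Rightarrow> real) \<Rightarrow> bool" where
  "weak_time_deriv T X N U V \<longleftrightarrow>
     (\<forall>\<psi>. test_fun 0 T \<psi> \<longrightarrow>
        (\<exists>z. has_bochner_integral_in T X N (\<lambda>t x. deriv \<psi> t * U t x) z \<and>
             has_bochner_integral_in T X N (\<lambda>t x. \<psi> t * V t x) (\<lambda>x. - z x)))"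

text \<open>
  \<open>U \<in> H\<^sup>1(0,T;X)\<close> with \<open>U\<^sub>t = V\<close>. As \<open>H\<^sup>1(0,T;X) \<subseteq> C([0,T];X)\<close>, the function \<open>U\<close> is taken
  to be the continuous representative, so that the values \<open>U 0\<close> and \<open>U T\<close> are its traces.
\<close>

definition bochner_H1 ::
  "real \<Rightarrow> (real \<Rightarrow> real) set \<Rightarrow> ((real \<Rightarrow> real) \<Rightarrow> real) \<Rightarrow>
     (real \<Rightarrow> real \<Rightarrow> real) \<Rightarrow> (real \<Rightarrow> real \<Rightarrow> real) \<Rightarrow> bool" where
  "bochner_H1 T X N U V \<longleftrightarrow>
     U \<in> bochner_L2 T X N \<and> V \<in> bochner_L2 T X N \<and> weak_time_deriv T X N U V \<and>
     (\<forall>t\<in>{0..T}. U t \<in> X \<and> ((\<lambda>\<tau>. N (\<lambda>x. U \<tau> x - U t x)) \<longlongrightarrow> 0) (at t within {0..T}))"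


section \<open>Functions on the space-time cylinder\<close>

abbreviation cyl :: "real \<Rightarrow> (real \<times> real) measure" where
  "cyl T \<equiv> lebesgue_on ({0<..<1} \<times> {0<..<T})"

text \<open>
  \<open>u \<in> H\<^sup>1(0,T;L\<^sup>2\<^sub>1\<^sub>/\<^sub>a) \<inter> L\<^sup>2(0,T;H\<^sup>2\<^sub>1\<^sub>/\<^sub>a)\<close> with derivatives \<open>u\<^sub>t = ut\<close>, \<open>u\<^sub>x = ux\<close>, \<open>u\<^sub>x\<^sub>x = uxx\<close>.
  An element of a Bochner space determines each slice \<open>u(\<cdot>,t)\<close> only up to a null set; it always has
  a jointly measurable representative, and such representatives are used here, so that integrals
  over the cylinder make sense.
\<close>

definition strong_fun ::
  "(real \<Rightarrow> real) \<Rightarrow> real \<Rightarrow> (real \<Rightarrow> real \<Rightarrow> real) \<Rightarrow> (real \<Rightarrow> real \<Rightarrow> real) \<Rightarrow>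
     (real \<Rightarrow> real \<Rightarrow> real) \<Rightarrow> (real \<Rightarrow> real \<Rightarrow> real) \<Rightarrow> bool" where
  "strong_fun a T u ut ux uxx \<longleftrightarrow>
     (\<forall>v\<in>{u, ut, ux, uxx}. (\<lambda>(x, t). v x t) \<in> borel_measurable (cyl T)) \<and>
     bochner_H1 T (L2w a) (L2w_norm a) (\<lambda>t x. u x t) (\<lambda>t x. ut x t) \<and>
     (\<lambda>t x. u x t) \<in> bochner_L2 T (H2w a) (H2w_norm a) \<and>
     (AE t in lebesgue_on {0<..<T}.
        weak_deriv 0 1 (\<lambda>x. u x t) (\<lambda>x. ux x t) \<and> weak_deriv 0 1 (\<lambda>x. ux x t) (\<lambda>x. uxx x t))"

text \<open>
  The lateral condition \<open>u = 0\<close> means that almost every slice lies in \<open>H10\<close>; this is already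
  implied by membership in the Bochner space with values in \<open>H2w a\<close>.
\<close>

definition solves_backward ::
  "(real \<Rightarrow> real) \<Rightarrow> real \<Rightarrow> (real \<Rightarrow> real \<Rightarrow> real) \<Rightarrow> (real \<Rightarrow> real \<Rightarrow> real) \<Rightarrow>
     (real \<Rightarrow> real \<Rightarrow> real) \<Rightarrow> (real \<Rightarrow> real \<Rightarrow> real) \<Rightarrow> (real \<Rightarrow> real) \<Rightarrow> bool" where
  "solves_backward a T u ut uxx F uT \<longleftrightarrow>
     (AE (x, t) in cyl T. ut x t + a x * uxx x t = F x t) \<and>
     (AE t in lebesgue_on {0<..<T}. (\<lambda>x. u x t) \<in> H10) \<and>
     (AE x in I01. u x T = uT x)"

end

theory Submission
  imports Defs "HOL-Computational_Algebra.Polynomial" "HOL-Real_Asymp.Real_Asymp"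
begin

text \<open>Put \<open>p = s l \<phi>\<close> and split \<open>F = (u\<^sub>t + p u) + (a u\<^sub>x\<^sub>x - p u)\<close>. In \<open>\<integral> s \<phi> e\<^sup>2\<^sup>s\<^sup>\<phi> F\<^sup>2 / a\<close> the cross
  terms are, after integration by parts in \<open>x\<close>, time derivatives of \<open>\<integral> u\<^sub>x\<^sup>2\<close> and \<open>\<integral> u\<^sup>2 / a\<close> with
  weights; integration by parts in \<open>t\<close> yields positive terms that dominate the left-hand side, and
  boundary terms, of which those at \<open>t = 0\<close> have the good sign.

  As \<open>u\<close> is only a strong solution, integration by parts in \<open>t\<close> is replaced by an inequality: both
  energies are convex functionals \<open>J\<close>, so \<open>J (u s) - J (u t) \<ge> 2 \<langle>J' (u t), u s - u t\<rangle>\<close> with the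
  pairing of \<open>L\<^sup>2\<^sub>1\<^sub>/\<^sub>a\<close>, where the gradients \<open>J'\<close> are \<open>- a u\<^sub>x\<^sub>x\<close> and \<open>u\<close>. Dividing by \<open>s - t\<close> and using the
  \<open>L\<^sup>2\<close> continuity of translations gives the estimate. At \<open>t = T\<close> it uses that \<open>u T\<close> lies in
  \<open>H\<^sup>1\<^sub>0\<close>, which follows from the convergence of the gradients \<open>u\<^sub>x\<close> along well-chosen times.\<close>

section \<open>Smooth cutoff functions\<close>

text \<open>The obstacle is that \<open>u_x\<close> has no time derivative: \<open>u_t\<close> is
  only known with values in the weighted \<open>L^2\<close> space, and the gradient energy is
  meaningful at almost every time only. What can be differentiated are the scalar functions
  \<open>ip (U t) v\<close> with \<open>v\<close> fixed, and the convexity inequalities need nothing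
  else. They are one-sided, in the direction that bounds the time integrals from above by the energy
  at \<open>T\<close>.

  The factor \<open>s \<phi>\<close> in front of \<open>F\<close> produces the surplus. Let
  \<open>e = exp (2 s \<phi>)\<close> and \<open>\<rho> = s \<phi> e\<close>. As
  \<open>\<phi>' = l \<phi>\<close> and \<open>e' = 2 p e\<close>, one has
  \<open>\<rho>' = l \<rho> + 2 p \<rho>\<close>. The part \<open>2 p \<rho>\<close> is consumed in
  completing the two squares; what remains is \<open>l \<rho> = p e\<close>, exactly the weight of
  \<open>u_x^2\<close> in the estimate. The weight \<open>e\<close> alone would leave nothing for
  \<open>u_x^2\<close>.

  The constant is \<open>3 exp (l T)\<close>: the 3 comes from the comparison at a fixed time, and
  \<open>exp (l T)\<close> is the value of \<open>\<phi>\<close> at \<open>T\<close>, since the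
  boundary term comes with the weight \<open>\<rho>\<close> while the statement has only
  \<open>s\<close> there.\<close>

definition smooth_upto :: "nat \<Rightarrow> (real \<Rightarrow> real) \<Rightarrow> bool" where
  "smooth_upto n f \<longleftrightarrow> (\<forall>k\<le>n. (deriv ^^ k) f differentiable_on UNIV)"

lemma smooth_upto_0: "smooth_upto 0 f \<longleftrightarrow> f differentiable_on UNIV"
  by (simp add: smooth_upto_def)

lemma smooth_upto_Suc:
  "smooth_upto (Suc n) f \<longleftrightarrow> f differentiable_on UNIV \<and> smooth_upto n (deriv f)"
proof -
  have eq: "(deriv ^^ Suc k) f = (deriv ^^ k) (deriv f)" for k
    by (simp add: funpow_swap1)
  show ?thesis
    unfolding smooth_upto_def
  proof safe
    fix k assume *: "\<forall>k\<le>Suc n. (deriv ^^ k) f differentiable_on UNIV"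
    show "f differentiable_on UNIV" using *[rule_format, of 0] by simp
    assume "k \<le> n" then show "(deriv ^^ k) (deriv f) differentiable_on UNIV"
      using *[rule_format, of "Suc k"] unfolding eq by simp
  next
    fix k assume "f differentiable_on UNIV" "\<forall>k\<le>n. (deriv ^^ k) (deriv f) differentiable_on UNIV"
      "k \<le> Suc n"
    then show "(deriv ^^ k) f differentiable_on UNIV"
      by (cases k) (auto simp: eq simp del: funpow.simps)
  qed
qed

lemma smooth_upto_mono: "smooth_upto n f \<Longrightarrow> m \<le> n \<Longrightarrow> smooth_upto m f"
  by (auto simp: smooth_upto_def)

lemma smooth_upto_differentiable: "smooth_upto n f \<Longrightarrow> f differentiable_on UNIV"
  using smooth_upto_mono[of n f 0] by (simp add: smooth_upto_0)

lemma differentiable_UNIV_has_deriv: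
  fixes f :: "real \<Rightarrow> real"
  assumes "f differentiable_on UNIV"
  shows "(f has_real_derivative deriv f x) (at x)"
  using assms by (auto simp: differentiable_on_def DERIV_deriv_iff_real_differentiable)

lemma has_deriv_differentiable_UNIV:
  fixes f :: "real \<Rightarrow> real"
  assumes "\<And>x. (f has_real_derivative g x) (at x)"
  shows "f differentiable_on UNIV" "deriv f = g"
  using assms by (auto simp: differentiable_on_def DERIV_imp_deriv real_differentiable_def)

lemma smooth_upto_add:
  "smooth_upto n f \<Longrightarrow> smooth_upto n g \<Longrightarrow> smooth_upto n (\<lambda>x. f x + g x)"
proof (induction n arbitrary: f g)
  case 0
  then show ?case by (simp add: smooth_upto_0)
next
  case (Suc n)
  have d: "((\<lambda>x. f x + g x) has_real_derivative deriv f x + deriv g x) (at x)" for x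
    using Suc.prems[THEN smooth_upto_differentiable, THEN differentiable_UNIV_has_deriv]
    by (intro DERIV_add)
  show ?case
    using Suc has_deriv_differentiable_UNIV[OF d] by (simp add: smooth_upto_Suc)
qed

text \<open>The reason for counting derivatives: the derivative of a product is a sum of products of
  factors with one order less, so an induction on \<open>n\<close> over arbitrary factors
  closes.\<close>

lemma smooth_upto_mult:
  "smooth_upto n f \<Longrightarrow> smooth_upto n g \<Longrightarrow> smooth_upto n (\<lambda>x. f x * g x)"
proof (induction n arbitrary: f g)
  case 0
  then show ?case by (simp add: smooth_upto_0)
next
  case (Suc n)
  have d: "((\<lambda>x. f x * g x) has_real_derivative deriv f x * g x + deriv g x * f x) (at x)" for x
    using Suc.prems[THEN smooth_upto_differentiable, THEN differentiable_UNIV_has_deriv]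
    by (intro DERIV_mult)
  have "smooth_upto n f" "smooth_upto n g"
    using Suc.prems smooth_upto_mono le_SucI by blast+
  then show ?case
    using Suc has_deriv_differentiable_UNIV[OF d]
    by (simp add: smooth_upto_Suc smooth_upto_add)
qed

lemma smooth_upto_const: "smooth_upto n (\<lambda>x. c)"
proof (induction n arbitrary: c)
  case (Suc n)
  have "((\<lambda>x. c) has_real_derivative 0) (at x)" for x c :: real by simp
  from has_deriv_differentiable_UNIV[OF this] Suc show ?case by (simp add: smooth_upto_Suc)
qed (simp add: smooth_upto_0)

lemma smooth_upto_affine: "smooth_upto n f \<Longrightarrow> smooth_upto n (\<lambda>x. f (c * x + d))"
proof (induction n arbitrary: f)
  case 0
  then have "((\<lambda>x. f (c * x + d)) has_real_derivative deriv f (c * x + d) * c) (at x)" for x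
    by (auto intro!: DERIV_chain2[where f = f] derivative_eq_intros
        simp: smooth_upto_0 differentiable_UNIV_has_deriv)
  from has_deriv_differentiable_UNIV[OF this] show ?case by (simp add: smooth_upto_0)
next
  case (Suc n)
  then have "((\<lambda>x. f (c * x + d)) has_real_derivative deriv f (c * x + d) * c) (at x)" for x
    by (auto intro!: DERIV_chain2[where f = f] derivative_eq_intros
        simp: smooth_upto_Suc differentiable_UNIV_has_deriv)
  from has_deriv_differentiable_UNIV[OF this] Suc show ?case
    by (simp add: smooth_upto_Suc smooth_upto_mult smooth_upto_const)
qed

definition smooth :: "(real \<Rightarrow> real) \<Rightarrow> bool" where
  "smooth f \<longleftrightarrow> (\<forall>n. (deriv ^^ n) f differentiable_on UNIV)"

lemma smooth_iff: "smooth f \<longleftrightarrow> (\<forall>n. smooth_upto n f)"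
  by (auto simp: smooth_def smooth_upto_def)

lemma smooth_add: "smooth f \<Longrightarrow> smooth g \<Longrightarrow> smooth (\<lambda>x. f x + g x)"
  and smooth_mult: "smooth f \<Longrightarrow> smooth g \<Longrightarrow> smooth (\<lambda>x. f x * g x)"
  and smooth_const: "smooth (\<lambda>x. c)"
  and smooth_affine: "smooth f \<Longrightarrow> smooth (\<lambda>x. f (c * x + d))"
  by (simp_all add: smooth_iff smooth_upto_add smooth_upto_mult smooth_upto_const smooth_upto_affine)

lemma smooth_diff: "smooth f \<Longrightarrow> smooth g \<Longrightarrow> smooth (\<lambda>x. f x - g x)"
  using smooth_add[of f "\<lambda>x. (-1) * g x"] smooth_mult[OF smooth_const[of "-1"], of g] by simp

lemma smooth_deriv_iff: "smooth f \<longleftrightarrow> f differentiable_on UNIV \<and> smooth (deriv f)"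
  unfolding smooth_iff using smooth_upto_Suc smooth_upto_mono by (meson le_SucI order_refl smooth_upto_differentiable)

lemma smooth_has_deriv: "smooth f \<Longrightarrow> (f has_real_derivative deriv f x) (at x)"
  using smooth_deriv_iff differentiable_UNIV_has_deriv by blast

lemma smooth_continuous_deriv: "smooth f \<Longrightarrow> continuous_on A f" "smooth f \<Longrightarrow> continuous_on A (deriv f)"
  using smooth_deriv_iff differentiable_imp_continuous_on continuous_on_subset by blast+

text \<open>Flat at \<open>0\<close>: every derivative has this form again, with another polynomial in \<open>1/x\<close>.\<close>

definition flat :: "real poly \<Rightarrow> real \<Rightarrow> real" where
  "flat p x = (if x > 0 then poly p (1 / x) * exp (- (1 / x)) else 0)"

lemma poly_exp_decay: "((\<lambda>y::real. poly p y * exp (- y)) \<longlongrightarrow> 0) at_top"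
proof -
  have m: "((\<lambda>y::real. c * (y ^ k * exp (- y))) \<longlongrightarrow> 0) at_top" for c k
    using tendsto_mult_right_zero[OF tendsto_power_div_exp_0[of k], of c]
    by (simp add: exp_minus divide_inverse)
  have "((\<lambda>y::real. \<Sum>i\<le>degree p. coeff p i * (y ^ i * exp (- y))) \<longlongrightarrow> (\<Sum>i\<le>degree p. 0)) at_top"
    by (intro tendsto_sum m)
  then show ?thesis
    by (simp add: poly_altdef sum_distrib_right mult.assoc)
qed

text \<open>With \<open>y = 1 / x\<close>, the chain rule turns \<open>p(y) exp (-y)\<close> into
  \<open>y^2 (p - p')(y) exp (-y)\<close>, which explains the polynomial. At \<open>0\<close> the
  right difference quotient is \<open>y p(y) exp (-y)\<close>, again a polynomial against
  exponential decay.\<close>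

lemma flat_has_deriv:
  "(flat p has_real_derivative flat ([:0,0,1:] * (p - pderiv p)) x) (at x)"
proof (cases "x = 0")
  case False
  show ?thesis
  proof (cases "x > 0")
    case True
    have "((\<lambda>x. poly p (1 / x) * exp (- (1 / x))) has_real_derivative flat ([:0,0,1:] * (p - pderiv p)) x) (at x)"
      using True unfolding flat_def
      by (auto intro!: derivative_eq_intros DERIV_chain2[where f = "poly p"] poly_DERIV
          simp: field_simps power2_eq_square)
    then show ?thesis
      by (rule DERIV_cong_ev[OF refl _ refl, THEN iffD1, rotated])
        (use True eventually_gt_at_top in \<open>auto simp: flat_def eventually_nhds intro!: exI[of _ "{0<..}"]\<close>)
  next
    case F: False
    then have "x < 0" using False by simp
    have "((\<lambda>x. 0) has_real_derivative flat ([:0,0,1:] * (p - pderiv p)) x) (at x)"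
      using F by (simp add: flat_def)
    then show ?thesis
      by (rule DERIV_cong_ev[OF refl _ refl, THEN iffD1, rotated])
        (use \<open>x < 0\<close> in \<open>auto simp: flat_def eventually_nhds intro!: exI[of _ "{..<0}"]\<close>)
  qed
next
  case True
  have r: "((\<lambda>h. flat p h / h) \<longlongrightarrow> 0) (at_right 0)"
  proof -
    have "((\<lambda>h. poly ([:0,1:] * p) (inverse h) * exp (- inverse h)) \<longlongrightarrow> 0) (at_right (0::real))"
      using filterlim_compose[OF poly_exp_decay filterlim_inverse_at_top_right] .
    then show ?thesis
      by (rule Lim_transform_eventually)
        (auto simp: flat_def eventually_at_filter field_simps)
  qed
  have l: "((\<lambda>h. flat p h / h) \<longlongrightarrow> 0) (at_left 0)"
    by (rule Lim_transform_eventually[OF tendsto_const]) (auto simp: flat_def eventually_at_filter)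
  show ?thesis
    using filterlim_split_at_real[OF l r] True by (simp add: DERIV_def flat_def)
qed

lemma smooth_flat: "smooth (flat p)"
proof -
  have "smooth_upto n (flat p)" for n
  proof (induction n arbitrary: p)
    case 0
    show ?case using has_deriv_differentiable_UNIV[OF flat_has_deriv] by (simp add: smooth_upto_0)
  next
    case (Suc n)
    show ?case using has_deriv_differentiable_UNIV[OF flat_has_deriv] Suc by (simp add: smooth_upto_Suc)
  qed
  then show ?thesis by (simp add: smooth_iff)
qed

text \<open>The product \<open>flat 1 x * flat 1 (1 - x)\<close> is a smooth bump that is positive
  exactly on the open unit interval; the step is its antiderivative divided by the total mass. Hence
  the derivative is nonnegative, bounded and supported in the unit interval.\<close>

lemma exists_smooth_step:
  obtains \<sigma> :: "real \<Rightarrow> real" and M where "smooth \<sigma>" "\<And>x. x \<le> 0 \<Longrightarrow> \<sigma> x = 0" "\<And>x. x \<ge> 1 \<Longrightarrow> \<sigma> x = 1"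
    "\<And>x. 0 \<le> \<sigma> x \<and> \<sigma> x \<le> 1" "\<And>x. 0 \<le> deriv \<sigma> x \<and> deriv \<sigma> x \<le> M" "\<And>x. x \<notin> {0<..<1} \<Longrightarrow> deriv \<sigma> x = 0"
proof -
  define b where "b x = flat 1 x * flat 1 (-1 * x + 1)" for x
  have sb: "smooth b" unfolding b_def by (intro smooth_mult smooth_affine smooth_flat)
  have cb: "continuous_on A b" for A using sb smooth_continuous_deriv by blast
  have b0: "b x \<ge> 0" for x by (simp add: b_def flat_def)
  have bpos: "b x > 0" if "0 < x" "x < 1" for x using that by (simp add: b_def flat_def)
  have bz: "b x = 0" if "x \<notin> {0<..<1}" for x using that by (auto simp: b_def flat_def)
  \<comment> \<open>The lower limit is -1 instead of 0, so that every \<open>x \<ge> 0\<close>,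
    including \<open>0\<close> itself, is interior to the interval on which the fundamental theorem
    is applied. For \<open>x < 0\<close> the function is locally constant.\<close>
  define B where "B x = integral {-1..x} b" for x
  define c where "c = B 1"
  have Bx: "B x = 0" if "x \<le> 0" for x
  proof -
    have "integral {-1..x} b = integral {-1..x} (\<lambda>x. 0)"
      using that by (intro integral_cong bz) auto
    then show ?thesis by (simp add: B_def)
  qed
  have dB: "(B has_real_derivative b x) (at x)" for x
  proof (cases "x < 0")
    case True
    then have "((\<lambda>x. 0) has_real_derivative b x) (at x)" by (simp add: bz)
    then show ?thesis
      by (rule DERIV_cong_ev[OF refl _ refl, THEN iffD1, rotated])
        (use True in \<open>auto simp: Bx eventually_nhds intro!: exI[of _ "{..<0}"]\<close>)
  next
    case False
    have "((\<lambda>u. integral {-1..u} b) has_real_derivative b x) (at x within {-1..x + 1})"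
      using False by (intro integral_has_real_derivative cb) auto
    moreover have "at x within {-1..x + 1} = at x"
      using False by (intro at_within_interior) auto
    ultimately show ?thesis by (simp add: B_def[abs_def])
  qed
  have mono: "B x \<le> B y" if "x \<le> y" for x y
    by (rule DERIV_nonneg_imp_nondecreasing[OF that]) (use dB b0 in blast)
  have B1: "B x = c" if "x \<ge> 1" for x
  proof (cases "x = 1")
    case False
    then have "1 < x" using that by simp
    then obtain z where "z > 1" "B x - B 1 = (x - 1) * b z"
      using MVT2[of 1 x B b] dB by auto
    then show ?thesis by (simp add: bz c_def)
  qed (simp add: c_def)
  have cpos: "c > 0"
  proof -
    obtain z where "z > 0" "z < 1" "B 1 - B 0 = (1 - 0) * b z"
      using MVT2[of 0 1 B b] dB by auto
    then show ?thesis using bpos[of z] Bx[of 0] by (simp add: c_def)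
  qed
  have "bounded (b ` {0..1})" using cb by (intro compact_imp_bounded compact_continuous_image) auto
  then obtain K where "\<forall>y\<in>b ` {0..1}. \<bar>y\<bar> \<le> K" unfolding bounded_iff real_norm_def ..
  then have K: "\<bar>b x\<bar> \<le> K" if "x \<in> {0..1}" for x using that by blast
  have K0: "0 \<le> K" using K[of 0] by auto
  have K': "b x \<le> K" for x
  proof (cases "x \<in> {0..1}")
    case True then show ?thesis using K[of x] by simp
  next
    case False then show ?thesis using bz[of x] K0 by auto
  qed
  define \<sigma> where "\<sigma> x = B x * (1 / c)" for x
  have d\<sigma>: "(\<sigma> has_real_derivative b x * (1 / c)) (at x)" for x
    unfolding \<sigma>_def by (intro DERIV_cmult_right dB)
  note D = has_deriv_differentiable_UNIV[OF d\<sigma>]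
  show thesis
  proof
    have "smooth (\<lambda>x. b x * (1 / c))" by (intro smooth_mult sb smooth_const)
    then show "smooth \<sigma>" using D smooth_deriv_iff[of \<sigma>] by simp
    show "\<sigma> x = 0" if "x \<le> 0" for x using Bx that by (simp add: \<sigma>_def)
    show "\<sigma> x = 1" if "x \<ge> 1" for x using B1 that cpos by (simp add: \<sigma>_def)
    show "0 \<le> \<sigma> x \<and> \<sigma> x \<le> 1" for x
    proof -
      have "0 \<le> B x" using mono[of 0 x] Bx[of x] Bx[of 0] by (cases "x \<le> 0") auto
      moreover have "B x \<le> c" using mono[of x 1] B1[of x] by (cases "x \<le> 1") (auto simp: c_def)
      ultimately show ?thesis using cpos by (simp add: \<sigma>_def)
    qed
    show "0 \<le> deriv \<sigma> x \<and> deriv \<sigma> x \<le> K / c" for x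
      using b0 K' cpos by (auto simp: D divide_right_mono)
    show "deriv \<sigma> x = 0" if "x \<notin> {0<..<1}" for x using bz that by (simp add: D)
  qed
qed

section \<open>Square integrable functions\<close>

text \<open>The measure is a parameter because the same facts serve functions of \<open>x\<close> on
  the unit interval, functions of time and functions on the plane.\<close>

definition sqint :: "'a measure \<Rightarrow> ('a \<Rightarrow> real) \<Rightarrow> bool" where
  "sqint M f \<longleftrightarrow> f \<in> borel_measurable M \<and> integrable M (\<lambda>x. (f x)\<^sup>2)"

definition l2norm :: "'a measure \<Rightarrow> ('a \<Rightarrow> real) \<Rightarrow> real" where
  "l2norm M f = sqrt (LINT x|M. (f x)\<^sup>2)"

lemma sqint_measurable: "sqint M f \<Longrightarrow> f \<in> borel_measurable M"
  and sqint_integrable: "sqint M f \<Longrightarrow> integrable M (\<lambda>x. (f x)\<^sup>2)"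
  by (simp_all add: sqint_def)

lemma sqint_mult_integrable:
  assumes "sqint M f" "sqint M g"
  shows "integrable M (\<lambda>x. f x * g x)"
proof (rule Bochner_Integration.integrable_bound[of M "\<lambda>x. (f x)\<^sup>2 + (g x)\<^sup>2"])
  show "integrable M (\<lambda>x. (f x)\<^sup>2 + (g x)\<^sup>2)" using assms by (simp add: sqint_def)
  show "(\<lambda>x. f x * g x) \<in> borel_measurable M"
    using assms[THEN sqint_measurable] by (rule borel_measurable_times)
  have "\<bar>x * y\<bar> \<le> x\<^sup>2 + y\<^sup>2" for x y :: real
  proof -
    have "2 * \<bar>x\<bar> * \<bar>y\<bar> \<le> x\<^sup>2 + y\<^sup>2" using zero_le_power2[of "\<bar>x\<bar> - \<bar>y\<bar>"] by (simp add: power2_diff)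
    moreover have "0 \<le> \<bar>x\<bar> * \<bar>y\<bar>" by simp
    ultimately have "\<bar>x\<bar> * \<bar>y\<bar> \<le> x\<^sup>2 + y\<^sup>2" by linarith
    then show ?thesis by (simp only: abs_mult)
  qed
  then show "AE x in M. norm (f x * g x) \<le> norm ((f x)\<^sup>2 + (g x)\<^sup>2)" by simp
qed

lemma sqint_cmult: "sqint M f \<Longrightarrow> sqint M (\<lambda>x. c * f x)"
  by (auto simp: sqint_def power_mult_distrib)

lemma sqint_add: "sqint M f \<Longrightarrow> sqint M g \<Longrightarrow> sqint M (\<lambda>x. f x + g x)"
  using sqint_mult_integrable[of M f g]
  by (auto simp: sqint_def power2_sum mult.assoc)

lemma sqint_diff: "sqint M f \<Longrightarrow> sqint M g \<Longrightarrow> sqint M (\<lambda>x. f x - g x)"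
  using sqint_add[of M f "\<lambda>x. (-1) * g x"] sqint_cmult[of M g "-1"] by simp

lemma sqint_zero: "sqint M (\<lambda>x. 0)"
  by (simp add: sqint_def)

lemma sqint_cong_AE:
  assumes "sqint M f" "AE x in M. f x = g x" "g \<in> borel_measurable M"
  shows "sqint M g"
proof -
  have "integrable M (\<lambda>x. (g x)\<^sup>2) \<longleftrightarrow> integrable M (\<lambda>x. (f x)\<^sup>2)"
    using assms by (intro integrable_cong_AE) (auto simp: sqint_def)
  then show ?thesis using assms by (simp add: sqint_def)
qed

lemma l2norm_nonneg [simp]: "0 \<le> l2norm M f"
  by (simp add: l2norm_def)

lemma l2norm_power2: "(l2norm M f)\<^sup>2 = (LINT x|M. (f x)\<^sup>2)"
  by (simp add: l2norm_def)

text \<open>The quadratic \<open>A + 2 s B + s^2 C\<close> is the integral of a square. Its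
  minimiser \<open>s = - B / C\<close> gives \<open>B^2 \<le> A C\<close>; for \<open>C = 0\<close>
  it is affine in \<open>s\<close> and bounded below, which forces \<open>B = 0\<close>.\<close>

lemma l2_Cauchy_Schwarz:
  assumes "sqint M f" "sqint M g"
  shows "\<bar>LINT x|M. f x * g x\<bar> \<le> l2norm M f * l2norm M g"
proof -
  define A B C where "A = (LINT x|M. (f x)\<^sup>2)" "B = (LINT x|M. f x * g x)" "C = (LINT x|M. (g x)\<^sup>2)"
  have q: "0 \<le> A + 2 * s * B + s\<^sup>2 * C" for s
  proof -
    have "0 \<le> (LINT x|M. (f x + s * g x)\<^sup>2)" by simp
    also have "\<dots> = (LINT x|M. (f x)\<^sup>2 + 2 * s * (f x * g x) + s\<^sup>2 * (g x)\<^sup>2)"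
      by (rule Bochner_Integration.integral_cong) (auto simp: power2_eq_square algebra_simps)
    also have "\<dots> = A + 2 * s * B + s\<^sup>2 * C"
      using assms sqint_mult_integrable[OF assms] by (simp add: A_B_C_def sqint_def)
    finally show ?thesis .
  qed
  have pos: "0 \<le> A" "0 \<le> C" by (simp_all add: A_B_C_def)
  have "B\<^sup>2 \<le> A * C"
  proof (cases "C = 0")
    case True
    have "B = 0"
    proof (rule ccontr)
      assume "B \<noteq> 0"
      then have "A + 2 * (- (A + 1) / (2 * B)) * B = -1" by (simp add: field_simps)
      with q[of "- (A + 1) / (2 * B)"] True show False by simp
    qed
    then show ?thesis using True by simp
  next
    case False
    then have C: "C > 0" using pos by simp
    have "A + 2 * (- B / C) * B + (- B / C)\<^sup>2 * C = A - B\<^sup>2 / C"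
      using C by (simp add: field_simps power2_eq_square)
    with q[of "- B / C"] have "B\<^sup>2 / C \<le> A" by simp
    then show ?thesis using C by (simp add: field_simps)
  qed
  then have "sqrt (B\<^sup>2) \<le> sqrt (A * C)" by (rule real_sqrt_le_mono)
  then show ?thesis by (simp add: l2norm_def A_B_C_def real_sqrt_mult)
qed

lemma l2norm_triangle:
  assumes "sqint M f" "sqint M g"
  shows "l2norm M (\<lambda>x. f x + g x) \<le> l2norm M f + l2norm M g"
proof (rule power2_le_imp_le)
  have "(l2norm M (\<lambda>x. f x + g x))\<^sup>2 = (LINT x|M. (f x)\<^sup>2 + 2 * (f x * g x) + (g x)\<^sup>2)"
    unfolding l2norm_power2
    by (rule Bochner_Integration.integral_cong) (auto simp: power2_eq_square algebra_simps)
  also have "\<dots> = (l2norm M f)\<^sup>2 + 2 * (LINT x|M. f x * g x) + (l2norm M g)\<^sup>2"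
    using assms sqint_mult_integrable[OF assms] by (simp add: l2norm_power2 sqint_def)
  also have "\<dots> \<le> (l2norm M f + l2norm M g)\<^sup>2"
    using l2_Cauchy_Schwarz[OF assms] by (simp add: power2_sum)
  finally show "(l2norm M (\<lambda>x. f x + g x))\<^sup>2 \<le> (l2norm M f + l2norm M g)\<^sup>2" .
qed simp

lemma l2norm_minus_commute: "l2norm M (\<lambda>x. f x - g x) = l2norm M (\<lambda>x. g x - f x)"
  by (simp add: l2norm_def power2_commute)

lemma l2norm_triangle_diff:
  assumes "sqint M f" "sqint M g" "sqint M h"
  shows "l2norm M (\<lambda>x. f x - h x) \<le> l2norm M (\<lambda>x. f x - g x) + l2norm M (\<lambda>x. g x - h x)"
  using l2norm_triangle[OF sqint_diff[OF assms(1,2)] sqint_diff[OF assms(2,3)]] by simp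

lemma l2norm_tendsto_iff:
  "((\<lambda>n. l2norm M (f n)) \<longlongrightarrow> 0) F \<longleftrightarrow> ((\<lambda>n. LINT x|M. (f n x)\<^sup>2) \<longlongrightarrow> 0) F"
proof
  assume "((\<lambda>n. l2norm M (f n)) \<longlongrightarrow> 0) F"
  from tendsto_power[OF this, of 2] show "((\<lambda>n. LINT x|M. (f n x)\<^sup>2) \<longlongrightarrow> 0) F"
    by (simp add: l2norm_power2)
next
  assume "((\<lambda>n. LINT x|M. (f n x)\<^sup>2) \<longlongrightarrow> 0) F"
  from tendsto_real_sqrt[OF this] show "((\<lambda>n. l2norm M (f n)) \<longlongrightarrow> 0) F" by (simp add: l2norm_def)
qed

lemma l2_tendsto_integral_mult:
  assumes "\<And>n. sqint M (f n)" "sqint M f0" "sqint M g"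
    and lim: "((\<lambda>n. l2norm M (\<lambda>x. f n x - f0 x)) \<longlongrightarrow> 0) F"
  shows "((\<lambda>n. LINT x|M. f n x * g x) \<longlongrightarrow> (LINT x|M. f0 x * g x)) F"
proof -
  have "((\<lambda>n. (LINT x|M. f n x * g x) - (LINT x|M. f0 x * g x)) \<longlongrightarrow> 0) F"
  proof (rule Lim_null_comparison)
    show "((\<lambda>n. l2norm M (\<lambda>x. f n x - f0 x) * l2norm M g) \<longlongrightarrow> 0) F"
      using tendsto_mult_left_zero[OF lim] .
    have "(LINT x|M. f n x * g x) - (LINT x|M. f0 x * g x) = (LINT x|M. (f n x - f0 x) * g x)" for n
      using assms by (simp add: left_diff_distrib sqint_mult_integrable)
    then show "\<forall>\<^sub>F n in F. norm ((LINT x|M. f n x * g x) - (LINT x|M. f0 x * g x))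
        \<le> l2norm M (\<lambda>x. f n x - f0 x) * l2norm M g"
      using l2_Cauchy_Schwarz[OF sqint_diff[OF assms(1,2)] assms(3)] by simp
  qed
  then show ?thesis by (simp add: LIM_zero_iff)
qed

lemma l2_tendsto_l2norm:
  assumes "\<And>n. sqint M (f n)" "sqint M f0"
    and lim: "((\<lambda>n. l2norm M (\<lambda>x. f n x - f0 x)) \<longlongrightarrow> 0) F"
  shows "((\<lambda>n. l2norm M (f n)) \<longlongrightarrow> l2norm M f0) F"
proof -
  have "((\<lambda>n. l2norm M (f n) - l2norm M f0) \<longlongrightarrow> 0) F"
  proof (rule Lim_null_comparison[OF always_eventually lim], rule allI)
    fix n
    have "l2norm M (f n) \<le> l2norm M (\<lambda>x. f n x - f0 x) + l2norm M f0"
      using l2norm_triangle_diff[OF assms(1)[of n] assms(2) sqint_zero] by simp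
    moreover have "l2norm M f0 \<le> l2norm M (\<lambda>x. f n x - f0 x) + l2norm M (f n)"
      using l2norm_triangle_diff[OF assms(2) assms(1)[of n] sqint_zero] l2norm_minus_commute[of M f0 "f n"]
      by simp
    ultimately show "norm (l2norm M (f n) - l2norm M f0) \<le> l2norm M (\<lambda>x. f n x - f0 x)" by simp
  qed
  then show ?thesis by (simp add: LIM_zero_iff)
qed

text \<open>The factor \<open>4 ^ n\<close> fits the rate: \<open>4^n (1/8)^n = (1/2)^n\<close> is
  summable, so the weighted squares have a finite sum almost everywhere. Their boundedness then
  gives increments of size \<open>(1/2) ^ n\<close> up to a constant, which is again
  summable.\<close>

lemma Riesz_Fischer_AE_subseq:
  fixes f :: "nat \<Rightarrow> 'a \<Rightarrow> real"
  assumes sq: "\<And>n. sqint M (f n)"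
    and d: "\<And>n. (LINT x|M. (f (Suc n) x - f n x)\<^sup>2) \<le> (1/8) ^ n"
  shows "AE x in M. convergent (\<lambda>n. f n x)"
proof -
  have meas [measurable]: "f n \<in> borel_measurable M" for n using sq by (simp add: sqint_def)
  have "(\<integral>\<^sup>+x. (\<Sum>n. ennreal (4 ^ n * (f (Suc n) x - f n x)\<^sup>2)) \<partial>M)
      = (\<Sum>n. (\<integral>\<^sup>+x. ennreal (4 ^ n * (f (Suc n) x - f n x)\<^sup>2) \<partial>M))"
    by (rule nn_integral_suminf) simp
  also have "\<dots> \<le> (\<Sum>n. ennreal ((1/2) ^ n))"
  proof (rule suminf_le)
    fix n
    have i: "integrable M (\<lambda>x. 4 ^ n * (f (Suc n) x - f n x)\<^sup>2)"
      using sqint_diff[OF sq sq] by (auto simp: sqint_def)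
    have "(\<integral>\<^sup>+x. ennreal (4 ^ n * (f (Suc n) x - f n x)\<^sup>2) \<partial>M)
        = ennreal (4 ^ n * (LINT x|M. (f (Suc n) x - f n x)\<^sup>2))"
      by (subst nn_integral_eq_integral[OF i]) auto
    also have "\<dots> \<le> ennreal (4 ^ n * (1/8) ^ n)"
      by (intro ennreal_leI mult_left_mono d) simp
    also have "4 ^ n * (1/8) ^ n = ((1/2) ^ n :: real)" by (simp flip: power_mult_distrib)
    finally show "(\<integral>\<^sup>+x. ennreal (4 ^ n * (f (Suc n) x - f n x)\<^sup>2) \<partial>M) \<le> ennreal ((1/2) ^ n)" .
  qed auto
  also have "\<dots> = ennreal (\<Sum>n. (1/2) ^ n)"
    by (intro suminf_ennreal2) auto
  also have "\<dots> < \<infinity>" by simp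
  finally have "AE x in M. (\<Sum>n. ennreal (4 ^ n * (f (Suc n) x - f n x)\<^sup>2)) \<noteq> \<infinity>"
    by (intro nn_integral_PInf_AE) auto
  then show ?thesis
  proof (rule eventually_mono)
    fix x assume "(\<Sum>n. ennreal (4 ^ n * (f (Suc n) x - f n x)\<^sup>2)) \<noteq> \<infinity>"
    then have "summable (\<lambda>n. 4 ^ n * (f (Suc n) x - f n x)\<^sup>2)"
      by (intro summable_suminf_not_top) auto
    then have "Bseq (\<lambda>n. 4 ^ n * (f (Suc n) x - f n x)\<^sup>2)"
      using summable_LIMSEQ_zero convergent_imp_Bseq convergent_def by blast
    then obtain K where K: "\<And>n. \<bar>4 ^ n * (f (Suc n) x - f n x)\<^sup>2\<bar> \<le> K" "K > 0"
      unfolding Bseq_def by auto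
    have b: "\<bar>f (Suc n) x - f n x\<bar> \<le> sqrt K * (1/2) ^ n" for n
    proof (rule power2_le_imp_le)
      have e: "(sqrt K * (1/2) ^ n)\<^sup>2 = K * (1/4) ^ n"
      proof -
        have "((1/2 :: real) ^ n)\<^sup>2 = (1/4) ^ n" by (simp add: power2_eq_square flip: power_mult_distrib)
        then show ?thesis using K(2) by (simp add: power_mult_distrib)
      qed
      have "(4::real) ^ n * (1/4) ^ n = 1" by (simp flip: power_mult_distrib)
      then have "(f (Suc n) x - f n x)\<^sup>2 = (4 ^ n * (f (Suc n) x - f n x)\<^sup>2) * (1/4) ^ n"
        by (simp add: ac_simps)
      also have "\<dots> \<le> K * (1/4) ^ n" using K(1)[of n] by (intro mult_right_mono) auto
      finally show "\<bar>f (Suc n) x - f n x\<bar>\<^sup>2 \<le> (sqrt K * (1/2) ^ n)\<^sup>2" unfolding e by simp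
    qed (use K in simp)
    have "summable (\<lambda>n. f (Suc n) x - f n x)"
      by (rule summable_comparison_test'[where N = 0 and g = "\<lambda>n. sqrt K * (1/2) ^ n"])
        (use b in \<open>auto intro!: summable_mult summable_geometric\<close>)
    then have "convergent (\<lambda>n. \<Sum>i<n. f (Suc i) x - f i x)" by (simp add: summable_iff_convergent)
    then have "convergent (\<lambda>n. f n x - f 0 x)" by (simp only: sum_lessThan_telescope[of "\<lambda>n. f n x"])
    then show "convergent (\<lambda>n. f n x)" using convergent_add_const_right_iff[of "\<lambda>n. f n x" "- f 0 x"] by simp
  qed
qed

text \<open>The limit is taken along a fast subsequence, which converges almost everywhere; Fatou's
  lemma along it then estimates \<open>f n - g\<close> for all large \<open>n\<close>, not only for
  the members of the subsequence.\<close>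

lemma Riesz_Fischer:
  fixes f :: "nat \<Rightarrow> 'a \<Rightarrow> real"
  assumes sq: "\<And>n. sqint M (f n)"
    and Cauchy: "\<And>e. e > 0 \<Longrightarrow> \<exists>N. \<forall>m\<ge>N. \<forall>n\<ge>N. (LINT x|M. (f m x - f n x)\<^sup>2) < e"
  obtains g where "sqint M g" "(\<lambda>n. l2norm M (\<lambda>x. f n x - g x)) \<longlonglongrightarrow> 0"
proof -
  have meas [measurable]: "f n \<in> borel_measurable M" for n using sq by (simp add: sqint_def)
  have "\<exists>N. \<forall>m\<ge>N. \<forall>n\<ge>N. (LINT x|M. (f m x - f n x)\<^sup>2) < (1/8) ^ k" for k :: nat
    by (rule Cauchy) simp
  then obtain N where N: "\<And>k m n. m \<ge> N k \<Longrightarrow> n \<ge> N k \<Longrightarrow> (LINT x|M. (f m x - f n x)\<^sup>2) < (1/8) ^ k"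
    by metis
  \<comment> \<open>The sum makes both \<open>r k\<close> and \<open>r (Suc k)\<close> at least
    \<open>N k\<close> although \<open>N\<close> need not be monotone; the summand \<open>k\<close>
    makes \<open>r\<close> unbounded, as the passage to the limit inferior needs.\<close>
  define r where "r k = (\<Sum>i\<le>k. N i) + k" for k
  have rN: "r k \<ge> N k" for k by (simp add: r_def trans_le_add1 member_le_sum)
  have rS: "r (Suc k) \<ge> N k" for k using rN[of k] by (simp add: r_def)
  have rk: "r k \<ge> k" for k by (simp add: r_def)
  have conv: "AE x in M. convergent (\<lambda>k. f (r k) x)"
    by (rule Riesz_Fischer_AE_subseq[OF sq]) (use N rN rS less_imp_le in blast)
  define g where "g x = lim (\<lambda>k. f (r k) x)" for x
  have [measurable]: "g \<in> borel_measurable M" unfolding g_def[abs_def] by measurable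
  have lim: "AE x in M. (\<lambda>k. f (r k) x) \<longlonglongrightarrow> g x"
    using conv by (auto simp: g_def convergent_LIMSEQ_iff elim!: eventually_mono)
  have est: "(\<integral>\<^sup>+x. ennreal ((f n x - g x)\<^sup>2) \<partial>M) \<le> ennreal ((1/8) ^ k)" if "n \<ge> N k" for n k
  proof -
    have "(\<integral>\<^sup>+x. ennreal ((f n x - g x)\<^sup>2) \<partial>M) = (\<integral>\<^sup>+x. liminf (\<lambda>j. ennreal ((f n x - f (r j) x)\<^sup>2)) \<partial>M)"
    proof (rule nn_integral_cong_AE, use lim in eventually_elim)
      case (elim x)
      have "(\<lambda>j. ennreal ((f n x - f (r j) x)\<^sup>2)) \<longlonglongrightarrow> ennreal ((f n x - g x)\<^sup>2)"
        by (intro tendsto_ennrealI tendsto_intros elim)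
      from lim_imp_Liminf[OF _ this] show ?case by simp
    qed
    also have "\<dots> \<le> liminf (\<lambda>j. \<integral>\<^sup>+x. ennreal ((f n x - f (r j) x)\<^sup>2) \<partial>M)"
      by (rule nn_integral_liminf) simp
    also have "\<dots> \<le> ennreal ((1/8) ^ k)"
    proof (rule Liminf_le)
      show "\<forall>\<^sub>F j in sequentially. (\<integral>\<^sup>+x. ennreal ((f n x - f (r j) x)\<^sup>2) \<partial>M) \<le> ennreal ((1/8) ^ k)"
        using eventually_ge_at_top[of "N k"]
      proof eventually_elim
        case (elim j)
        have "(\<integral>\<^sup>+x. ennreal ((f n x - f (r j) x)\<^sup>2) \<partial>M) = ennreal (LINT x|M. (f n x - f (r j) x)\<^sup>2)"
          using sqint_diff[OF sq sq] by (intro nn_integral_eq_integral) (auto simp: sqint_def)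
        also have "\<dots> \<le> ennreal ((1/8) ^ k)"
          using N[OF that, of "r j"] elim rk[of j] by (intro ennreal_leI) simp
        finally show ?case .
      qed
    qed simp
    finally show ?thesis .
  qed
  have sqd: "sqint M (\<lambda>x. f n x - g x)" if "n \<ge> N k" for n k
    unfolding sqint_def using est[OF that] by (auto simp: integrable_iff_bounded intro: le_less_trans)
  have sqg: "sqint M g"
    using sqint_diff[OF sq[of "N 0"] sqd[of 0 "N 0"]] by simp
  show thesis
  proof
    show "sqint M g" by (fact sqg)
    show "(\<lambda>n. l2norm M (\<lambda>x. f n x - g x)) \<longlonglongrightarrow> 0"
      unfolding l2norm_tendsto_iff
    proof (rule LIMSEQ_I)
      fix e :: real assume "e > 0"
      then obtain k :: nat where k: "(1/8) ^ k < e" using real_arch_pow_inv[of e "1/8"] by auto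
      have "(LINT x|M. (f n x - g x)\<^sup>2) \<le> (1/8) ^ k" if "n \<ge> N k" for n
        using est[OF that] sqint_diff[OF sq sqg]
        by (subst (asm) nn_integral_eq_integral) (auto simp: sqint_def)
      then show "\<exists>no. \<forall>n\<ge>no. norm ((LINT x|M. (f n x - g x)\<^sup>2) - 0) < e"
        using k by (intro exI[of _ "N k"]) fastforce
    qed
  qed
qed

section \<open>Continuity of translations\<close>

lemma lborel_distr_translate: "distr lborel borel (\<lambda>x. h + x) = (lborel :: 'a::euclidean_space measure)"
  using lborel_affine[of 1 h] by (simp add: density_1)

lemma
  fixes f :: "'a::euclidean_space \<Rightarrow> real"
  assumes "integrable lborel f"
  shows integrable_translate: "integrable lborel (\<lambda>x. f (h + x))"
    and integral_translate: "(LINT x|lborel. f (h + x)) = (LINT x|lborel. f x)"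
proof -
  have [measurable]: "f \<in> borel_measurable borel" using borel_measurable_integrable[OF assms] by simp
  have "integrable (distr lborel borel (\<lambda>x. h + x)) f" using assms by (simp add: lborel_distr_translate)
  then show "integrable lborel (\<lambda>x. f (h + x))" by (subst (asm) integrable_distr_eq) auto
  have "(LINT x|distr lborel borel (\<lambda>x. h + x). f x) = (LINT x|lborel. f (h + x))"
    by (rule integral_distr) auto
  then show "(LINT x|lborel. f (h + x)) = (LINT x|lborel. f x)" by (simp add: lborel_distr_translate)
qed

definition translation_continuous :: "('a::euclidean_space \<Rightarrow> real) \<Rightarrow> bool" where
  "translation_continuous f \<longleftrightarrow> ((\<lambda>h. LINT x|lborel. \<bar>f (h + x) - f x\<bar>) \<longlongrightarrow> 0) (at 0)"

lemma translation_continuous_approx: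
  fixes f :: "'a::euclidean_space \<Rightarrow> real"
  assumes f: "integrable lborel f"
    and appr: "\<And>e. e > 0 \<Longrightarrow> \<exists>g. integrable lborel g \<and> translation_continuous g \<and>
      (LINT x|lborel. \<bar>f x - g x\<bar>) < e"
  shows "translation_continuous f"
  unfolding translation_continuous_def
proof (rule tendstoI)
  fix e :: real assume "e > 0"
  then obtain g where g: "integrable lborel g" "translation_continuous g" "(LINT x|lborel. \<bar>f x - g x\<bar>) < e / 3"
    using appr[of "e/3"] by auto
  have "\<forall>\<^sub>F h in at 0. dist (LINT x|lborel. \<bar>g (h + x) - g x\<bar>) 0 < e / 3"
    using g(2) \<open>e > 0\<close> unfolding translation_continuous_def by (intro tendstoD) auto
  then show "\<forall>\<^sub>F h in at 0. dist (LINT x|lborel. \<bar>f (h + x) - f x\<bar>) 0 < e"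
  proof eventually_elim
    case (elim h)
    note i = f g(1) integrable_translate[OF f, of h] integrable_translate[OF g(1), of h]
    have "(LINT x|lborel. \<bar>f (h + x) - f x\<bar>)
        \<le> (LINT x|lborel. \<bar>f (h + x) - g (h + x)\<bar> + \<bar>g (h + x) - g x\<bar> + \<bar>f x - g x\<bar>)"
      using i by (intro integral_mono) auto
    also have "\<dots> = (LINT x|lborel. \<bar>f (h + x) - g (h + x)\<bar>) + (LINT x|lborel. \<bar>g (h + x) - g x\<bar>)
        + (LINT x|lborel. \<bar>f x - g x\<bar>)"
      using i by simp
    also have "(LINT x|lborel. \<bar>f (h + x) - g (h + x)\<bar>) = (LINT x|lborel. \<bar>f x - g x\<bar>)"
      using f g(1) by (intro integral_translate[where f = "\<lambda>x. \<bar>f x - g x\<bar>"]) auto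
    finally show ?case using elim g(3) by simp
  qed
qed

text \<open>Translation preserves the integral, so the integral of the absolute difference is twice
  that of its one-sided part. This part lives on \<open>U\<close>, hence is dominated by the
  indicator, and at each point of \<open>U\<close> it vanishes for small shifts because
  \<open>U\<close> is open.\<close>

lemma translation_continuous_open:
  fixes U :: "'a::euclidean_space set"
  assumes "open U" "emeasure lborel U < \<infinity>"
  shows "translation_continuous (indicator U)"
  unfolding translation_continuous_def tendsto_at_iff_sequentially comp_def
proof (intro allI impI)
  fix h :: "nat \<Rightarrow> 'a" assume h: "h \<longlonglongrightarrow> 0"
  have [measurable]: "U \<in> sets borel" using assms by simp
  let ?f = "indicator U :: 'a \<Rightarrow> real"
  have i: "integrable lborel ?f" using assms by simp
  have it: "integrable lborel (\<lambda>x. ?f (h n + x))" for n by (rule integrable_translate[OF i])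
  have eq: "(LINT x|lborel. \<bar>?f (h n + x) - ?f x\<bar>) = 2 * (LINT x|lborel. max 0 (?f x - ?f (h n + x)))" for n
  proof -
    have "(LINT x|lborel. \<bar>?f (h n + x) - ?f x\<bar>)
        = (LINT x|lborel. 2 * max 0 (?f x - ?f (h n + x)) + (?f (h n + x) - ?f x))"
      by (rule Bochner_Integration.integral_cong) (auto simp: indicator_def)
    also have "\<dots> = 2 * (LINT x|lborel. max 0 (?f x - ?f (h n + x)))
        + ((LINT x|lborel. ?f (h n + x)) - (LINT x|lborel. ?f x))"
      using i it[of n] by simp
    finally show ?thesis using integral_translate[OF i, of "h n"] by simp
  qed
  have "(\<lambda>n. LINT x|lborel. max 0 (?f x - ?f (h n + x))) \<longlonglongrightarrow> (LINT x|(lborel::'a measure). 0)"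
  proof (rule integral_dominated_convergence[where w = ?f])
    show "AE x in lborel. (\<lambda>n. max 0 (?f x - ?f (h n + x))) \<longlonglongrightarrow> 0"
    proof (rule AE_I2)
      fix x
      have "\<forall>\<^sub>F n in sequentially. max 0 (?f x - ?f (h n + x)) = 0"
      proof (cases "x \<in> U")
        case True
        have "(\<lambda>n. h n + x) \<longlonglongrightarrow> 0 + x" by (intro tendsto_intros h)
        then have "\<forall>\<^sub>F n in sequentially. h n + x \<in> U" using assms(1) True by (auto simp: tendsto_def)
        then show ?thesis by eventually_elim (simp add: True)
      qed simp
      then show "(\<lambda>n. max 0 (?f x - ?f (h n + x))) \<longlonglongrightarrow> 0" by (rule tendsto_eventually)
    qed
    show "AE x in lborel. norm (max 0 (?f x - ?f (h n + x))) \<le> ?f x" for n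
      by (auto simp: indicator_def)
  qed (use i it in auto)
  from tendsto_mult_right_zero[OF this[simplified], of 2]
  show "(\<lambda>n. LINT x|lborel. \<bar>?f (h n + x) - ?f x\<bar>) \<longlonglongrightarrow> 0" unfolding eq .
qed

text \<open>The property is closed under sums and under limits in mean, so indicators of sets of
  finite measure suffice; outer regularity reduces these to open sets.\<close>

lemma integrable_translation_continuous:
  fixes f :: "'a::euclidean_space \<Rightarrow> real"
  assumes "integrable lborel f"
  shows "translation_continuous f"
  using assms
proof (induction rule: integrable_induct)
  case (base A c)
  have [measurable]: "A \<in> sets borel" using base by simp
  show ?case
  proof (rule translation_continuous_approx)
    show "integrable lborel (\<lambda>x. indicator A x *\<^sub>R c)" using base by simp
    fix e :: real assume "e > 0"
    \<comment> \<open>The summand 1 covers \<open>c = 0\<close> and leaves a strict inequality after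
      multiplication by \<open>\<bar>c\<bar>\<close>.\<close>
    then have e': "e / (\<bar>c\<bar> + 1) > 0" by simp
    obtain U where U: "open U" "A \<subseteq> U" "emeasure lborel (U - A) < ennreal (e / (\<bar>c\<bar> + 1))"
      using outer_regular_lborel[of A, OF _ e'] by auto
    have [measurable]: "U \<in> sets borel" using U by simp
    have "emeasure lborel U \<le> emeasure lborel A + emeasure lborel (U - A)"
      using emeasure_subadditive[of A lborel "U - A"] U(2) by (simp add: Un_absorb1)
    also have "\<dots> < \<infinity>"
      using base less_trans[OF U(3) ennreal_less_top] by (simp add: less_top[symmetric])
    finally have fin: "emeasure lborel U < \<infinity>" .
    have tU: "translation_continuous (\<lambda>x. c * indicator U x)"
    proof -
      have "(LINT x|lborel. \<bar>c * indicator U (h + x) - c * indicator U x\<bar>)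
          = \<bar>c\<bar> * (LINT x|lborel. \<bar>indicator U (h + x) - indicator U x\<bar>)" for h
        by (subst integral_mult_right_zero[symmetric], rule Bochner_Integration.integral_cong)
          (auto simp: abs_mult right_diff_distrib[symmetric])
      then show ?thesis
        using tendsto_mult_right_zero[OF translation_continuous_open[OF U(1) fin, unfolded translation_continuous_def], of "\<bar>c\<bar>"]
        by (simp add: translation_continuous_def)
    qed
    have "(LINT x|lborel. \<bar>indicator A x *\<^sub>R c - c * indicator U x\<bar>) = (LINT x|lborel. \<bar>c\<bar> * indicator (U - A) x)"
      using U(2) by (intro Bochner_Integration.integral_cong) (auto simp: indicator_def)
    also have "\<dots> = \<bar>c\<bar> * measure lborel (U - A)" by simp
    also have "\<dots> \<le> \<bar>c\<bar> * (e / (\<bar>c\<bar> + 1))"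
    proof (rule mult_left_mono)
      have "measure lborel (U - A) = enn2real (emeasure lborel (U - A))" by (simp add: measure_def)
      also have "\<dots> \<le> enn2real (ennreal (e / (\<bar>c\<bar> + 1)))"
        using U(3) by (intro enn2real_mono) auto
      finally show "measure lborel (U - A) \<le> e / (\<bar>c\<bar> + 1)" using e' by simp
    qed simp
    also have "\<dots> < e" using \<open>e > 0\<close> by (simp add: field_simps)
    finally show "\<exists>g. integrable lborel g \<and> translation_continuous g \<and>
        (LINT x|lborel. \<bar>indicator A x *\<^sub>R c - g x\<bar>) < e"
      using tU fin by (intro exI[of _ "\<lambda>x. c * indicator U x"]) auto
  qed
next
  case (add f g)
  show ?case unfolding translation_continuous_def
  proof (rule tendsto_sandwich[OF _ _ tendsto_const])
    show "((\<lambda>h. (LINT x|lborel. \<bar>f (h + x) - f x\<bar>) + (LINT x|lborel. \<bar>g (h + x) - g x\<bar>)) \<longlongrightarrow> 0) (at 0)"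
      using tendsto_add[OF add.IH[unfolded translation_continuous_def]] by simp
    have "(LINT x|lborel. \<bar>f (h + x) + g (h + x) - (f x + g x)\<bar>)
        \<le> (LINT x|lborel. \<bar>f (h + x) - f x\<bar> + \<bar>g (h + x) - g x\<bar>)" for h
      using add.hyps integrable_translate[OF add.hyps(1)] integrable_translate[OF add.hyps(2)]
      by (intro integral_mono) auto
    then show "\<forall>\<^sub>F h in at 0. (LINT x|lborel. \<bar>f (h + x) + g (h + x) - (f x + g x)\<bar>)
        \<le> (LINT x|lborel. \<bar>f (h + x) - f x\<bar>) + (LINT x|lborel. \<bar>g (h + x) - g x\<bar>)"
      using add.hyps integrable_translate[OF add.hyps(1)] integrable_translate[OF add.hyps(2)]
      by simp
  qed simp
next
  case (lim f s)
  show ?case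
  proof (rule translation_continuous_approx[OF lim.hyps(4)])
    fix e :: real assume "e > 0"
    have "(\<lambda>i. LINT x|lborel. \<bar>f x - s i x\<bar>) \<longlonglongrightarrow> (LINT x|(lborel::'a measure). 0)"
    \<comment> \<open>The induction supplies
      \<open>\<bar>s i x\<bar> \<le> 2 * \<bar>f x\<bar>\<close>, whence the factor 3.\<close>
    proof (rule integral_dominated_convergence[where w = "\<lambda>x. 3 * \<bar>f x\<bar>"])
      show "AE x in lborel. (\<lambda>i. \<bar>f x - s i x\<bar>) \<longlonglongrightarrow> 0"
      proof (rule AE_I2)
        fix x
        have "(\<lambda>i. \<bar>f x - s i x\<bar>) \<longlonglongrightarrow> \<bar>f x - f x\<bar>" by (intro tendsto_intros lim.hyps) simp
        then show "(\<lambda>i. \<bar>f x - s i x\<bar>) \<longlonglongrightarrow> 0" by simp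
      qed
      show "AE x in lborel. norm \<bar>f x - s i x\<bar> \<le> 3 * \<bar>f x\<bar>" for i
      proof (rule AE_I2)
        fix x show "norm \<bar>f x - s i x\<bar> \<le> 3 * \<bar>f x\<bar>" using lim.hyps(3)[of x i] by simp
      qed
    qed (use lim.hyps in auto)
    then have "\<forall>\<^sub>F i in sequentially. (LINT x|lborel. \<bar>f x - s i x\<bar>) < e"
      using \<open>e > 0\<close> by (intro order_tendstoD) auto
    then obtain i where "(LINT x|lborel. \<bar>f x - s i x\<bar>) < e" by (auto simp: eventually_sequentially)
    then show "\<exists>g. integrable lborel g \<and> translation_continuous g \<and> (LINT x|lborel. \<bar>f x - g x\<bar>) < e"
      using lim.hyps lim.IH by blast
  qed
qed

text \<open>This carries continuity of translations from \<open>L^1\<close> to \<open>L^2\<close>: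
  the signed square of an \<open>L^2\<close> function is integrable and, unlike the plain square,
  remembers the sign. The factor 2 is attained for \<open>a = - b\<close>.\<close>

lemma power2_diff_le_abs_diff_signed_squares:
  "(b - a)\<^sup>2 \<le> 2 * \<bar>b * \<bar>b\<bar> - a * \<bar>a\<bar>\<bar>" for a b :: real
proof -
  have same: "(b - a)\<^sup>2 \<le> 2 * \<bar>b * b - a * a\<bar>" if "0 \<le> a" "0 \<le> b" for a b :: real
  proof -
    have "\<bar>b - a\<bar> * \<bar>b - a\<bar> \<le> \<bar>b - a\<bar> * (b + a)" using that by (intro mult_left_mono) auto
    also have "\<dots> = \<bar>(b - a) * (b + a)\<bar>" using that by (simp add: abs_mult)
    also have "(b - a) * (b + a) = b * b - a * a" by (simp add: algebra_simps)
    finally have "(b - a)\<^sup>2 \<le> \<bar>b * b - a * a\<bar>" by (simp add: power2_eq_square)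
    then show ?thesis by (rule order_trans) simp
  qed
  have opp: "(b - a)\<^sup>2 \<le> 2 * \<bar>b * b + a * a\<bar>" for a b :: real
    using zero_le_power2[of "b + a"] by (simp add: power2_eq_square algebra_simps)
  consider "0 \<le> a" "0 \<le> b" | "a < 0" "b < 0" | "0 \<le> a" "b < 0" | "a < 0" "0 \<le> b" by linarith
  then show ?thesis
  proof cases
    case 1 then show ?thesis using same[of a b] by simp
  next
    case 2 then show ?thesis using same[of "-a" "-b"] by (simp add: power2_commute abs_minus_commute)
  next
    case 3 then show ?thesis using opp[of b a] by simp
  next
    case 4 then show ?thesis using opp[of b a] by simp
  qed
qed

lemma sqint_translate:
  fixes f :: "'a::euclidean_space \<Rightarrow> real"
  assumes "sqint lborel f"
  shows "sqint lborel (\<lambda>x. f (h + x))"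
proof -
  have [measurable]: "f \<in> borel_measurable borel" using assms by (simp add: sqint_def)
  show ?thesis using integrable_translate[OF sqint_integrable[OF assms]] by (simp add: sqint_def)
qed

lemma l2_translation_continuous:
  fixes f :: "'a::euclidean_space \<Rightarrow> real"
  assumes "sqint lborel f"
  shows "((\<lambda>h. l2norm lborel (\<lambda>x. f (h + x) - f x)) \<longlongrightarrow> 0) (at 0)"
  unfolding l2norm_tendsto_iff
proof (rule tendsto_sandwich[OF _ _ tendsto_const])
  have [measurable]: "f \<in> borel_measurable borel" using assms by (simp add: sqint_def)
  let ?F = "\<lambda>x. f x * \<bar>f x\<bar>"
  have "integrable lborel (\<lambda>x. \<bar>?F x\<bar>)"
    using sqint_integrable[OF assms] by (simp add: abs_mult power2_eq_square)
  then have i: "integrable lborel ?F" by (subst (asm) integrable_abs_iff) auto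
  show "((\<lambda>h. 2 * (LINT x|lborel. \<bar>?F (h + x) - ?F x\<bar>)) \<longlongrightarrow> 0) (at 0)"
    using tendsto_mult_right_zero[OF integrable_translation_continuous[OF i, unfolded translation_continuous_def]]
    by blast
  have "(LINT x|lborel. (f (h + x) - f x)\<^sup>2) \<le> (LINT x|lborel. 2 * \<bar>?F (h + x) - ?F x\<bar>)" for h
    using sqint_integrable[OF sqint_diff[OF sqint_translate[OF assms] assms]] i integrable_translate[OF i]
    by (intro integral_mono power2_diff_le_abs_diff_signed_squares) auto
  then show "\<forall>\<^sub>F h in at 0. (LINT x|lborel. (f (h + x) - f x)\<^sup>2)
      \<le> 2 * (LINT x|lborel. \<bar>?F (h + x) - ?F x\<bar>)" by simp
qed simp

section \<open>The energy inequality\<close>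

lemma nn_integral_lborel_prod:
  fixes F :: "real \<times> real \<Rightarrow> ennreal"
  assumes [measurable]: "F \<in> borel_measurable borel"
  shows "(\<integral>\<^sup>+t. \<integral>\<^sup>+x. F (x, t) \<partial>lborel \<partial>lborel) = (\<integral>\<^sup>+z. F z \<partial>lborel)"
  using lborel_pair.nn_integral_snd[of F] by (simp add: lborel_prod)

lemma integral_lborel_prod:
  fixes F :: "real \<times> real \<Rightarrow> real"
  assumes "integrable lborel F"
  shows "(LINT t|lborel. LINT x|lborel. F (x, t)) = (LINT z|lborel. F z)"
    and "integrable lborel (\<lambda>t. LINT x|lborel. F (x, t))"
  using lborel_pair.integral_snd[of "\<lambda>x t. F (x, t)"] lborel_pair.integrable_snd[of "\<lambda>x t. F (x, t)"] assms
  by (simp_all add: lborel_prod)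

text \<open>The dominating function is \<open>V^2 + g^2\<close>, with \<open>V\<close> shifted by
  \<open>\<tau>\<close> in time. By translation invariance its integral over \<open>(x, t)\<close>
  does not depend on \<open>\<tau>\<close>, so the triple integral is \<open>\<sigma>\<close> times
  the sum of the two squared norms.\<close>

lemma integrable_time_shifted_pairing:
  fixes V g :: "real \<times> real \<Rightarrow> real"
  assumes V: "sqint lborel V" and g: "sqint lborel g" and "0 < \<sigma>"
  shows "integrable (lborel \<Otimes>\<^sub>M lborel)
    (\<lambda>(t, \<tau>). indicator {0<..<\<sigma>} \<tau> * (LINT x|lborel. V (x, t + \<tau>) * g (x, t)))"
proof -
  have [measurable]: "V \<in> borel_measurable borel" "g \<in> borel_measurable borel"
    using V g by (auto simp: sqint_def)
  have Vt: "sqint lborel (\<lambda>z. V ((0, \<tau>) + z))" for \<tau> by (rule sqint_translate[OF V])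
  define W where "W x t \<tau> = indicator {0<..<\<sigma>} \<tau> * ((V (x, t + \<tau>))\<^sup>2 + (g (x, t))\<^sup>2)" for x t \<tau>
  have [measurable]: "(\<lambda>(x, p). W x (fst p) (snd p)) \<in> borel_measurable (lborel \<Otimes>\<^sub>M (lborel \<Otimes>\<^sub>M lborel))"
    unfolding W_def by measurable
  have [measurable]: "(\<lambda>(t, \<tau>). \<integral>\<^sup>+x. ennreal (W x t \<tau>) \<partial>lborel) \<in> borel_measurable (lborel \<Otimes>\<^sub>M lborel)"
    unfolding W_def by measurable
  have W0: "0 \<le> W x t \<tau>" for x t \<tau> by (simp add: W_def)
  have inner: "(\<integral>\<^sup>+t. \<integral>\<^sup>+x. ennreal (W x t \<tau>) \<partial>lborel \<partial>lborel)
      = ennreal (indicator {0<..<\<sigma>} \<tau> * ((LINT z|lborel. (V z)\<^sup>2) + (LINT z|lborel. (g z)\<^sup>2)))" for \<tau>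
  proof -
    have i: "integrable lborel (\<lambda>z. indicator {0<..<\<sigma>} \<tau> * ((V ((0, \<tau>) + z))\<^sup>2 + (g z)\<^sup>2))"
      using sqint_integrable[OF Vt] sqint_integrable[OF g] by simp
    have "(\<integral>\<^sup>+t. \<integral>\<^sup>+x. ennreal (W x t \<tau>) \<partial>lborel \<partial>lborel)
        = (\<integral>\<^sup>+t. \<integral>\<^sup>+x. (\<lambda>z. ennreal (indicator {0<..<\<sigma>} \<tau> * ((V ((0, \<tau>) + z))\<^sup>2 + (g z)\<^sup>2))) (x, t) \<partial>lborel \<partial>lborel)"
      by (simp add: W_def add.commute)
    also have "\<dots> = (\<integral>\<^sup>+z. ennreal (indicator {0<..<\<sigma>} \<tau> * ((V ((0, \<tau>) + z))\<^sup>2 + (g z)\<^sup>2)) \<partial>lborel)"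
      by (rule nn_integral_lborel_prod) measurable
    also have "\<dots> = ennreal (LINT z|lborel. indicator {0<..<\<sigma>} \<tau> * ((V ((0, \<tau>) + z))\<^sup>2 + (g z)\<^sup>2))"
      by (rule nn_integral_eq_integral[OF i]) simp
    also have "(LINT z|lborel. indicator {0<..<\<sigma>} \<tau> * ((V ((0, \<tau>) + z))\<^sup>2 + (g z)\<^sup>2))
        = indicator {0<..<\<sigma>} \<tau> * ((LINT z|lborel. (V ((0, \<tau>) + z))\<^sup>2) + (LINT z|lborel. (g z)\<^sup>2))"
      using sqint_integrable[OF Vt] sqint_integrable[OF g] by simp
    also have "(LINT z|lborel. (V ((0, \<tau>) + z))\<^sup>2) = (LINT z|lborel. (V z)\<^sup>2)"
      by (rule integral_translate[OF sqint_integrable[OF V]])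
    finally show ?thesis .
  qed
  interpret P: pair_sigma_finite "lborel :: real measure" "lborel \<Otimes>\<^sub>M (lborel :: real measure) :: (real \<times> real) measure"
    unfolding lborel_prod by standard
  have "(\<integral>\<^sup>+z. ennreal ((\<lambda>(x, p). W x (fst p) (snd p)) z) \<partial>(lborel \<Otimes>\<^sub>M (lborel \<Otimes>\<^sub>M lborel)))
      = (\<integral>\<^sup>+p. \<integral>\<^sup>+x. ennreal (W x (fst p) (snd p)) \<partial>lborel \<partial>(lborel \<Otimes>\<^sub>M lborel))"
    using P.nn_integral_snd[of "\<lambda>(x, p). ennreal (W x (fst p) (snd p))"] by (simp add: case_prod_unfold)
  also have "\<dots> = (\<integral>\<^sup>+\<tau>. \<integral>\<^sup>+t. \<integral>\<^sup>+x. ennreal (W x t \<tau>) \<partial>lborel \<partial>lborel \<partial>lborel)"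
    using lborel_pair.nn_integral_snd[of "\<lambda>(t, \<tau>). \<integral>\<^sup>+x. ennreal (W x t \<tau>) \<partial>lborel"] by (simp add: case_prod_unfold)
  also have "\<dots> = (\<integral>\<^sup>+\<tau>. ennreal ((LINT z|lborel. (V z)\<^sup>2) + (LINT z|lborel. (g z)\<^sup>2)) * indicator {0<..<\<sigma>} \<tau> \<partial>lborel)"
    unfolding inner by (intro nn_integral_cong) (auto simp: indicator_def)
  also have "\<dots> < \<infinity>"
    using \<open>0 < \<sigma>\<close> by (simp add: nn_integral_cmult_indicator ennreal_mult_less_top)
  finally have iW: "integrable (lborel \<Otimes>\<^sub>M (lborel \<Otimes>\<^sub>M lborel)) (\<lambda>(x, p). W x (fst p) (snd p))"
    using W0 by (intro integrableI_nonneg) auto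
  have "integrable (lborel \<Otimes>\<^sub>M (lborel \<Otimes>\<^sub>M lborel))
      (\<lambda>(x, p). indicator {0<..<\<sigma>} (snd p) * (V (x, fst p + snd p) * g (x, fst p)))"
  proof (rule Bochner_Integration.integrable_bound[OF iW])
    show "(\<lambda>(x, p). indicator {0<..<\<sigma>} (snd p) * (V (x, fst p + snd p) * g (x, fst p)))
        \<in> borel_measurable (lborel \<Otimes>\<^sub>M (lborel \<Otimes>\<^sub>M lborel))" by measurable
    have "\<bar>v * w\<bar> \<le> v\<^sup>2 + w\<^sup>2" for v w :: real
    proof -
      have "2 * \<bar>v\<bar> * \<bar>w\<bar> \<le> v\<^sup>2 + w\<^sup>2" using zero_le_power2[of "\<bar>v\<bar> - \<bar>w\<bar>"] by (simp add: power2_diff)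
      moreover have "0 \<le> \<bar>v\<bar> * \<bar>w\<bar>" by simp
      ultimately have "\<bar>v\<bar> * \<bar>w\<bar> \<le> v\<^sup>2 + w\<^sup>2" by linarith
      then show ?thesis by (simp only: abs_mult)
    qed
    then show "AE z in lborel \<Otimes>\<^sub>M (lborel \<Otimes>\<^sub>M lborel).
        norm ((\<lambda>(x, p). indicator {0<..<\<sigma>} (snd p) * (V (x, fst p + snd p) * g (x, fst p))) z)
        \<le> norm ((\<lambda>(x, p). W x (fst p) (snd p)) z)"
      by (intro AE_I2) (auto simp: W_def indicator_def)
  qed
  from P.integrable_snd[OF this] show ?thesis by (simp add: case_prod_unfold)
qed

text \<open>After the exchange, the integrand at a fixed shift is a pairing of two functions on the
  plane, whose limit for shift zero is controlled by the continuity of translations.\<close>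

lemma Fubini_time_shifted_pairing:
  fixes V g :: "real \<times> real \<Rightarrow> real"
  assumes V: "sqint lborel V" and g: "sqint lborel g" and "0 < \<sigma>"
  shows "integrable lborel (\<lambda>t. (LINT \<tau>:{0<..<\<sigma>}|lborel. LINT x|lborel. V (x, t + \<tau>) * g (x, t)))"
    and "(LINT t|lborel. (LINT \<tau>:{0<..<\<sigma>}|lborel. LINT x|lborel. V (x, t + \<tau>) * g (x, t)))
      = (LINT \<tau>:{0<..<\<sigma>}|lborel. LINT z|lborel. V ((0, \<tau>) + z) * g z)"
    and "set_integrable lborel {0<..<\<sigma>} (\<lambda>\<tau>. LINT z|lborel. V ((0, \<tau>) + z) * g z)"
proof -
  note i = integrable_time_shifted_pairing[OF assms]
  have eq: "(LINT t|lborel. LINT x|lborel. V (x, t + \<tau>) * g (x, t)) = (LINT z|lborel. V ((0, \<tau>) + z) * g z)" for \<tau>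
    using integral_lborel_prod(1)[OF sqint_mult_integrable[OF sqint_translate[OF V, of "(0, \<tau>)"] g]]
    by (simp add: add.commute)
  show "integrable lborel (\<lambda>t. (LINT \<tau>:{0<..<\<sigma>}|lborel. LINT x|lborel. V (x, t + \<tau>) * g (x, t)))"
    using lborel_pair.integrable_fst[OF i] by (simp add: set_lebesgue_integral_def)
  show "(LINT t|lborel. (LINT \<tau>:{0<..<\<sigma>}|lborel. LINT x|lborel. V (x, t + \<tau>) * g (x, t)))
      = (LINT \<tau>:{0<..<\<sigma>}|lborel. LINT z|lborel. V ((0, \<tau>) + z) * g z)"
    using lborel_pair.Fubini_integral[OF i] by (simp add: set_lebesgue_integral_def eq)
  show "set_integrable lborel {0<..<\<sigma>} (\<lambda>\<tau>. LINT z|lborel. V ((0, \<tau>) + z) * g z)"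
    using lborel_pair.integrable_snd[OF i] by (simp add: set_integrable_def eq)
qed

lemma pairing_translation_tendsto:
  fixes V g :: "'a::euclidean_space \<Rightarrow> real"
  assumes V: "sqint lborel V" and g: "sqint lborel g"
  shows "((\<lambda>h. LINT z|lborel. V (h + z) * g z) \<longlongrightarrow> (LINT z|lborel. V z * g z)) (at 0)"
  by (rule l2_tendsto_integral_mult[OF sqint_translate[OF V] V g l2_translation_continuous[OF V]])

text \<open>An integrated form of \<open>(\<psi> J)' = \<psi>' J + 2 \<psi> (V, G)\<close>. The
  hypothesis \<open>key\<close> is multiplied by \<open>\<psi> t\<close> and integrated over
  \<open>t\<close>; shifting the term with \<open>J (t + \<sigma>)\<close> by
  \<open>\<sigma>\<close> moves the difference onto \<open>\<psi>\<close>, and division by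
  \<open>\<sigma>\<close> followed by \<open>\<sigma> \<rightarrow> 0\<close> gives the claim. Times
  within \<open>\<sigma>\<close> of the end are compared with \<open>JT\<close>, which becomes the
  boundary term.\<close>

lemma energy_inequality:
  fixes V G :: "real \<times> real \<Rightarrow> real" and J \<psi> \<psi>' :: "real \<Rightarrow> real"
  assumes T: "0 < T" and V: "sqint lborel V" and G: "sqint lborel G"
    and J: "set_integrable lborel {0<..<T} J" and J0: "\<And>t. 0 \<le> J t" and JT: "0 \<le> JT"
    and \<psi>: "\<And>t. (\<psi> has_real_derivative \<psi>' t) (at t)" "continuous_on {0..T} \<psi>'"
      "\<And>t. t \<in> {0..T} \<Longrightarrow> 0 \<le> \<psi> t"
    and key: "\<And>\<sigma>. 0 < \<sigma> \<Longrightarrow> \<sigma> < T \<Longrightarrow> AE t in lborel. t \<in> {0<..<T} \<longrightarrow>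
      2 * (LINT \<tau>:{0<..<\<sigma>}|lborel. LINT x|lborel. V (x, t + \<tau>) * G (x, t))
        \<le> (if t + \<sigma> < T then J (t + \<sigma>) else JT) - J t"
  shows "(LINT t:{0<..<T}|lborel. \<psi>' t * J t)
    + 2 * (LINT t:{0<..<T}|lborel. \<psi> t * (LINT x|lborel. V (x, t) * G (x, t))) \<le> \<psi> T * JT"
proof -
  have [measurable]: "V \<in> borel_measurable borel" "G \<in> borel_measurable borel"
    using V G by (auto simp: sqint_def)
  have c\<psi>: "continuous_on A \<psi>" for A
    using \<psi>(1) by (meson DERIV_isCont continuous_at_imp_continuous_on)
  then have [measurable]: "\<psi> \<in> borel_measurable borel"
    by (intro borel_measurable_continuous_onI)
  have "compact (\<psi>' ` {0..T})" "compact (\<psi> ` {0..T})"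
    using \<psi>(2) c\<psi> by (auto intro!: compact_continuous_image)
  then obtain K K' where "\<forall>y\<in>\<psi>' ` {0..T}. norm y \<le> K" "\<forall>y\<in>\<psi> ` {0..T}. norm y \<le> K'"
    using compact_imp_bounded bounded_iff by metis
  then have K: "\<bar>\<psi>' t\<bar> \<le> K" and K': "\<bar>\<psi> t\<bar> \<le> K'" if "t \<in> {0..T}" for t using that by auto
  have lip: "\<bar>\<psi> s - \<psi> t\<bar> \<le> K * \<bar>s - t\<bar>" if "s \<in> {0..T}" "t \<in> {0..T}" for s t
  proof -
    have *: "\<bar>\<psi> s - \<psi> t\<bar> \<le> K * \<bar>s - t\<bar>" if st: "s < t" "s \<in> {0..T}" "t \<in> {0..T}" for s t
    proof -
      obtain z where z: "s < z" "z < t" "\<psi> t - \<psi> s = (t - s) * \<psi>' z"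
        using MVT2[OF st(1), of \<psi> \<psi>'] \<psi>(1) by blast
      then have "\<bar>\<psi> t - \<psi> s\<bar> = \<bar>t - s\<bar> * \<bar>\<psi>' z\<bar>" by (simp add: abs_mult)
      also have "\<dots> \<le> \<bar>t - s\<bar> * K" using z st by (intro mult_left_mono K) auto
      finally show ?thesis by (simp add: abs_minus_commute mult.commute)
    qed
    show ?thesis
      using *[of s t] *[of t s] that by (cases s t rule: linorder_cases) (auto simp: abs_minus_commute)
  qed
  define J1 where "J1 t = indicator {0<..<T} t * J t" for t
  have J1: "integrable lborel J1" using J by (simp add: set_integrable_def J1_def[abs_def])
  have [measurable]: "J1 \<in> borel_measurable borel" using borel_measurable_integrable[OF J1] by simp
  have J1_nonneg: "0 \<le> J1 t" for t by (simp add: J1_def J0)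
  define g where "g z = indicator {0<..<T} (snd z) * \<psi> (snd z) * G z" for z :: "real \<times> real"
  have [measurable]: "(snd :: real \<times> real \<Rightarrow> real) \<in> borel_measurable borel"
    by (intro borel_measurable_continuous_onI continuous_intros)
  have [measurable]: "g \<in> borel_measurable borel" unfolding g_def[abs_def] by measurable
  have g: "sqint lborel g"
  proof -
    have "integrable lborel (\<lambda>z. (g z)\<^sup>2)"
    proof (rule Bochner_Integration.integrable_bound)
      show "integrable lborel (\<lambda>z. K'\<^sup>2 * (G z)\<^sup>2)" using sqint_integrable[OF G] by simp
      have "(\<psi> t)\<^sup>2 \<le> K'\<^sup>2" if "t \<in> {0<..<T}" for t
        using K'[of t] that power_mono[of "\<bar>\<psi> t\<bar>" K' 2] by simp
      then show "AE z in lborel. norm ((g z)\<^sup>2) \<le> norm (K'\<^sup>2 * (G z)\<^sup>2)"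
        by (intro AE_I2) (auto simp: g_def indicator_def power_mult_distrib intro!: mult_right_mono)
    qed measurable
    then show ?thesis by (simp add: sqint_def)
  qed
  define \<Phi> where "\<Phi> \<tau> = (LINT z|lborel. V ((0, \<tau>) + z) * g z)" for \<tau>
  have \<Phi>0: "\<Phi> 0 = (LINT t:{0<..<T}|lborel. \<psi> t * (LINT x|lborel. V (x, t) * G (x, t)))"
  proof -
    have "\<Phi> 0 = (LINT t|lborel. LINT x|lborel. V (x, t) * g (x, t))"
      using integral_lborel_prod(1)[OF sqint_mult_integrable[OF V g]] by (simp add: \<Phi>_def flip: zero_prod_def)
    also have "\<dots> = (LINT t:{0<..<T}|lborel. \<psi> t * (LINT x|lborel. V (x, t) * G (x, t)))"
      unfolding set_lebesgue_integral_def
    proof (rule Bochner_Integration.integral_cong[OF refl])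
      fix t
      have "(LINT x|lborel. V (x, t) * g (x, t)) = (LINT x|lborel. (indicator {0<..<T} t * \<psi> t) * (V (x, t) * G (x, t)))"
        by (rule Bochner_Integration.integral_cong) (auto simp: g_def)
      also have "\<dots> = indicator {0<..<T} t * \<psi> t * (LINT x|lborel. V (x, t) * G (x, t))"
        by (rule integral_mult_right_zero)
      finally show "(LINT x|lborel. V (x, t) * g (x, t))
          = indicator {0<..<T} t *\<^sub>R (\<psi> t * (LINT x|lborel. V (x, t) * G (x, t)))" by simp
    qed
    finally show ?thesis .
  qed
  have \<Phi>_lim: "(\<Phi> \<longlongrightarrow> \<Phi> 0) (at 0)"
  proof -
    have "filterlim (\<lambda>\<tau>. (0::real, \<tau>)) (at 0) (at (0::real))"
      by (rule filterlim_atI) (auto intro!: tendsto_eq_intros simp: zero_prod_def eventually_at_filter)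
    from filterlim_compose[OF pairing_translation_tendsto[OF V g] this] show ?thesis
      by (simp add: \<Phi>_def[abs_def] flip: zero_prod_def)
  qed
  \<comment> \<open>The 2 keeps every step strictly below \<open>T\<close>, as \<open>key\<close>
    demands, also for \<open>n = 0\<close>.\<close>
  define \<sigma> where "\<sigma> n = T / (real n + 2)" for n
  have \<sigma>: "0 < \<sigma> n" "\<sigma> n < T" for n using T by (auto simp: \<sigma>_def field_simps add_pos_nonneg)
  have \<sigma>lim: "\<sigma> \<longlonglongrightarrow> 0" unfolding \<sigma>_def[abs_def] by real_asymp
  \<comment> \<open>The backward difference quotient of \<open>\<psi>\<close>, divided by the
    positive step. It is set to 0 for \<open>t \<le> \<sigma> n\<close>, where only a term
    \<open>- \<psi> t * J1 t\<close> would stand; that term is dropped by its sign, and with it the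
    boundary contribution at time 0.\<close>
  define D where "D n t = indicator {0<..<T} t * (if \<sigma> n < t then (\<psi> (t - \<sigma> n) - \<psi> t) / \<sigma> n else 0)" for n t
  have [measurable]: "D n \<in> borel_measurable borel" for n unfolding D_def[abs_def] by measurable
  have DK: "\<bar>D n t\<bar> \<le> K" for n t
  proof -
    have K0: "0 \<le> K" using K[of 0] T by auto
    show ?thesis
    proof (cases "t \<in> {0<..<T} \<and> \<sigma> n < t")
      case True
      then have "\<bar>\<psi> (t - \<sigma> n) - \<psi> t\<bar> \<le> K * \<sigma> n" using lip[of "t - \<sigma> n" t] \<sigma>[of n] by auto
      then show ?thesis using True \<sigma>[of n] by (simp add: D_def field_simps)
    qed (use K0 in \<open>auto simp: D_def\<close>)
  qed
  have iDJ: "integrable lborel (\<lambda>t. D n t * J1 t)" for n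
  proof (rule Bochner_Integration.integrable_bound)
    show "integrable lborel (\<lambda>t. K * J1 t)" using J1 by simp
    show "AE t in lborel. norm (D n t * J1 t) \<le> norm (K * J1 t)"
      using DK J1_nonneg by (intro AE_I2) (auto simp: abs_mult intro!: mult_right_mono intro: order_trans[OF _ abs_ge_self])
  qed measurable
  have D_lim: "(\<lambda>n. LINT t|lborel. D n t * J1 t) \<longlonglongrightarrow> (LINT t|lborel. - (\<psi>' t) * J1 t)"
  proof (rule integral_dominated_convergence[where w = "\<lambda>t. K * J1 t"])
    show "AE t in lborel. (\<lambda>n. D n t * J1 t) \<longlonglongrightarrow> - (\<psi>' t) * J1 t"
    proof (rule AE_I2)
      fix t
      show "(\<lambda>n. D n t * J1 t) \<longlonglongrightarrow> - (\<psi>' t) * J1 t"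
      proof (cases "t \<in> {0<..<T}")
        case True
        have "((\<lambda>h. (\<psi> (t + h) - \<psi> t) / h) \<longlongrightarrow> \<psi>' t) (at 0)" using \<psi>(1)[of t] by (simp add: DERIV_def)
        moreover have "filterlim (\<lambda>n. - \<sigma> n) (at 0) sequentially"
          using \<sigma> by (intro filterlim_atI) (auto intro!: tendsto_eq_intros \<sigma>lim simp: less_imp_neq[symmetric])
        ultimately have "(\<lambda>n. (\<psi> (t + (- \<sigma> n)) - \<psi> t) / (- \<sigma> n)) \<longlonglongrightarrow> \<psi>' t" by (rule filterlim_compose)
        then have lim: "(\<lambda>n. (\<psi> (t - \<sigma> n) - \<psi> t) / \<sigma> n) \<longlonglongrightarrow> - \<psi>' t"
          using tendsto_minus_cancel_left by fastforce
        have "\<forall>\<^sub>F n in sequentially. \<sigma> n < t" using True \<sigma>lim by (intro order_tendstoD) auto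
        then have "\<forall>\<^sub>F n in sequentially. (\<psi> (t - \<sigma> n) - \<psi> t) / \<sigma> n = D n t"
          by eventually_elim (use True in \<open>simp add: D_def\<close>)
        from Lim_transform_eventually[OF lim this] show ?thesis by (intro tendsto_mult_right)
      qed (simp add: D_def J1_def)
    qed
    show "AE t in lborel. norm (D n t * J1 t) \<le> K * J1 t" for n
      using DK J1_nonneg by (intro AE_I2) (auto simp: abs_mult intro!: mult_right_mono)
    show "integrable lborel (\<lambda>t. K * J1 t)" using J1 by simp
    have "(\<lambda>t. indicator {0..T} t *\<^sub>R \<psi>' t) \<in> borel_measurable lborel"
      using borel_measurable_continuous_on_indicator[OF _ \<psi>(2)] by simp
    then have "(\<lambda>t. - (indicator {0..T} t *\<^sub>R \<psi>' t) * J1 t) \<in> borel_measurable lborel" by measurable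
    also have "(\<lambda>t. - (indicator {0..T} t *\<^sub>R \<psi>' t) * J1 t) = (\<lambda>t. - (\<psi>' t) * J1 t)"
      by (auto simp: fun_eq_iff J1_def indicator_def)
    finally show "(\<lambda>t. - (\<psi>' t) * J1 t) \<in> borel_measurable lborel" .
  qed measurable
  have step: "2 * (LINT \<tau>:{0<..<\<sigma> n}|lborel. \<Phi> \<tau>)
      \<le> \<sigma> n * (LINT t|lborel. D n t * J1 t) + JT * ((\<psi> T + K * \<sigma> n) * \<sigma> n)" for n
  proof -
    \<comment> \<open>Once \<open>key\<close> is multiplied by \<open>\<psi> t\<close>,
      \<open>f1\<close> is the term with \<open>J (t + \<sigma> n)\<close> written at its own
      argument, \<open>f2\<close> is the weight of \<open>JT\<close> on the last interval of length
      \<open>\<sigma> n\<close>, and \<open>f3\<close> is the term with \<open>J t\<close>.\<close>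
    define f1 where "f1 t = indicator {0<..<T} (t - \<sigma> n) * \<psi> (t - \<sigma> n) * J1 t" for t
    define f2 where "f2 t = indicator {T - \<sigma> n..<T} t * \<psi> t" for t
    define f3 where "f3 t = \<psi> t * J1 t" for t
    have [measurable]: "f1 \<in> borel_measurable borel" "f2 \<in> borel_measurable borel" "f3 \<in> borel_measurable borel"
      unfolding f1_def[abs_def] f2_def[abs_def] f3_def[abs_def] by measurable
    have i1: "integrable lborel f1"
    proof (rule Bochner_Integration.integrable_bound)
      show "integrable lborel (\<lambda>t. K' * J1 t)" using J1 by simp
      show "AE t in lborel. norm (f1 t) \<le> norm (K' * J1 t)"
        using K' J1_nonneg
        by (intro AE_I2) (auto simp: f1_def abs_mult indicator_def intro!: mult_right_mono intro: order_trans[OF _ abs_ge_self])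
    qed measurable
    have i3: "integrable lborel f3"
    proof (rule Bochner_Integration.integrable_bound)
      show "integrable lborel (\<lambda>t. K' * J1 t)" using J1 by simp
      show "AE t in lborel. norm (f3 t) \<le> norm (K' * J1 t)"
        using K' J1_nonneg
        by (intro AE_I2) (auto simp: f3_def J1_def abs_mult indicator_def intro!: mult_right_mono intro: order_trans[OF _ abs_ge_self])
    qed measurable
    have i2: "integrable lborel f2"
    proof (rule Bochner_Integration.integrable_bound)
      show "integrable lborel (\<lambda>t. K' * indicator {T - \<sigma> n..<T} t)" using \<sigma>[of n] by simp
      show "AE t in lborel. norm (f2 t) \<le> norm (K' * indicator {T - \<sigma> n..<T} t)"
        using K' \<sigma>[of n]
        by (intro AE_I2) (auto simp: f2_def indicator_def intro: order_trans[OF _ abs_ge_self])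
    qed measurable
    have f2_le: "(LINT t|lborel. f2 t) \<le> (\<psi> T + K * \<sigma> n) * \<sigma> n"
    proof -
      have "(LINT t|lborel. f2 t) \<le> (LINT t|lborel. (\<psi> T + K * \<sigma> n) * indicator {T - \<sigma> n..<T} t)"
      proof (rule integral_mono[OF i2])
        show "integrable lborel (\<lambda>t. (\<psi> T + K * \<sigma> n) * indicator {T - \<sigma> n..<T} t)" using \<sigma>[of n] by simp
        fix t
        have "\<psi> t \<le> \<psi> T + K * \<sigma> n" if t: "t \<in> {T - \<sigma> n..<T}"
        proof -
          have "\<bar>\<psi> t - \<psi> T\<bar> \<le> K * \<bar>t - T\<bar>" using t \<sigma>[of n] by (intro lip) auto
          also have "\<dots> \<le> K * \<sigma> n"
            using t K[of 0] T by (intro mult_left_mono) auto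
          finally show ?thesis by linarith
        qed
        then show "f2 t \<le> (\<psi> T + K * \<sigma> n) * indicator {T - \<sigma> n..<T} t" by (auto simp: f2_def indicator_def)
      qed
      also have "\<dots> = (\<psi> T + K * \<sigma> n) * \<sigma> n" using \<sigma>[of n] by simp
      finally show ?thesis .
    qed
    have i1t: "integrable lborel (\<lambda>t. f1 (\<sigma> n + t))" by (rule integrable_translate[OF i1])
    have "2 * (LINT \<tau>:{0<..<\<sigma> n}|lborel. \<Phi> \<tau>)
        = (LINT t|lborel. 2 * (LINT \<tau>:{0<..<\<sigma> n}|lborel. LINT x|lborel. V (x, t + \<tau>) * g (x, t)))"
      using Fubini_time_shifted_pairing(2)[OF V g \<sigma>(1)[of n]] by (simp add: \<Phi>_def)
    also have "\<dots> \<le> (LINT t|lborel. f1 (\<sigma> n + t) + JT * f2 t - f3 t)"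
    proof (rule integral_mono_AE)
      show "integrable lborel (\<lambda>t. 2 * (LINT \<tau>:{0<..<\<sigma> n}|lborel. LINT x|lborel. V (x, t + \<tau>) * g (x, t)))"
        using Fubini_time_shifted_pairing(1)[OF V g \<sigma>(1)[of n]] by simp
      show "integrable lborel (\<lambda>t. f1 (\<sigma> n + t) + JT * f2 t - f3 t)" using i1t i2 i3 by simp
      show "AE t in lborel. 2 * (LINT \<tau>:{0<..<\<sigma> n}|lborel. LINT x|lborel. V (x, t + \<tau>) * g (x, t))
          \<le> f1 (\<sigma> n + t) + JT * f2 t - f3 t"
        using key[OF \<sigma>, of n]
      proof eventually_elim
        case (elim t)
        have gG: "(LINT x|lborel. V (x, t + \<tau>) * g (x, t))
            = indicator {0<..<T} t * \<psi> t * (LINT x|lborel. V (x, t + \<tau>) * G (x, t))" for \<tau>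
        proof -
          have "(LINT x|lborel. V (x, t + \<tau>) * g (x, t))
              = (LINT x|lborel. (indicator {0<..<T} t * \<psi> t) * (V (x, t + \<tau>) * G (x, t)))"
            by (rule Bochner_Integration.integral_cong) (auto simp: g_def)
          then show ?thesis by (simp only: integral_mult_right_zero)
        qed
        have lhs: "2 * (LINT \<tau>:{0<..<\<sigma> n}|lborel. LINT x|lborel. V (x, t + \<tau>) * g (x, t))
            = indicator {0<..<T} t * \<psi> t * (2 * (LINT \<tau>:{0<..<\<sigma> n}|lborel. LINT x|lborel. V (x, t + \<tau>) * G (x, t)))"
          unfolding gG by simp
        show ?case
        proof (cases "t \<in> {0<..<T}")
          case False
          then show ?thesis unfolding lhs using \<sigma>[of n] by (auto simp: f1_def f2_def f3_def J1_def)
        next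
          case True
          then have "indicator {0<..<T} t * \<psi> t * (2 * (LINT \<tau>:{0<..<\<sigma> n}|lborel. LINT x|lborel. V (x, t + \<tau>) * G (x, t)))
              \<le> \<psi> t * ((if t + \<sigma> n < T then J (t + \<sigma> n) else JT) - J t)"
            using elim \<psi>(3)[of t] by (auto intro!: mult_left_mono)
          also have "\<dots> = f1 (\<sigma> n + t) + JT * f2 t - f3 t"
            using True \<sigma>[of n] by (auto simp: f1_def f2_def f3_def J1_def indicator_def algebra_simps)
          finally show ?thesis unfolding lhs .
        qed
      qed
    qed
    also have "\<dots> = (LINT t|lborel. f1 (\<sigma> n + t)) + JT * (LINT t|lborel. f2 t) - (LINT t|lborel. f3 t)"
      using i1t i2 i3 by simp
    also have "(LINT t|lborel. f1 (\<sigma> n + t)) = (LINT t|lborel. f1 t)" by (rule integral_translate[OF i1])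
    also have "(LINT t|lborel. f1 t) + JT * (LINT t|lborel. f2 t) - (LINT t|lborel. f3 t)
        = (LINT t|lborel. f1 t - f3 t) + JT * (LINT t|lborel. f2 t)" using i1 i3 by simp
    also have "\<dots> \<le> (LINT t|lborel. \<sigma> n * (D n t * J1 t)) + JT * ((\<psi> T + K * \<sigma> n) * \<sigma> n)"
    proof (intro add_mono integral_mono mult_left_mono[OF f2_le JT])
      show "integrable lborel (\<lambda>t. f1 t - f3 t)" using i1 i3 by simp
      show "integrable lborel (\<lambda>t. \<sigma> n * (D n t * J1 t))" using iDJ by simp
      fix t
      show "f1 t - f3 t \<le> \<sigma> n * (D n t * J1 t)"
      proof (cases "t \<in> {0<..<T}")
        case False then show ?thesis by (simp add: f1_def f3_def J1_def)
      next
        case True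
        then have "0 \<le> \<psi> t * J1 t" using \<psi>(3)[of t] J1_nonneg by simp
        then show ?thesis
          using True \<sigma>[of n] by (auto simp: f1_def f3_def D_def left_diff_distrib)
      qed
    qed
    also have "(LINT t|lborel. \<sigma> n * (D n t * J1 t)) = \<sigma> n * (LINT t|lborel. D n t * J1 t)" by simp
    finally show ?thesis .
  qed
  \<comment> \<open>As \<open>\<Phi>\<close> tends to \<open>\<Phi> 0\<close>, its mean over the
    shifts below \<open>\<sigma> n\<close> is eventually at least \<open>\<Phi> 0 - e\<close>; the
    bound in \<open>step\<close> is then divided by \<open>\<sigma> n\<close>.\<close>
  have "2 * (\<Phi> 0 - e) \<le> (LINT t|lborel. - (\<psi>' t) * J1 t) + JT * \<psi> T" if "e > 0" for e
  proof (rule LIMSEQ_le_const)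
    have "(\<lambda>n. (LINT t|lborel. D n t * J1 t) + JT * (\<psi> T + K * \<sigma> n))
        \<longlonglongrightarrow> (LINT t|lborel. - (\<psi>' t) * J1 t) + JT * (\<psi> T + K * 0)"
      by (intro tendsto_intros D_lim \<sigma>lim)
    then show "(\<lambda>n. (LINT t|lborel. D n t * J1 t) + JT * (\<psi> T + K * \<sigma> n))
        \<longlonglongrightarrow> (LINT t|lborel. - (\<psi>' t) * J1 t) + JT * \<psi> T" by simp
    have "\<forall>\<^sub>F \<tau> in at 0. \<Phi> 0 - e < \<Phi> \<tau>" using \<Phi>_lim \<open>e > 0\<close> by (intro order_tendstoD) auto
    then obtain d where d: "d > 0" "\<And>\<tau>. 0 < \<tau> \<Longrightarrow> \<tau> < d \<Longrightarrow> \<Phi> 0 - e < \<Phi> \<tau>"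
      unfolding eventually_at by (auto simp: dist_real_def)
    have "\<forall>\<^sub>F n in sequentially. \<sigma> n < d" using \<sigma>lim d(1) by (intro order_tendstoD) auto
    then obtain N where N: "\<And>n. n \<ge> N \<Longrightarrow> \<sigma> n < d" by (auto simp: eventually_sequentially)
    have "2 * (\<Phi> 0 - e) \<le> (LINT t|lborel. D n t * J1 t) + JT * (\<psi> T + K * \<sigma> n)" if "n \<ge> N" for n
    proof -
      have "(LINT \<tau>:{0<..<\<sigma> n}|lborel. \<Phi> 0 - e) \<le> (LINT \<tau>:{0<..<\<sigma> n}|lborel. \<Phi> \<tau>)"
      proof (rule set_integral_mono)
        show "set_integrable lborel {0<..<\<sigma> n} (\<lambda>\<tau>. \<Phi> 0 - e)"
          using \<sigma>[of n] by (simp add: set_integrable_def)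
        show "set_integrable lborel {0<..<\<sigma> n} \<Phi>"
          using Fubini_time_shifted_pairing(3)[OF V g \<sigma>(1)] by (simp add: \<Phi>_def[abs_def])
      qed (use d N[OF \<open>n \<ge> N\<close>] in force)
      then have "(\<Phi> 0 - e) * \<sigma> n \<le> (LINT \<tau>:{0<..<\<sigma> n}|lborel. \<Phi> \<tau>)"
        using \<sigma>[of n] by (simp add: set_lebesgue_integral_def mult.commute)
      with step[of n] have "2 * (\<Phi> 0 - e) * \<sigma> n
          \<le> ((LINT t|lborel. D n t * J1 t) + JT * (\<psi> T + K * \<sigma> n)) * \<sigma> n"
        by (simp add: algebra_simps)
      then show ?thesis using \<sigma>(1)[of n] by (rule mult_right_le_imp_le)
    qed
    then show "\<exists>N. \<forall>n\<ge>N. 2 * (\<Phi> 0 - e) \<le> (LINT t|lborel. D n t * J1 t) + JT * (\<psi> T + K * \<sigma> n)" by blast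
  qed
  then have "2 * \<Phi> 0 \<le> (LINT t|lborel. - (\<psi>' t) * J1 t) + JT * \<psi> T + e" if "e > 0" for e
    using that[THEN half_gt_zero] by fastforce
  then have "2 * \<Phi> 0 \<le> (LINT t|lborel. - (\<psi>' t) * J1 t) + JT * \<psi> T" by (rule field_le_epsilon)
  moreover have "(LINT t|lborel. - (\<psi>' t) * J1 t) = - (LINT t:{0<..<T}|lborel. \<psi>' t * J t)"
    unfolding set_lebesgue_integral_def
    by (subst Bochner_Integration.integral_minus[symmetric], rule Bochner_Integration.integral_cong)
      (auto simp: J1_def)
  ultimately show ?thesis unfolding \<Phi>0 by (simp add: mult.commute)
qed

section \<open>Weak derivatives and integration by parts\<close>

lemma test_fun_iff:
  "test_fun l r \<psi> \<longleftrightarrow> smooth \<psi> \<and> (\<exists>c d. l < c \<and> c \<le> d \<and> d < r \<and> (\<forall>x. x \<notin> {c..d} \<longrightarrow> \<psi> x = 0))"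
  by (simp add: test_fun_def smooth_def)

lemma test_fun_smooth: "test_fun l r \<psi> \<Longrightarrow> smooth \<psi>"
  by (simp add: test_fun_iff)

lemma test_fun_measurable [measurable_dest]:
  "test_fun l r \<psi> \<Longrightarrow> \<psi> \<in> borel_measurable borel" "test_fun l r \<psi> \<Longrightarrow> deriv \<psi> \<in> borel_measurable borel"
  by (auto intro!: borel_measurable_continuous_onI smooth_continuous_deriv dest: test_fun_smooth)

lemma borel_measurable_lebesgue_onI:
  fixes f :: "'a::euclidean_space \<Rightarrow> real"
  shows "f \<in> borel_measurable borel \<Longrightarrow> f \<in> borel_measurable (lebesgue_on S)"
  by (intro measurable_restrict_space1 measurable_completion) simp

lemma
  assumes "test_fun l r \<psi>"
  shows test_fun_measurable_on: "\<psi> \<in> borel_measurable (lebesgue_on S)"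
    and test_fun_deriv_measurable_on: "deriv \<psi> \<in> borel_measurable (lebesgue_on S)"
  using test_fun_measurable[OF assms] by (auto intro: borel_measurable_lebesgue_onI)

lemma test_fun_support:
  assumes "test_fun l r \<psi>"
  obtains c d where "l < c" "c \<le> d" "d < r" "\<And>x. x \<notin> {c..d} \<Longrightarrow> \<psi> x = 0"
    "\<And>x. x \<notin> {c..d} \<Longrightarrow> deriv \<psi> x = 0"
proof -
  obtain c d where cd: "l < c" "c \<le> d" "d < r" "\<And>x. x \<notin> {c..d} \<Longrightarrow> \<psi> x = 0"
    using assms by (auto simp: test_fun_iff)
  have "deriv \<psi> x = 0" if "x \<notin> {c..d}" for x
  proof -
    have "\<forall>\<^sub>F y in nhds x. \<psi> y = 0"
      using cd(4) that by (intro eventually_nhds[THEN iffD2] exI[of _ "- {c..d}"]) auto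
    then have "(\<psi> has_real_derivative 0) (at x)"
      by (subst DERIV_cong_ev[where g = "\<lambda>_. 0"]) auto
    then show ?thesis by (rule DERIV_imp_deriv)
  qed
  with cd show ?thesis by (rule that)
qed

lemma test_fun_bounded:
  assumes "test_fun l r \<psi>"
  obtains K where "\<And>x. \<bar>\<psi> x\<bar> \<le> K" "\<And>x. \<bar>deriv \<psi> x\<bar> \<le> K"
proof -
  obtain c d where cd: "c \<le> d" "\<And>x. x \<notin> {c..d} \<Longrightarrow> \<psi> x = 0" "\<And>x. x \<notin> {c..d} \<Longrightarrow> deriv \<psi> x = 0"
    using test_fun_support[OF assms] by metis
  have "compact (\<psi> ` {c..d})" "compact (deriv \<psi> ` {c..d})"
    using test_fun_smooth[OF assms] by (auto intro!: compact_continuous_image smooth_continuous_deriv)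
  then obtain K K' where K: "\<forall>y\<in>\<psi> ` {c..d}. norm y \<le> K" "\<forall>y\<in>deriv \<psi> ` {c..d}. norm y \<le> K'"
    using compact_imp_bounded bounded_iff by metis
  have "0 \<le> K" "0 \<le> K'" using K cd(1) by (auto intro: order_trans[OF norm_ge_zero])
  then have "\<bar>\<psi> x\<bar> \<le> max K K'" "\<bar>deriv \<psi> x\<bar> \<le> max K K'" for x
    using K cd(2,3)[of x] by (cases "x \<in> {c..d}"; force)+
  then show ?thesis by (rule that)
qed

lemma test_fun_mult:
  assumes "smooth \<eta>" "test_fun l r \<psi>"
  shows "test_fun l r (\<lambda>x. \<eta> x * \<psi> x)" "deriv (\<lambda>x. \<eta> x * \<psi> x) x = deriv \<eta> x * \<psi> x + \<eta> x * deriv \<psi> x"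
proof -
  show "test_fun l r (\<lambda>x. \<eta> x * \<psi> x)"
    using assms unfolding test_fun_iff by (auto intro: smooth_mult)
  show "deriv (\<lambda>x. \<eta> x * \<psi> x) x = deriv \<eta> x * \<psi> x + \<eta> x * deriv \<psi> x"
    using DERIV_mult[OF smooth_has_deriv[OF assms(1)] smooth_has_deriv[OF test_fun_smooth[OF assms(2)]], of x]
    by (simp add: DERIV_imp_deriv add.commute mult.commute)
qed

text \<open>The functions \<open>\<psi> n\<close> approximate the indicator of \<open>{c<..d}\<close>, so their derivatives approximate
  the difference of the point masses at \<open>c\<close> and \<open>d\<close>.\<close>

lemma test_fun_approx_indicator:
  fixes l r c d :: real
  assumes "l < c" "c \<le> d" "d < r"
  obtains \<psi> d' where "d \<le> d'" "d' < r" "\<And>n::nat. test_fun l r (\<psi> n)" "\<And>n x. \<bar>\<psi> n x\<bar> \<le> indicator {c..d'} x"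
    "\<And>x. (\<lambda>n. \<psi> n x) \<longlonglongrightarrow> indicator {c<..d} x"
    "\<And>f. continuous_on {c..d'} f \<Longrightarrow> (\<lambda>n. LINT x|lebesgue. deriv (\<psi> n) x * f x) \<longlonglongrightarrow> f c - f d"
proof -
  obtain \<sigma> M where \<sigma>: "smooth \<sigma>" "\<And>x. x \<le> 0 \<Longrightarrow> \<sigma> x = 0" "\<And>x. x \<ge> 1 \<Longrightarrow> \<sigma> x = 1"
    "\<And>x. 0 \<le> \<sigma> x \<and> \<sigma> x \<le> 1" "\<And>x. 0 \<le> deriv \<sigma> x \<and> deriv \<sigma> x \<le> M" "\<And>x. x \<notin> {0<..<1} \<Longrightarrow> deriv \<sigma> x = 0"
    by (rule exists_smooth_step) blast
  \<comment> \<open>The width of the two ramps, which start at \<open>c\<close> and at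
    \<open>d\<close>. It is at most half of \<open>r - d\<close>, so the second ramp ends no later
    than the midpoint \<open>d'\<close> of \<open>d\<close> and \<open>r\<close>.\<close>
  define e where "e n = (r - d) / (real n + 2)" for n
  have e: "0 < e n" "e n \<le> (r - d) / 2" for n
    subgoal using assms by (simp add: e_def)
    subgoal unfolding e_def by (rule divide_left_mono) (use assms in auto)
    done
  have elim: "e \<longlonglongrightarrow> 0" unfolding e_def[abs_def] by real_asymp
  define d' where "d' = (d + r) / 2"
  have d': "d + e n \<le> d'" for n using e[of n] by (simp add: d'_def field_simps)
  define S where "S n c x = \<sigma> ((1 / e n) * x + (- c / e n))" for n c x
  have S_eq: "S n c x = \<sigma> ((x - c) / e n)" for n c x by (simp add: S_def diff_divide_distrib)
  have smS: "smooth (S n c)" for n c unfolding S_def[abs_def] by (rule smooth_affine[OF \<sigma>(1)])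
  have dS: "(S n c has_real_derivative deriv \<sigma> ((x - c) / e n) / e n) (at x)" for n c x
  proof -
    have "((\<lambda>x. \<sigma> ((x - c) / e n)) has_real_derivative deriv \<sigma> ((x - c) / e n) * (1 / e n)) (at x)"
      using e[of n] by (intro DERIV_chain2[OF smooth_has_deriv[OF \<sigma>(1)]]) (auto intro!: derivative_eq_intros)
    then show ?thesis by (simp add: S_eq[abs_def])
  qed
  have S0: "S n c x = 0" if "x \<le> c" for n c x using that e[of n] \<sigma>(2) by (simp add: S_eq divide_nonpos_pos)
  have S1: "S n c x = 1" if "x \<ge> c + e n" for n c x using that e[of n] \<sigma>(3) by (simp add: S_eq)
  have Slim: "(\<lambda>n. S n c x) \<longlonglongrightarrow> indicator {c<..} x" for c x
  proof (cases "c < x")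
    case True
    then have "\<forall>\<^sub>F n in sequentially. e n < x - c" using elim by (intro order_tendstoD) auto
    then have "\<forall>\<^sub>F n in sequentially. S n c x = 1" by eventually_elim (rule S1, simp)
    then show ?thesis using True by (simp add: tendsto_eventually)
  qed (simp add: S0)
  \<comment> \<open>The derivative of a ramp is nonnegative, has integral 1 and lives on an interval
    of length \<open>e n\<close> to the right of \<open>c\<close>: an approximate identity, for
    which continuity from the right is enough.\<close>
  have point_mass: "(\<lambda>n. LINT x|lebesgue. deriv (S n c) x * f x) \<longlonglongrightarrow> f c"
    and point_mass_int: "\<And>n. integrable lebesgue (\<lambda>x. deriv (S n c) x * f x)"
    if f: "continuous_on {c..c'} f" and c': "\<And>n. c + e n \<le> c'" for c c' f
  proof -
    have D: "deriv (S n c) x = deriv \<sigma> ((x - c) / e n) / e n" for n x using dS by (rule DERIV_imp_deriv)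
    have D0: "0 \<le> deriv (S n c) x" for n x using \<sigma>(5) e[of n] by (simp add: D)
    have Dz: "deriv (S n c) x = 0" if "x \<notin> {c..c + e n}" for n x
      unfolding D using \<sigma>(6)[of "(x - c) / e n"] that e[of n] by (auto simp: field_simps)
    have cD: "continuous_on A (deriv (S n c))" for n A using smS smooth_continuous_deriv by blast
    have si: "set_integrable lborel {c..c + e n} (\<lambda>x. deriv (S n c) x * h x)" if "continuous_on {c..c'} h" for h n
      using c'[of n] by (intro borel_integrable_atLeastAtMost' continuous_on_mult cD continuous_on_subset[OF that]) auto
    have eqi: "(\<lambda>x. indicator {c..c + e n} x *\<^sub>R (deriv (S n c) x * h x)) = (\<lambda>x. deriv (S n c) x * h x)" for h n
      using Dz by (auto simp: fun_eq_iff indicator_def)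
    have i: "integrable lborel (\<lambda>x. deriv (S n c) x * h x)" if "continuous_on {c..c'} h" for h n
      using si[OF that, of n] unfolding set_integrable_def eqi .
    then show "integrable lebesgue (\<lambda>x. deriv (S n c) x * f x)" for n
      using f by (intro integrable_completion[THEN iffD2]) (auto intro: borel_measurable_integrable)
    have one: "(LINT x|lborel. deriv (S n c) x) = 1" for n
    proof -
      have "(LINT x|lborel. deriv (S n c) x * indicator {c..c + e n} x) = S n c (c + e n) - S n c c"
      proof (rule integral_FTC_Icc_real)
        show "c \<le> c + e n" using e[of n] by simp
        show "DERIV (S n c) x :> deriv (S n c) x" for x using dS[of n c x] by (simp only: D)
        show "isCont (deriv (S n c)) x" for x
          using cD[of UNIV n] continuous_on_eq_continuous_at[OF open_UNIV] by blast
      qed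
      also have "(\<lambda>x. deriv (S n c) x * indicator {c..c + e n} x) = deriv (S n c)"
        using Dz by (auto simp: fun_eq_iff indicator_def)
      finally show ?thesis by (simp add: S0 S1)
    qed
    have Di: "integrable lborel (deriv (S n c))" for n using i[of "\<lambda>_. 1" n] by simp
    have "(\<lambda>n. LINT x|lborel. deriv (S n c) x * f x) \<longlonglongrightarrow> f c"
    proof (rule LIMSEQ_I)
      fix \<epsilon> :: real assume "\<epsilon> > 0"
      have "c \<in> {c..c'}" using c'[of 0] e[of 0] by auto
      then obtain \<delta> where \<delta>: "\<delta> > 0" "\<And>x. x \<in> {c..c'} \<Longrightarrow> dist x c < \<delta> \<Longrightarrow> dist (f x) (f c) < \<epsilon> / 2"
        using f \<open>\<epsilon> > 0\<close> unfolding continuous_on_iff by (metis half_gt_zero)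
      have "\<forall>\<^sub>F n in sequentially. e n < \<delta>" using elim \<delta>(1) by (intro order_tendstoD) auto
      then obtain N where N: "\<And>n. n \<ge> N \<Longrightarrow> e n < \<delta>" by (auto simp: eventually_sequentially)
      have "\<bar>(LINT x|lborel. deriv (S n c) x * f x) - f c\<bar> \<le> \<epsilon> / 2" if "n \<ge> N" for n
      proof -
        have "(LINT x|lborel. deriv (S n c) x * f x) - f c = (LINT x|lborel. deriv (S n c) x * (f x - f c))"
          using i[OF f, of n] Di[of n] one[of n] by (simp add: right_diff_distrib)
        also have "\<bar>\<dots>\<bar> \<le> (LINT x|lborel. \<bar>deriv (S n c) x * (f x - f c)\<bar>)" by (rule integral_abs_bound)
        also have "\<dots> \<le> (LINT x|lborel. (\<epsilon> / 2) * deriv (S n c) x)"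
        proof (rule integral_mono)
          show "integrable lborel (\<lambda>x. \<bar>deriv (S n c) x * (f x - f c)\<bar>)"
            using i[OF continuous_on_diff[OF f continuous_on_const], of n] by (rule integrable_abs)
          show "integrable lborel (\<lambda>x. (\<epsilon> / 2) * deriv (S n c) x)" using Di by simp
          fix x
          show "\<bar>deriv (S n c) x * (f x - f c)\<bar> \<le> (\<epsilon> / 2) * deriv (S n c) x"
          proof (cases "x \<in> {c..c + e n}")
            case True
            then have "\<bar>f x - f c\<bar> \<le> \<epsilon> / 2"
              using \<delta>(2)[of x] N[OF that] c'[of n] by (force simp: dist_real_def)
            then have "\<bar>f x - f c\<bar> * deriv (S n c) x \<le> (\<epsilon> / 2) * deriv (S n c) x"
              using D0[of n x] by (rule mult_right_mono)
            then show ?thesis using D0[of n x] by (simp add: abs_mult mult.commute)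
          qed (simp add: Dz)
        qed
        also have "\<dots> = \<epsilon> / 2" using one by simp
        finally show ?thesis .
      qed
      then show "\<exists>no. \<forall>n\<ge>no. norm ((LINT x|lborel. deriv (S n c) x * f x) - f c) < \<epsilon>"
        using \<open>\<epsilon> > 0\<close> by (intro exI[of _ N]) force
    qed
    then show "(\<lambda>n. LINT x|lebesgue. deriv (S n c) x * f x) \<longlonglongrightarrow> f c"
      using i[OF f] by (subst integral_completion) (auto intro: borel_measurable_integrable)
  qed
  define \<psi> where "\<psi> n x = S n c x - S n d x" for n x
  have d\<psi>: "deriv (\<psi> n) x = deriv (S n c) x - deriv (S n d) x" for n x
    unfolding \<psi>_def[abs_def] using smS smooth_has_deriv by (intro DERIV_imp_deriv DERIV_diff) blast+
  have \<psi>0: "\<psi> n x = 0" if out: "x \<notin> {c..d'}" for n x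
  proof -
    consider "x < c" | "x > d'" using out unfolding atLeastAtMost_iff by linarith
    then show ?thesis
      by cases (use assms d'[of n] e[of n] in \<open>auto simp: \<psi>_def S0 S1\<close>)
  qed
  have dd: "d \<le> d'" "d' < r" using assms by (auto simp: d'_def)
  show thesis
  proof
    show "d \<le> d'" "d' < r" by (fact dd)+
    show "test_fun l r (\<psi> n)" for n
      unfolding test_fun_iff
    proof
      show "smooth (\<psi> n)" unfolding \<psi>_def[abs_def] by (intro smooth_diff smS)
      show "\<exists>c d. l < c \<and> c \<le> d \<and> d < r \<and> (\<forall>x. x \<notin> {c..d} \<longrightarrow> \<psi> n x = 0)"
        using assms dd \<psi>0 by (intro exI[of _ c] exI[of _ d']) auto
    qed
    show "\<bar>\<psi> n x\<bar> \<le> indicator {c..d'} x" for n x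
    proof (cases "x \<in> {c..d'}")
      case True
      have "0 \<le> S n c x" "S n c x \<le> 1" "0 \<le> S n d x" "S n d x \<le> 1" using \<sigma>(4) by (auto simp: S_eq)
      then show ?thesis using True by (simp add: \<psi>_def)
    qed (simp add: \<psi>0)
    show "(\<lambda>n. \<psi> n x) \<longlonglongrightarrow> indicator {c<..d} x" for x
    proof -
      have "(\<lambda>n. S n c x - S n d x) \<longlonglongrightarrow> indicator {c<..} x - indicator {d<..} x" by (intro tendsto_diff Slim)
      also have "indicator {c<..} x - indicator {d<..} x = (indicator {c<..d} x :: real)"
        using assms by (auto simp: indicator_def)
      finally show ?thesis by (simp add: \<psi>_def)
    qed
    fix f :: "real \<Rightarrow> real" assume f: "continuous_on {c..d'} f"
    have 1: "c + e n \<le> d'" for n using d'[of n] assms by simp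
    have fd: "continuous_on {d..d'} f" using f by (rule continuous_on_subset) (use assms in auto)
    have "(LINT x|lebesgue. deriv (\<psi> n) x * f x)
        = (LINT x|lebesgue. deriv (S n c) x * f x) - (LINT x|lebesgue. deriv (S n d) x * f x)" for n
      unfolding d\<psi> left_diff_distrib
      by (rule Bochner_Integration.integral_diff[OF point_mass_int[OF f 1] point_mass_int[OF fd d']])
    then show "(\<lambda>n. LINT x|lebesgue. deriv (\<psi> n) x * f x) \<longlonglongrightarrow> f c - f d"
      using tendsto_diff[OF point_mass[OF f 1] point_mass[OF fd d']] by simp
  qed
qed

section \<open>The fundamental lemma of the calculus of variations and uniqueness of weak
  derivatives\<close>

lemma AE_eq_0_of_half_line_integrals:
  fixes f :: "real \<Rightarrow> real"
  assumes f: "integrable lebesgue f" and z: "\<And>x. (LINT y:{x<..}|lebesgue. f y) = 0"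
  shows "AE x in lebesgue. f x = 0"
proof -
  obtain g where [measurable]: "g \<in> borel_measurable lborel" and g: "AE x in lborel. f x = g x"
    using completion_ex_borel_measurable_real[OF borel_measurable_integrable[OF f]] by blast
  have fg: "AE x in lebesgue. f x = g x" using g by (rule AE_completion)
  have gm: "g \<in> borel_measurable lebesgue" by (intro measurable_completion) measurable
  have ig: "integrable lborel g"
    using f integrable_cong_AE[OF borel_measurable_integrable[OF f] gm fg] integrable_completion[of g lborel] by simp
  have gz: "(LINT y|lborel. indicator {x<..} y * g y) = 0" for x
  proof -
    have "0 = (LINT y|lebesgue. indicator {x<..} y * f y)" using z[of x] by (simp add: set_lebesgue_integral_def)
    also have "\<dots> = (LINT y|lebesgue. indicator {x<..} y * g y)"
      using fg borel_measurable_integrable[OF f] gm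
      by (intro integral_cong_AE borel_measurable_times borel_measurable_indicator) auto
    also have "\<dots> = (LINT y|lborel. indicator {x<..} y * g y)" by (rule integral_completion) measurable
    finally show ?thesis by simp
  qed
  have ind: "integrable lborel (\<lambda>y. indicator {x<..} y * h y)" if "integrable lborel h" for x and h :: "real \<Rightarrow> real"
    using integrable_mult_indicator[of "{x<..}" lborel h] that by simp
  define p n where "p y = max 0 (g y)" "n y = max 0 (- g y)" for y
  have [measurable]: "p \<in> borel_measurable lborel" "n \<in> borel_measurable lborel"
    unfolding p_n_def[abs_def] by measurable
  have ipn: "integrable lborel p" "integrable lborel n"
    unfolding p_n_def[abs_def] using ig by auto
  have pn0: "0 \<le> p y" "0 \<le> n y" for y by (simp_all add: p_n_def)
  have em: "emeasure (density lborel (\<lambda>y. ennreal (q y))) {x<..} = ennreal (LINT y|lborel. indicator {x<..} y * q y)"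
    if q: "integrable lborel q" "\<And>y. 0 \<le> q y" for q :: "real \<Rightarrow> real" and x
  proof -
    have [measurable]: "q \<in> borel_measurable lborel" using q by auto
    have "emeasure (density lborel (\<lambda>y. ennreal (q y))) {x<..} = (\<integral>\<^sup>+y. ennreal (indicator {x<..} y * q y) \<partial>lborel)"
      by (subst emeasure_density) (auto intro!: nn_integral_cong borel_open simp: indicator_def)
    then show ?thesis using ind[OF q(1), of x] q(2) by (simp add: nn_integral_eq_integral)
  qed
  \<comment> \<open>The positive and the negative part define two finite measures that agree on all
    half-lines, hence coincide; uniqueness of densities then makes the two parts equal almost
    everywhere. As one of them is zero at each point, so is \<open>g\<close>.\<close>
  have "density lborel (\<lambda>y. ennreal (p y)) = density lborel (\<lambda>y. ennreal (n y))"
  proof (rule measure_eqI_lessThan)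
    fix x
    have "(LINT y|lborel. indicator {x<..} y * p y) - (LINT y|lborel. indicator {x<..} y * n y)
        = (LINT y|lborel. indicator {x<..} y * p y - indicator {x<..} y * n y)"
      using ind[OF ipn(1), of x] ind[OF ipn(2), of x] by simp
    also have "\<dots> = (LINT y|lborel. indicator {x<..} y * g y)"
      by (rule Bochner_Integration.integral_cong) (auto simp: p_n_def max_def indicator_def)
    finally have "(LINT y|lborel. indicator {x<..} y * p y) = (LINT y|lborel. indicator {x<..} y * n y)"
      by (simp add: gz)
    then show "emeasure (density lborel (\<lambda>y. ennreal (p y))) {x<..} = emeasure (density lborel (\<lambda>y. ennreal (n y))) {x<..}"
      using ipn pn0 by (simp add: em)
    show "emeasure (density lborel (\<lambda>y. ennreal (p y))) {x<..} < \<infinity>"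
      using ipn pn0 by (simp add: em)
  qed auto
  then have "AE y in lborel. ennreal (p y) = ennreal (n y)"
    by (subst (asm) sigma_finite_measure.density_unique_iff[OF lborel.sigma_finite_measure_axioms]) auto
  then have "AE y in lborel. g y = 0"
    by eventually_elim (auto simp: p_n_def max_def split: if_splits)
  then have "AE y in lebesgue. g y = 0" by (rule AE_completion)
  with fg show ?thesis by eventually_elim simp
qed

lemma AE_lebesgue_on_iff:
  fixes S :: "'a::euclidean_space set"
  assumes "S \<in> sets lebesgue"
  shows "(AE x in lebesgue_on S. P x) \<longleftrightarrow> (AE x in lebesgue. x \<in> S \<longrightarrow> P x)"
  using assms by (subst AE_restrict_space_iff) auto

lemma AE_lebesgue_on_interval:
  "(AE x in lebesgue_on {l<..<r::real}. P x) \<longleftrightarrow> (AE x in lebesgue. x \<in> {l<..<r} \<longrightarrow> P x)"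
  by (rule AE_lebesgue_on_iff) simp

text \<open>Approximating the indicator of \<open>{c<..d}\<close> by test functions shows that the
  integral of \<open>h\<close> over each such interval vanishes; the criterion with half-lines then
  applies to \<open>h\<close> cut off to a compact part, and countably many of these exhaust the
  interval.\<close>

lemma AE_eq_0_of_test_funs:
  assumes h: "locally_integrable l r h"
    and z: "\<And>\<psi>. test_fun l r \<psi> \<Longrightarrow> (LINT x:{l<..<r}|lebesgue. h x * \<psi> x) = 0"
  shows "AE x in lebesgue_on {l<..<r}. h x = 0"
proof -
  have set_int: "set_integrable lebesgue {c..d} h" if "l < c" "c \<le> d" "d < r" for c d
    using h that by (auto simp: locally_integrable_def)
  have sub: "set_integrable lebesgue {c<..d} h" if "l < c" "c \<le> d" "d < r" for c d
    by (rule set_integrable_subset[OF set_int[OF that]]) auto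
  have *: "(LINT x:{c<..d}|lebesgue. h x) = 0" if cd: "l < c" "c \<le> d" "d < r" for c d
  proof -
    obtain \<psi> d' where d': "d \<le> d'" "d' < r" and \<psi>: "\<And>n::nat. test_fun l r (\<psi> n)" "\<And>n x. \<bar>\<psi> n x\<bar> \<le> indicator {c..d'} x"
      "\<And>x. (\<lambda>n. \<psi> n x) \<longlonglongrightarrow> indicator {c<..d} x"
      by (rule test_fun_approx_indicator[OF cd]) blast
    have i: "integrable lebesgue (\<lambda>x. indicator {c..d'} x * h x)"
      using set_int[of c d'] cd d' by (simp add: set_integrable_def)
    have \<psi>z: "\<psi> n x = 0" if "x \<notin> {c..d'}" for n x using \<psi>(2)[of n x] that by simp
    have "(\<lambda>n. LINT x|lebesgue. \<psi> n x * (indicator {c..d'} x * h x))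
        \<longlonglongrightarrow> (LINT x|lebesgue. indicator {c<..d} x * (indicator {c..d'} x * h x))"
    proof (rule integral_dominated_convergence[where w = "\<lambda>x. \<bar>indicator {c..d'} x * h x\<bar>"])
      show "integrable lebesgue (\<lambda>x. \<bar>indicator {c..d'} x * h x\<bar>)" using i by (rule integrable_abs)
      show "(\<lambda>x. indicator {c<..d} x * (indicator {c..d'} x * h x)) \<in> borel_measurable lebesgue"
        by (intro borel_measurable_times borel_measurable_indicator borel_measurable_integrable[OF i]) simp
      show "(\<lambda>x. \<psi> n x * (indicator {c..d'} x * h x)) \<in> borel_measurable lebesgue" for n
        using \<psi>(1)[THEN test_fun_measurable(1)]
        by (intro borel_measurable_times borel_measurable_integrable[OF i] measurable_completion) auto
      show "AE x in lebesgue. (\<lambda>n. \<psi> n x * (indicator {c..d'} x * h x)) \<longlonglongrightarrow> indicator {c<..d} x * (indicator {c..d'} x * h x)"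
        by (intro AE_I2 tendsto_mult_right \<psi>)
      show "AE x in lebesgue. norm (\<psi> n x * (indicator {c..d'} x * h x)) \<le> \<bar>indicator {c..d'} x * h x\<bar>" for n
      proof (rule AE_I2)
        fix x
        have "\<bar>\<psi> n x\<bar> * \<bar>indicator {c..d'} x * h x\<bar> \<le> 1 * \<bar>indicator {c..d'} x * h x\<bar>"
          by (intro mult_right_mono order_trans[OF \<psi>(2)[of n x] indicator_le_1]) simp
        then show "norm (\<psi> n x * (indicator {c..d'} x * h x)) \<le> \<bar>indicator {c..d'} x * h x\<bar>"
          by (simp only: real_norm_def abs_mult mult_1)
      qed
    qed
    moreover have "(LINT x|lebesgue. \<psi> n x * (indicator {c..d'} x * h x)) = 0" for n
    proof -
      have "(LINT x|lebesgue. \<psi> n x * (indicator {c..d'} x * h x)) = (LINT x:{l<..<r}|lebesgue. h x * \<psi> n x)"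
        unfolding set_lebesgue_integral_def using \<psi>z[of _ n] cd d'
        by (intro Bochner_Integration.integral_cong) (auto simp: indicator_def)
      then show ?thesis using z[OF \<psi>(1)] by simp
    qed
    ultimately have "(LINT x|lebesgue. indicator {c<..d} x * (indicator {c..d'} x * h x)) = 0"
      by (simp add: LIMSEQ_const_iff)
    moreover have "(\<lambda>x. indicator {c<..d} x * (indicator {c..d'} x * h x)) = (\<lambda>x. indicator {c<..d} x * h x)"
      using d' by (auto simp: indicator_def fun_eq_iff)
    ultimately show ?thesis by (simp add: set_lebesgue_integral_def)
  qed
  have cpt: "AE x in lebesgue. x \<in> {c<..d} \<longrightarrow> h x = 0" if cd: "l < c" "c \<le> d" "d < r" for c d
  proof -
    have "AE x in lebesgue. indicator {c<..d} x * h x = 0"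
    proof (rule AE_eq_0_of_half_line_integrals)
      show "integrable lebesgue (\<lambda>x. indicator {c<..d} x * h x)" using sub[OF cd] by (simp add: set_integrable_def)
      fix x
      \<comment> \<open>The lower end is clipped to lie between \<open>c\<close> and
        \<open>d\<close>, so one formula covers half-lines that start before \<open>c\<close> or
        after \<open>d\<close>.\<close>
      have "(LINT y:{x<..}|lebesgue. indicator {c<..d} y * h y) = (LINT y:{max c (min x d)<..d}|lebesgue. h y)"
        unfolding set_lebesgue_integral_def
        by (intro Bochner_Integration.integral_cong) (auto simp: indicator_def)
      then show "(LINT y:{x<..}|lebesgue. indicator {c<..d} y * h y) = 0" using *[of "max c (min x d)" d] cd by auto
    qed
    then show ?thesis by eventually_elim (auto simp: indicator_def)
  qed
  show ?thesis
  proof (cases "l < r")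
    case True
    define c d where "c n = l + (r - l) / (real n + 2)" "d n = r - (r - l) / (real n + 2)" for n
    have frac: "0 < (r - l) / (real n + 2)" "(r - l) / (real n + 2) \<le> (r - l) / 2" for n
    proof -
      show "0 < (r - l) / (real n + 2)" using True by simp
      show "(r - l) / (real n + 2) \<le> (r - l) / 2" by (rule divide_left_mono) (use True in auto)
    qed
    have "AE x in lebesgue. \<forall>n. x \<in> {c n<..d n} \<longrightarrow> h x = 0"
    proof (intro AE_all_countable[THEN iffD2] allI cpt)
      fix n show "l < c n" "d n < r" using frac[of n] by (auto simp: c_d_def)
      obtain q where q: "(r - l) / (real n + 2) = q" by simp
      show "c n \<le> d n" using frac(2)[of n] unfolding c_d_def q by simp
    qed
    then show ?thesis
      unfolding AE_lebesgue_on_interval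
    proof eventually_elim
      case (elim x)
      show ?case
      proof
        assume x: "x \<in> {l<..<r}"
        have "c \<longlonglongrightarrow> l" "d \<longlonglongrightarrow> r" unfolding c_d_def[abs_def] by real_asymp+
        then have "\<forall>\<^sub>F n in sequentially. c n < x" "\<forall>\<^sub>F n in sequentially. x < d n"
          using x by (auto intro: order_tendstoD)
        then have "\<forall>\<^sub>F n in sequentially. x \<in> {c n<..d n}" by eventually_elim auto
        then show "h x = 0" using elim by (auto simp: eventually_sequentially)
      qed
    qed
  qed (simp add: AE_lebesgue_on_iff)
qed

lemma set_integrable_I01:
  "set_integrable lebesgue {0<..<1} f \<longleftrightarrow> integrable I01 f" for f :: "real \<Rightarrow> real"
  by (simp add: set_integrable_def integrable_restrict_space)

lemma set_integral_I01:
  "(LINT x:{0<..<1}|lebesgue. f x) = (LINT x|I01. f x)" for f :: "real \<Rightarrow> real"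
  by (simp add: set_lebesgue_integral_def integral_restrict_space)

lemma locally_integrable_diff:
  "locally_integrable l r f \<Longrightarrow> locally_integrable l r g \<Longrightarrow> locally_integrable l r (\<lambda>x. f x - g x)"
  by (simp add: locally_integrable_def)

lemma set_integrable_mult_test:
  assumes f: "locally_integrable l r f" and \<psi>: "test_fun l r \<psi>"
  shows "set_integrable lebesgue {l<..<r} (\<lambda>x. f x * \<psi> x)"
    and "set_integrable lebesgue {l<..<r} (\<lambda>x. f x * deriv \<psi> x)"
proof -
  obtain c d where cd: "l < c" "c \<le> d" "d < r" "\<And>x. x \<notin> {c..d} \<Longrightarrow> \<psi> x = 0" "\<And>x. x \<notin> {c..d} \<Longrightarrow> deriv \<psi> x = 0"
    using test_fun_support[OF \<psi>] by metis
  obtain K where K: "\<And>x. \<bar>\<psi> x\<bar> \<le> K" "\<And>x. \<bar>deriv \<psi> x\<bar> \<le> K" using test_fun_bounded[OF \<psi>] by metis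
  have i: "integrable lebesgue (\<lambda>x. indicator {c..d} x * f x)"
    using f cd by (simp add: locally_integrable_def set_integrable_def)
  have *: "set_integrable lebesgue {l<..<r} (\<lambda>x. f x * h x)"
    if h: "\<And>x. \<bar>h x\<bar> \<le> K" "\<And>x. x \<notin> {c..d} \<Longrightarrow> h x = 0" "h \<in> borel_measurable borel" for h
  proof -
    have "integrable lebesgue (\<lambda>x. (indicator {c..d} x * f x) * h x)"
    proof (rule Bochner_Integration.integrable_bound)
      show "integrable lebesgue (\<lambda>x. K * (indicator {c..d} x * f x))" using i by simp
      show "(\<lambda>x. (indicator {c..d} x * f x) * h x) \<in> borel_measurable lebesgue"
        using h by (intro borel_measurable_times borel_measurable_integrable[OF i] measurable_completion) auto
      show "AE x in lebesgue. norm (indicator {c..d} x * f x * h x) \<le> norm (K * (indicator {c..d} x * f x))"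
      proof (rule AE_I2)
        fix x
        have "\<bar>h x\<bar> * \<bar>indicator {c..d} x * f x\<bar> \<le> \<bar>K\<bar> * \<bar>indicator {c..d} x * f x\<bar>"
          using h(1)[of x] by (intro mult_right_mono) auto
        then show "norm (indicator {c..d} x * f x * h x) \<le> norm (K * (indicator {c..d} x * f x))"
          by (simp only: real_norm_def abs_mult mult.commute)
      qed
    qed
    also have "(\<lambda>x. (indicator {c..d} x * f x) * h x) = (\<lambda>x. indicator {l<..<r} x *\<^sub>R (f x * h x))"
      using cd h(2) by (auto simp: indicator_def fun_eq_iff)
    finally show ?thesis by (simp add: set_integrable_def)
  qed
  show "set_integrable lebesgue {l<..<r} (\<lambda>x. f x * \<psi> x)"
    using K cd \<psi> by (intro * test_fun_measurable(1)) auto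
  show "set_integrable lebesgue {l<..<r} (\<lambda>x. f x * deriv \<psi> x)"
    using K cd \<psi> by (intro * test_fun_measurable(2)) auto
qed

text \<open>The functions themselves may differ on a null set. This is needed for second
  derivatives, where the first derivatives to be compared agree only almost everywhere.\<close>

lemma weak_deriv_unique:
  assumes 1: "weak_deriv l r f g" and 2: "weak_deriv l r f' g'"
    and eq: "AE x in lebesgue_on {l<..<r}. f x = f' x"
  shows "AE x in lebesgue_on {l<..<r}. g x = g' x"
proof -
  have "AE x in lebesgue_on {l<..<r}. g x - g' x = 0"
  proof (rule AE_eq_0_of_test_funs)
    show "locally_integrable l r (\<lambda>x. g x - g' x)"
      using 1 2 by (auto simp: weak_deriv_def intro: locally_integrable_diff)
    fix \<psi> assume \<psi>: "test_fun l r \<psi>"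
    have i: "set_integrable lebesgue {l<..<r} (\<lambda>x. h x * \<psi> x)" "set_integrable lebesgue {l<..<r} (\<lambda>x. h x * deriv \<psi> x)"
      if "locally_integrable l r h" for h
      using set_integrable_mult_test[OF that \<psi>] .
    have l: "locally_integrable l r f" "locally_integrable l r f'" "locally_integrable l r g" "locally_integrable l r g'"
      using 1 2 by (auto simp: weak_deriv_def)
    have "(LINT x:{l<..<r}|lebesgue. f x * deriv \<psi> x) = (LINT x:{l<..<r}|lebesgue. f' x * deriv \<psi> x)"
      unfolding set_lebesgue_integral_def
    proof (rule integral_cong_AE)
      show "AE x in lebesgue. indicator {l<..<r} x *\<^sub>R (f x * deriv \<psi> x) = indicator {l<..<r} x *\<^sub>R (f' x * deriv \<psi> x)"
        using eq unfolding AE_lebesgue_on_interval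
        by eventually_elim (auto simp: indicator_def)
    qed (use i(2)[OF l(1)] i(2)[OF l(2)] in \<open>auto simp: set_integrable_def intro: borel_measurable_integrable\<close>)
    moreover have "(LINT x:{l<..<r}|lebesgue. f x * deriv \<psi> x) = - (LINT x:{l<..<r}|lebesgue. g x * \<psi> x)"
      "(LINT x:{l<..<r}|lebesgue. f' x * deriv \<psi> x) = - (LINT x:{l<..<r}|lebesgue. g' x * \<psi> x)"
      using 1 2 \<psi> by (auto simp: weak_deriv_def)
    ultimately show "(LINT x:{l<..<r}|lebesgue. (g x - g' x) * \<psi> x) = 0"
      using i(1)[OF l(3)] i(1)[OF l(4)] by (simp add: left_diff_distrib)
  qed
  then show ?thesis by eventually_elim simp
qed

section \<open>Functions on the unit interval and the space \<open>H10\<close>\<close>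

lemma L2_iff_sqint: "f \<in> L2 \<longleftrightarrow> sqint I01 f"
  by (simp add: L2_def sqint_def)

lemma sqint_I01_bounded:
  assumes "h \<in> borel_measurable I01" "\<And>x. x \<in> {0<..<1} \<Longrightarrow> \<bar>h x\<bar> \<le> K"
  shows "sqint I01 h"
proof -
  have "integrable I01 (\<lambda>x. (h x)\<^sup>2)"
  proof (rule Bochner_Integration.integrable_bound)
    show "integrable I01 (\<lambda>x. K\<^sup>2)" by (simp add: integrable_restrict_space)
    show "(\<lambda>x. (h x)\<^sup>2) \<in> borel_measurable I01" using assms(1) by measurable
    show "AE x in I01. norm ((h x)\<^sup>2) \<le> norm (K\<^sup>2)"
    proof (rule AE_I2)
      fix x assume "x \<in> space I01"
      then have "\<bar>h x\<bar>\<^sup>2 \<le> K\<^sup>2" using assms(2) by (intro power_mono) auto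
      then show "norm ((h x)\<^sup>2) \<le> norm (K\<^sup>2)" by simp
    qed
  qed
  then show ?thesis using assms(1) by (simp add: sqint_def)
qed

lemma sqint_mult_bounded:
  assumes f: "sqint M f" and h: "h \<in> borel_measurable M" "\<And>x. x \<in> space M \<Longrightarrow> \<bar>h x\<bar> \<le> K"
  shows "sqint M (\<lambda>x. h x * f x)"
proof -
  have "integrable M (\<lambda>x. (h x * f x)\<^sup>2)"
  proof (rule Bochner_Integration.integrable_bound)
    show "integrable M (\<lambda>x. K\<^sup>2 * (f x)\<^sup>2)" using sqint_integrable[OF f] by simp
    show "(\<lambda>x. (h x * f x)\<^sup>2) \<in> borel_measurable M" using h sqint_measurable[OF f] by measurable
    show "AE x in M. norm ((h x * f x)\<^sup>2) \<le> norm (K\<^sup>2 * (f x)\<^sup>2)"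
    proof (rule AE_I2)
      fix x assume "x \<in> space M"
      then have "(h x)\<^sup>2 \<le> K\<^sup>2" using power_mono[OF h(2), of x 2] by simp
      then show "norm ((h x * f x)\<^sup>2) \<le> norm (K\<^sup>2 * (f x)\<^sup>2)"
        by (simp add: power_mult_distrib mult_right_mono)
    qed
  qed
  then show ?thesis using h sqint_measurable[OF f] by (simp add: sqint_def)
qed

lemma sqint_I01_integrable: "sqint I01 f \<Longrightarrow> integrable I01 f"
  using sqint_mult_integrable[of I01 f "\<lambda>_. 1"] sqint_I01_bounded[of "\<lambda>_. 1" 1] by simp

lemma sqint_I01_test_fun:
  assumes "test_fun l r \<psi>"
  shows "sqint I01 \<psi>" "sqint I01 (deriv \<psi>)"
proof -
  obtain K where "\<And>x. \<bar>\<psi> x\<bar> \<le> K" "\<And>x. \<bar>deriv \<psi> x\<bar> \<le> K" using test_fun_bounded[OF assms] by metis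
  then show "sqint I01 \<psi>" "sqint I01 (deriv \<psi>)"
    using assms by (auto intro!: sqint_I01_bounded test_fun_measurable_on test_fun_deriv_measurable_on)
qed

lemma integrable_I01_locally_integrable:
  assumes "integrable I01 f"
  shows "locally_integrable 0 1 f"
  unfolding locally_integrable_def
proof (intro allI impI)
  fix c d :: real assume cd: "0 < c \<and> c \<le> d \<and> d < 1"
  have "set_integrable lebesgue {0<..<1} f" using assms by (simp only: set_integrable_I01)
  then show "set_integrable lebesgue {c..d} f"
  proof (rule set_integrable_subset)
    show "{c..d} \<in> sets lebesgue" by simp
    show "{c..d} \<subseteq> {0<..<1}" using cd by (auto simp: subset_eq)
  qed
qed

lemma locally_integrable_measurable:
  assumes "locally_integrable l r f"
  shows "f \<in> borel_measurable (lebesgue_on {l<..<r})"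
proof (cases "l < r")
  case True
  define c d where "c n = l + (r - l) / (real n + 2)" "d n = r - (r - l) / (real n + 2)" for n
  have frac: "0 < (r - l) / (real n + 2)" "(r - l) / (real n + 2) \<le> (r - l) / 2" for n
  proof -
    show "0 < (r - l) / (real n + 2)" using True by simp
    show "(r - l) / (real n + 2) \<le> (r - l) / 2" by (rule divide_left_mono) (use True in auto)
  qed
  have cd: "l < c n" "c n \<le> d n" "d n < r" for n
  proof -
    obtain q where q: "(r - l) / (real n + 2) = q" by simp
    show "l < c n" "c n \<le> d n" "d n < r" using frac[of n] unfolding c_d_def q by simp_all
  qed
  show ?thesis
  proof (rule borel_measurable_LIMSEQ_real)
    fix n
    have "set_integrable lebesgue {c n..d n} f" using assms cd by (auto simp: locally_integrable_def)
    then have "(\<lambda>x. indicator {c n..d n} x * f x) \<in> borel_measurable lebesgue"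
      by (auto simp: set_integrable_def intro: borel_measurable_integrable)
    then show "(\<lambda>x. indicator {c n..d n} x * f x) \<in> borel_measurable (lebesgue_on {l<..<r})"
      by (rule measurable_restrict_space1)
  next
    fix x assume "x \<in> space (lebesgue_on {l<..<r})"
    then have x: "l < x" "x < r" by auto
    have "c \<longlonglongrightarrow> l" "d \<longlonglongrightarrow> r" unfolding c_d_def[abs_def] by real_asymp+
    then have "\<forall>\<^sub>F n in sequentially. c n < x" "\<forall>\<^sub>F n in sequentially. x < d n"
      using x by (auto intro: order_tendstoD)
    then have "\<forall>\<^sub>F n in sequentially. indicator {c n..d n} x * f x = f x" by eventually_elim auto
    then show "(\<lambda>n. indicator {c n..d n} x * f x) \<longlonglongrightarrow> f x" by (rule tendsto_eventually)
  qed
qed (simp add: measurable_def)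

lemma integral_I01_borel:
  fixes h :: "real \<Rightarrow> real"
  assumes "h \<in> borel_measurable borel"
  shows "(LINT x|I01. h x) = (LINT x|lborel. indicator {0<..<1} x * h x)"
proof -
  have "(LINT x|I01. h x) = (LINT x|lebesgue. indicator {0<..<1} x * h x)"
    by (simp add: integral_restrict_space)
  also have "\<dots> = (LINT x|lborel. indicator {0<..<1} x * h x)"
    using assms by (intro integral_completion) measurable
  finally show ?thesis .
qed

lemma smooth_integral_deriv:
  assumes \<psi>: "smooth \<psi>" and "a \<le> b"
  shows "(LINT x|lborel. indicator {a<..<b} x * deriv \<psi> x) = \<psi> b - \<psi> a"
proof -
  have "(LINT x|lborel. deriv \<psi> x * indicator {a..b} x) = \<psi> b - \<psi> a"
  proof (rule integral_FTC_Icc_real[OF \<open>a \<le> b\<close>])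
    show "DERIV \<psi> x :> deriv \<psi> x" for x by (rule smooth_has_deriv[OF \<psi>])
    show "isCont (deriv \<psi>) x" for x
      using smooth_continuous_deriv(2)[OF \<psi>, of UNIV] continuous_on_eq_continuous_at[OF open_UNIV] by blast
  qed
  moreover have "(LINT x|lborel. deriv \<psi> x * indicator {a..b} x) = (LINT x|lborel. indicator {a<..<b} x * deriv \<psi> x)"
  proof (rule integral_cong_AE)
    have "AE x in lborel. x \<noteq> a" "AE x in lborel. x \<noteq> b" by (rule AE_lborel_singleton)+
    then show "AE x in lborel. deriv \<psi> x * indicator {a..b} x = indicator {a<..<b} x * deriv \<psi> x"
      by eventually_elim (auto simp: indicator_def)
    have [measurable]: "deriv \<psi> \<in> borel_measurable borel"
      using \<psi> by (intro borel_measurable_continuous_onI smooth_continuous_deriv)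
    show "(\<lambda>x. deriv \<psi> x * indicator {a..b} x) \<in> borel_measurable lborel" by measurable
    show "(\<lambda>x. indicator {a<..<b} x * deriv \<psi> x) \<in> borel_measurable lborel" by measurable
  qed
  ultimately show ?thesis by simp
qed

lemma test_fun_ends:
  assumes "test_fun l r \<psi>" shows "\<psi> l = 0" "\<psi> r = 0"
proof -
  obtain c d where "l < c" "d < r" "\<And>x. x \<notin> {c..d} \<Longrightarrow> \<psi> x = 0"
    using test_fun_support[OF assms] by metis
  then show "\<psi> l = 0" "\<psi> r = 0" by auto
qed

lemma integral_test_fun_by_parts:
  assumes \<psi>: "test_fun 0 1 \<psi>" and \<theta>: "test_fun 0 1 \<theta>"
  shows "(LINT x|I01. \<psi> x * deriv \<theta> x) = - (LINT x|I01. deriv \<psi> x * \<theta> x)"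
proof -
  note t = test_fun_mult[OF test_fun_smooth[OF \<psi>] \<theta>]
  have "(LINT x|I01. deriv (\<lambda>x. \<psi> x * \<theta> x) x) = 0"
    using test_fun_measurable(2)[OF t(1)] smooth_integral_deriv[OF test_fun_smooth[OF t(1)], of 0 1] test_fun_ends[OF \<psi>]
    by (simp add: integral_I01_borel)
  then have "(LINT x|I01. deriv \<psi> x * \<theta> x + \<psi> x * deriv \<theta> x) = 0" by (simp add: t(2))
  then show ?thesis
    using sqint_mult_integrable[OF sqint_I01_test_fun(2)[OF \<psi>] sqint_I01_test_fun(1)[OF \<theta>]]
      sqint_mult_integrable[OF sqint_I01_test_fun(1)[OF \<psi>] sqint_I01_test_fun(2)[OF \<theta>]] by simp
qed

text \<open>Function and gradient are kept together, so that limits can be taken in the graph norm.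
  That the second is the weak derivative of the first is a consequence, by passage to the limit in
  the approximating test functions.\<close>

definition H10_deriv :: "(real \<Rightarrow> real) \<Rightarrow> (real \<Rightarrow> real) \<Rightarrow> bool" where
  "H10_deriv f g \<longleftrightarrow> sqint I01 f \<and> sqint I01 g \<and> (\<exists>\<psi>. (\<forall>n::nat. test_fun 0 1 (\<psi> n)) \<and>
     (\<lambda>n. l2norm I01 (\<lambda>x. \<psi> n x - f x)) \<longlonglongrightarrow> 0 \<and> (\<lambda>n. l2norm I01 (\<lambda>x. deriv (\<psi> n) x - g x)) \<longlonglongrightarrow> 0)"

lemma H10_deriv_sqint: "H10_deriv f g \<Longrightarrow> sqint I01 f" "H10_deriv f g \<Longrightarrow> sqint I01 g"
  by (auto simp: H10_deriv_def)

lemma H10_imp_H10_deriv: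
  assumes "f \<in> H10"
  obtains g where "H10_deriv f g"
proof -
  obtain g where f: "f \<in> L2" and g: "g \<in> L2" and ex: "\<exists>\<psi>. (\<forall>n::nat. test_fun 0 1 (\<psi> n)) \<and>
      (\<lambda>n. LINT x|I01. (\<psi> n x - f x)\<^sup>2) \<longlonglongrightarrow> 0 \<and> (\<lambda>n. LINT x|I01. (deriv (\<psi> n) x - g x)\<^sup>2) \<longlonglongrightarrow> 0"
    using assms unfolding H10_def mem_Collect_eq by (elim conjE bexE) (rule that)
  have "H10_deriv f g"
    unfolding H10_deriv_def l2norm_tendsto_iff using f g ex by (simp only: L2_iff_sqint simp_thms)
  then show ?thesis by (rule that)
qed

lemma H10_deriv_weak_deriv:
  assumes "H10_deriv f g"
  shows "weak_deriv 0 1 f g"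
  unfolding weak_deriv_def set_integral_I01
proof (intro conjI allI impI)
  show "locally_integrable 0 1 f" "locally_integrable 0 1 g"
    using assms by (auto simp: H10_deriv_def intro!: integrable_I01_locally_integrable sqint_I01_integrable)
  fix \<theta> assume \<theta>: "test_fun 0 1 \<theta>"
  obtain \<psi> where fg: "sqint I01 f" "sqint I01 g" and \<psi>: "\<And>n::nat. test_fun 0 1 (\<psi> n)"
    "(\<lambda>n. l2norm I01 (\<lambda>x. \<psi> n x - f x)) \<longlonglongrightarrow> 0" "(\<lambda>n. l2norm I01 (\<lambda>x. deriv (\<psi> n) x - g x)) \<longlonglongrightarrow> 0"
    using assms unfolding H10_deriv_def by blast
  have "(\<lambda>n. LINT x|I01. \<psi> n x * deriv \<theta> x) \<longlonglongrightarrow> (LINT x|I01. f x * deriv \<theta> x)"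
    by (rule l2_tendsto_integral_mult[OF sqint_I01_test_fun(1)[OF \<psi>(1)] fg(1) sqint_I01_test_fun(2)[OF \<theta>] \<psi>(2)])
  moreover have "(\<lambda>n. LINT x|I01. deriv (\<psi> n) x * \<theta> x) \<longlonglongrightarrow> (LINT x|I01. g x * \<theta> x)"
    by (rule l2_tendsto_integral_mult[OF sqint_I01_test_fun(2)[OF \<psi>(1)] fg(2) sqint_I01_test_fun(1)[OF \<theta>] \<psi>(3)])
  then have "(\<lambda>n. LINT x|I01. \<psi> n x * deriv \<theta> x) \<longlonglongrightarrow> - (LINT x|I01. g x * \<theta> x)"
    unfolding integral_test_fun_by_parts[OF \<psi>(1) \<theta>] by (rule tendsto_minus)
  ultimately show "(LINT x|I01. f x * deriv \<theta> x) = - (LINT x|I01. g x * \<theta> x)" by (rule LIMSEQ_unique)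
qed

lemma l2norm_cong_AE:
  assumes "AE x in M. f x = g x" "f \<in> borel_measurable M" "g \<in> borel_measurable M"
  shows "l2norm M f = l2norm M g"
proof -
  have "(LINT x|M. (f x)\<^sup>2) = (LINT x|M. (g x)\<^sup>2)"
    by (rule integral_cong_AE) (use assms in auto)
  then show ?thesis by (simp add: l2norm_def)
qed

text \<open>By uniqueness any weak derivative can replace the one provided by \<open>H10\<close>;
  this is how the given \<open>ux\<close> becomes the gradient of almost every slice.\<close>

lemma H10_derivI_weak_deriv:
  assumes "f \<in> H10" "weak_deriv 0 1 f g"
  shows "H10_deriv f g"
proof -
  obtain g0 where g0: "H10_deriv f g0" by (rule H10_imp_H10_deriv[OF assms(1)])
  have eq: "AE x in I01. g0 x = g x"
    by (rule weak_deriv_unique[OF H10_deriv_weak_deriv[OF g0] assms(2)]) simp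
  have g: "g \<in> borel_measurable I01"
    using assms(2) by (intro locally_integrable_measurable) (simp add: weak_deriv_def)
  have "l2norm I01 (\<lambda>x. deriv \<psi> x - g x) = l2norm I01 (\<lambda>x. deriv \<psi> x - g0 x)" if \<psi>: "test_fun 0 1 \<psi>" for \<psi>
  proof (rule l2norm_cong_AE)
    show "AE x in I01. deriv \<psi> x - g x = deriv \<psi> x - g0 x" using eq by eventually_elim simp
    show "(\<lambda>x. deriv \<psi> x - g x) \<in> borel_measurable I01"
      using g test_fun_deriv_measurable_on[OF \<psi>] by (intro borel_measurable_diff)
    show "(\<lambda>x. deriv \<psi> x - g0 x) \<in> borel_measurable I01"
      using sqint_measurable[OF H10_deriv_sqint(2)[OF g0]] test_fun_deriv_measurable_on[OF \<psi>]
      by (intro borel_measurable_diff)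
  qed
  note tr = this
  obtain \<psi> where \<psi>: "\<forall>n::nat. test_fun 0 1 (\<psi> n)" "(\<lambda>n. l2norm I01 (\<lambda>x. \<psi> n x - f x)) \<longlonglongrightarrow> 0"
    "(\<lambda>n. l2norm I01 (\<lambda>x. deriv (\<psi> n) x - g0 x)) \<longlonglongrightarrow> 0"
    using g0 unfolding H10_deriv_def by blast
  have "(\<lambda>n. l2norm I01 (\<lambda>x. deriv (\<psi> n) x - g x)) \<longlonglongrightarrow> 0"
    unfolding tr[OF \<psi>(1)[rule_format]] by (fact \<psi>(3))
  with \<psi> show ?thesis
    using H10_deriv_sqint(1)[OF g0] sqint_cong_AE[OF H10_deriv_sqint(2)[OF g0] eq g]
    unfolding H10_deriv_def by blast
qed

text \<open>A choice of test functions at distance below \<open>1 / (n + 1)\<close> from the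
  \<open>n\<close>-th pair follows the sequence to its limit. The trace at the final time is
  identified in this way.\<close>

lemma H10_deriv_limit:
  assumes fg: "\<And>n::nat. H10_deriv (f n) (g n)" and sq: "sqint I01 f0" "sqint I01 g0"
    and lim: "(\<lambda>n. l2norm I01 (\<lambda>x. f n x - f0 x)) \<longlonglongrightarrow> 0" "(\<lambda>n. l2norm I01 (\<lambda>x. g n x - g0 x)) \<longlonglongrightarrow> 0"
  shows "H10_deriv f0 g0"
proof -
  have "\<exists>\<psi>. test_fun 0 1 \<psi> \<and> l2norm I01 (\<lambda>x. \<psi> x - f n x) < 1 / (real n + 1) \<and>
      l2norm I01 (\<lambda>x. deriv \<psi> x - g n x) < 1 / (real n + 1)" for n
  proof -
    obtain \<psi> where \<psi>: "\<And>k::nat. test_fun 0 1 (\<psi> k)"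
      "(\<lambda>k. l2norm I01 (\<lambda>x. \<psi> k x - f n x)) \<longlonglongrightarrow> 0" "(\<lambda>k. l2norm I01 (\<lambda>x. deriv (\<psi> k) x - g n x)) \<longlonglongrightarrow> 0"
      using fg[of n] unfolding H10_deriv_def by blast
    have "\<forall>\<^sub>F k in sequentially. l2norm I01 (\<lambda>x. \<psi> k x - f n x) < 1 / (real n + 1) \<and>
        l2norm I01 (\<lambda>x. deriv (\<psi> k) x - g n x) < 1 / (real n + 1)"
      using order_tendstoD(2)[OF \<psi>(2)] order_tendstoD(2)[OF \<psi>(3)] by (intro eventually_conj) auto
    then show ?thesis using \<psi>(1) unfolding eventually_sequentially by blast
  qed
  then obtain \<psi> where \<psi>: "\<And>n. test_fun 0 1 (\<psi> n)" "\<And>n. l2norm I01 (\<lambda>x. \<psi> n x - f n x) < 1 / (real n + 1)"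
    "\<And>n. l2norm I01 (\<lambda>x. deriv (\<psi> n) x - g n x) < 1 / (real n + 1)" by metis
  have l: "(\<lambda>n. l2norm I01 (\<lambda>x. p n x - h0 x)) \<longlonglongrightarrow> 0"
    if "\<And>n. sqint I01 (p n)" "\<And>n. sqint I01 (h n)" "sqint I01 h0" "\<And>n. l2norm I01 (\<lambda>x. p n x - h n x) < 1 / (real n + 1)"
      "(\<lambda>n. l2norm I01 (\<lambda>x. h n x - h0 x)) \<longlonglongrightarrow> 0" for p h :: "nat \<Rightarrow> real \<Rightarrow> real" and h0
  proof (rule tendsto_sandwich[OF _ _ tendsto_const])
    have "(\<lambda>n. 1 / (real n + 1)) \<longlonglongrightarrow> 0" by real_asymp
    from tendsto_add[OF this that(5)]
    show "(\<lambda>n. 1 / (real n + 1) + l2norm I01 (\<lambda>x. h n x - h0 x)) \<longlonglongrightarrow> 0" by simp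
    have "l2norm I01 (\<lambda>x. p n x - h0 x) \<le> 1 / (real n + 1) + l2norm I01 (\<lambda>x. h n x - h0 x)" for n
      using l2norm_triangle_diff[OF that(1,2,3), of n n] that(4)[of n] by linarith
    then show "\<forall>\<^sub>F n in sequentially. l2norm I01 (\<lambda>x. p n x - h0 x) \<le> 1 / (real n + 1) + l2norm I01 (\<lambda>x. h n x - h0 x)"
      by simp
  qed simp
  note t = sqint_I01_test_fun[OF \<psi>(1)]
  have "(\<lambda>n. l2norm I01 (\<lambda>x. \<psi> n x - f0 x)) \<longlonglongrightarrow> 0"
    by (rule l[OF t(1) H10_deriv_sqint(1)[OF fg] sq(1) \<psi>(2) lim(1)])
  moreover have "(\<lambda>n. l2norm I01 (\<lambda>x. deriv (\<psi> n) x - g0 x)) \<longlonglongrightarrow> 0"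
    by (rule l[OF t(2) H10_deriv_sqint(2)[OF fg] sq(2) \<psi>(3) lim(2)])
  ultimately show ?thesis using sq \<psi>(1) unfolding H10_deriv_def by blast
qed

section \<open>Decay at the end points and integration by parts in space\<close>

lemma test_fun_power2_le:
  assumes \<psi>: "test_fun 0 1 \<psi>" and "0 \<le> a" "a \<le> b" "b \<le> 1"
  shows "(\<psi> b - \<psi> a)\<^sup>2 \<le> (b - a) * (LINT x|I01. (deriv \<psi> x)\<^sup>2)"
proof -
  have [measurable]: "deriv \<psi> \<in> borel_measurable borel" by (rule test_fun_measurable[OF \<psi>])
  have ind: "sqint I01 (indicator {a<..<b})"
    by (rule sqint_I01_bounded[of _ 1]) (auto intro: borel_measurable_lebesgue_onI)
  have sub: "indicator {0<..<1} x * indicator {a<..<b} x = (indicator {a<..<b} x :: real)" for x :: real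
    using assms by (auto simp: indicator_def)
  have "(LINT x|I01. indicator {a<..<b} x * deriv \<psi> x) = \<psi> b - \<psi> a"
    using smooth_integral_deriv[OF test_fun_smooth[OF \<psi>] \<open>a \<le> b\<close>]
    by (subst integral_I01_borel) (auto simp: mult.assoc[symmetric] sub)
  then have "\<bar>\<psi> b - \<psi> a\<bar> \<le> l2norm I01 (indicator {a<..<b}) * l2norm I01 (deriv \<psi>)"
    using l2_Cauchy_Schwarz[OF ind sqint_I01_test_fun(2)[OF \<psi>]] by simp
  then have "(\<psi> b - \<psi> a)\<^sup>2 \<le> (l2norm I01 (indicator {a<..<b}) * l2norm I01 (deriv \<psi>))\<^sup>2"
    using power_mono[of "\<bar>\<psi> b - \<psi> a\<bar>" _ 2] by simp
  also have "\<dots> = (LINT x|I01. (indicator {a<..<b} x)\<^sup>2) * (LINT x|I01. (deriv \<psi> x)\<^sup>2)"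
    by (simp add: power_mult_distrib l2norm_power2)
  also have "(LINT x|I01. (indicator {a<..<b} x)\<^sup>2) = b - a"
  proof -
    have "(LINT x|I01. (indicator {a<..<b} x)\<^sup>2) = (LINT x|lborel. indicator {a<..<b} x :: real)"
    proof (subst integral_I01_borel)
      have "(\<lambda>x. indicator {0<..<1} x * (indicator {a<..<b} x)\<^sup>2) = (indicator {a<..<b} :: real \<Rightarrow> real)"
        using assms by (auto simp: fun_eq_iff indicator_def)
      then show "(LINT x|lborel. indicator {0<..<1} x * (indicator {a<..<b} x)\<^sup>2)
          = (LINT x|lborel. indicator {a<..<b} x :: real)" by simp
    qed measurable
    then show ?thesis using \<open>a \<le> b\<close> by simp
  qed
  finally show ?thesis .
qed

text \<open>A test function vanishes at the end points, so its square is at most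
  \<open>2 \<delta>\<close> times the gradient energy on the strips. These are disjoint with total
  length \<open>4 \<delta>\<close>, which yields \<open>8 \<delta>^2\<close>; 8 is raised to 9 to
  obtain a rational root. Both sides pass to the limit.\<close>

lemma H10_deriv_boundary_strip:
  assumes fg: "H10_deriv f g" and \<delta>: "0 < \<delta>" "\<delta> < 1/4"
  shows "l2norm I01 (\<lambda>x. indicator ({0<..<2*\<delta>} \<union> {1-2*\<delta><..<1}) x * f x) \<le> 3 * \<delta> * l2norm I01 g"
proof -
  define S where "S = {0<..<2*\<delta>} \<union> {1-2*\<delta><..<1::real}"
  have [measurable]: "S \<in> sets borel" by (simp add: S_def)
  have indm: "(indicator S :: real \<Rightarrow> real) \<in> borel_measurable I01" by (intro borel_measurable_lebesgue_onI) measurable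
  have sqS: "sqint I01 (\<lambda>x. indicator S x * h x)" if "sqint I01 h" for h
    by (rule sqint_mult_bounded[OF that indm, of 1]) simp
  have mS: "(LINT x|I01. indicator S x) = 4 * \<delta>"
  proof -
    have "(LINT x|I01. indicator S x :: real) = (LINT x|lborel. indicator {0<..<2*\<delta>} x + indicator {1-2*\<delta><..<1} x)"
      using \<delta> by (subst integral_I01_borel) (auto simp: S_def indicator_def intro!: Bochner_Integration.integral_cong)
    then show ?thesis using \<delta> by simp
  qed
  have test: "l2norm I01 (\<lambda>x. indicator S x * \<psi> x) \<le> 3 * \<delta> * l2norm I01 (deriv \<psi>)" if \<psi>: "test_fun 0 1 \<psi>" for \<psi>
  proof (rule power2_le_imp_le)
    have le: "(indicator S x * \<psi> x)\<^sup>2 \<le> (2 * \<delta> * (LINT x|I01. (deriv \<psi> x)\<^sup>2)) * indicator S x" for x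
    proof (cases "x \<in> S")
      case True
      have E0: "0 \<le> (LINT x|I01. (deriv \<psi> x)\<^sup>2)" by simp
      consider "0 < x" "x < 2 * \<delta>" | "1 - 2 * \<delta> < x" "x < 1" using True by (auto simp: S_def)
      then have "(\<psi> x)\<^sup>2 \<le> 2 * \<delta> * (LINT x|I01. (deriv \<psi> x)\<^sup>2)"
      proof cases
        case 1
        have "(\<psi> x - \<psi> 0)\<^sup>2 \<le> (x - 0) * (LINT x|I01. (deriv \<psi> x)\<^sup>2)"
          using 1 \<delta> by (intro test_fun_power2_le[OF \<psi>]) auto
        also have "\<dots> \<le> 2 * \<delta> * (LINT x|I01. (deriv \<psi> x)\<^sup>2)" using 1 by (intro mult_right_mono E0) auto
        finally show ?thesis using test_fun_ends[OF \<psi>] by simp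
      next
        case 2
        have "(\<psi> 1 - \<psi> x)\<^sup>2 \<le> (1 - x) * (LINT x|I01. (deriv \<psi> x)\<^sup>2)"
          using 2 \<delta> by (intro test_fun_power2_le[OF \<psi>]) auto
        also have "\<dots> \<le> 2 * \<delta> * (LINT x|I01. (deriv \<psi> x)\<^sup>2)" using 2 by (intro mult_right_mono E0) auto
        finally show ?thesis using test_fun_ends[OF \<psi>] by simp
      qed
      then show ?thesis using True by simp
    qed simp
    have "(l2norm I01 (\<lambda>x. indicator S x * \<psi> x))\<^sup>2 \<le> (LINT x|I01. (2 * \<delta> * (LINT x|I01. (deriv \<psi> x)\<^sup>2)) * indicator S x)"
      unfolding l2norm_power2
    proof (rule integral_mono[OF _ _ le])
      show "integrable I01 (\<lambda>x. (indicator S x * \<psi> x)\<^sup>2)"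
        by (rule sqint_integrable[OF sqS[OF sqint_I01_test_fun(1)[OF \<psi>]]])
      have "sqint I01 (indicator S)" by (rule sqint_I01_bounded[OF indm, of 1]) simp
      then show "integrable I01 (\<lambda>x. (2 * \<delta> * (LINT x|I01. (deriv \<psi> x)\<^sup>2)) * indicator S x)"
        by (intro integrable_mult_right sqint_I01_integrable)
    qed
    also have "\<dots> = 8 * \<delta>\<^sup>2 * (l2norm I01 (deriv \<psi>))\<^sup>2"
      by (simp only: integral_mult_right_zero mS l2norm_power2) (simp add: power2_eq_square)
    also have "\<dots> \<le> 9 * \<delta>\<^sup>2 * (l2norm I01 (deriv \<psi>))\<^sup>2" by (intro mult_right_mono) auto
    also have "\<dots> = (3 * \<delta> * l2norm I01 (deriv \<psi>))\<^sup>2" by (simp add: power_mult_distrib)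
    finally show "(l2norm I01 (\<lambda>x. indicator S x * \<psi> x))\<^sup>2 \<le> (3 * \<delta> * l2norm I01 (deriv \<psi>))\<^sup>2" .
  qed (use \<delta> in simp)
  obtain \<psi> where \<psi>: "\<And>n::nat. test_fun 0 1 (\<psi> n)"
    "(\<lambda>n. l2norm I01 (\<lambda>x. \<psi> n x - f x)) \<longlonglongrightarrow> 0" "(\<lambda>n. l2norm I01 (\<lambda>x. deriv (\<psi> n) x - g x)) \<longlonglongrightarrow> 0"
    using fg unfolding H10_deriv_def by blast
  note sq = H10_deriv_sqint[OF fg]
  have "(\<lambda>n. l2norm I01 (\<lambda>x. indicator S x * \<psi> n x)) \<longlonglongrightarrow> l2norm I01 (\<lambda>x. indicator S x * f x)"
  proof (rule l2_tendsto_l2norm[OF sqS[OF sqint_I01_test_fun(1)[OF \<psi>(1)]] sqS[OF sq(1)]])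
    show "(\<lambda>n. l2norm I01 (\<lambda>x. indicator S x * \<psi> n x - indicator S x * f x)) \<longlonglongrightarrow> 0"
    proof (rule tendsto_sandwich[OF _ _ tendsto_const \<psi>(2)])
      have "l2norm I01 (\<lambda>x. indicator S x * \<psi> n x - indicator S x * f x) \<le> l2norm I01 (\<lambda>x. \<psi> n x - f x)" for n
        unfolding l2norm_def
      proof (intro real_sqrt_le_mono integral_mono)
        note d = sqint_diff[OF sqint_I01_test_fun(1)[OF \<psi>(1)] sq(1), of n]
        show "integrable I01 (\<lambda>x. (\<psi> n x - f x)\<^sup>2)" by (rule sqint_integrable[OF d])
        show "integrable I01 (\<lambda>x. (indicator S x * \<psi> n x - indicator S x * f x)\<^sup>2)"
          using sqint_integrable[OF sqS[OF d]] by (simp add: right_diff_distrib)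
        show "(indicator S x * \<psi> n x - indicator S x * f x)\<^sup>2 \<le> (\<psi> n x - f x)\<^sup>2" for x
          by (simp add: indicator_def)
      qed
      then show "\<forall>\<^sub>F n in sequentially. l2norm I01 (\<lambda>x. indicator S x * \<psi> n x - indicator S x * f x)
          \<le> l2norm I01 (\<lambda>x. \<psi> n x - f x)" by simp
    qed simp
  qed
  moreover have "(\<lambda>n. 3 * \<delta> * l2norm I01 (deriv (\<psi> n))) \<longlonglongrightarrow> 3 * \<delta> * l2norm I01 g"
    by (intro tendsto_mult_left l2_tendsto_l2norm[OF sqint_I01_test_fun(2)[OF \<psi>(1)] sq(2) \<psi>(3)])
  ultimately have "l2norm I01 (\<lambda>x. indicator S x * f x) \<le> 3 * \<delta> * l2norm I01 g"
    by (rule LIMSEQ_le) (use test[OF \<psi>(1)] in blast)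
  then show ?thesis by (simp add: S_def)
qed

text \<open>The weak derivative of \<open>p\<close> is tested with \<open>\<eta>\<close> times the
  approximating functions of \<open>f\<close>. The limit is taken in \<open>L^2\<close>, which is
  why \<open>\<eta> q\<close> has to lie there; \<open>q\<close> itself may be too singular at the
  end points.\<close>

lemma H10_deriv_integral_by_parts_cutoff:
  assumes fg: "H10_deriv f f'" and p: "sqint I01 p" and pq: "weak_deriv 0 1 p q"
    and \<eta>: "smooth \<eta>" "\<And>x. \<bar>\<eta> x\<bar> \<le> K" "\<And>x. \<bar>deriv \<eta> x\<bar> \<le> K" and \<eta>q: "sqint I01 (\<lambda>x. \<eta> x * q x)"
  shows "(LINT x|I01. f x * (deriv \<eta> x * p x)) + (LINT x|I01. f' x * (\<eta> x * p x)) = - (LINT x|I01. f x * (\<eta> x * q x))"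
proof -
  obtain \<psi> where \<psi>: "\<And>n::nat. test_fun 0 1 (\<psi> n)"
    "(\<lambda>n. l2norm I01 (\<lambda>x. \<psi> n x - f x)) \<longlonglongrightarrow> 0" "(\<lambda>n. l2norm I01 (\<lambda>x. deriv (\<psi> n) x - f' x)) \<longlonglongrightarrow> 0"
    using fg unfolding H10_deriv_def by blast
  note sq = H10_deriv_sqint[OF fg] and t = sqint_I01_test_fun[OF \<psi>(1)]
  have m: "\<eta> \<in> borel_measurable I01" "deriv \<eta> \<in> borel_measurable I01"
    using \<eta>(1) by (auto intro!: borel_measurable_lebesgue_onI borel_measurable_continuous_onI smooth_continuous_deriv)
  have sp: "sqint I01 (\<lambda>x. deriv \<eta> x * p x)" "sqint I01 (\<lambda>x. \<eta> x * p x)"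
    using p m \<eta> by (auto intro: sqint_mult_bounded)
  have eq: "(LINT x|I01. \<psi> n x * (deriv \<eta> x * p x)) + (LINT x|I01. deriv (\<psi> n) x * (\<eta> x * p x))
      = - (LINT x|I01. \<psi> n x * (\<eta> x * q x))" for n
  proof -
    note tm = test_fun_mult[OF \<eta>(1) \<psi>(1), of n]
    have "(LINT x|I01. p x * deriv (\<lambda>x. \<eta> x * \<psi> n x) x) = - (LINT x|I01. q x * (\<eta> x * \<psi> n x))"
      using pq tm(1) unfolding weak_deriv_def set_integral_I01 by blast
    moreover have "(LINT x|I01. p x * deriv (\<lambda>x. \<eta> x * \<psi> n x) x)
        = (LINT x|I01. \<psi> n x * (deriv \<eta> x * p x) + deriv (\<psi> n) x * (\<eta> x * p x))"
      by (rule Bochner_Integration.integral_cong) (auto simp: tm(2) algebra_simps)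
    moreover have "\<dots> = (LINT x|I01. \<psi> n x * (deriv \<eta> x * p x)) + (LINT x|I01. deriv (\<psi> n) x * (\<eta> x * p x))"
      by (rule Bochner_Integration.integral_add[OF sqint_mult_integrable[OF t(1) sp(1)] sqint_mult_integrable[OF t(2) sp(2)]])
    moreover have "(LINT x|I01. q x * (\<eta> x * \<psi> n x)) = (LINT x|I01. \<psi> n x * (\<eta> x * q x))"
      by (rule Bochner_Integration.integral_cong) auto
    ultimately show ?thesis by simp
  qed
  have "(\<lambda>n. (LINT x|I01. \<psi> n x * (deriv \<eta> x * p x)) + (LINT x|I01. deriv (\<psi> n) x * (\<eta> x * p x)))
      \<longlonglongrightarrow> (LINT x|I01. f x * (deriv \<eta> x * p x)) + (LINT x|I01. f' x * (\<eta> x * p x))"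
    by (intro tendsto_add l2_tendsto_integral_mult[OF t(1) sq(1) sp(1) \<psi>(2)]
        l2_tendsto_integral_mult[OF t(2) sq(2) sp(2) \<psi>(3)])
  moreover have "(\<lambda>n. - (LINT x|I01. \<psi> n x * (\<eta> x * q x))) \<longlonglongrightarrow> - (LINT x|I01. f x * (\<eta> x * q x))"
    by (intro tendsto_minus l2_tendsto_integral_mult[OF t(1) sq(1) \<eta>q \<psi>(2)])
  ultimately show ?thesis unfolding eq by (rule LIMSEQ_unique)
qed

text \<open>A difference of two steps of width \<open>\<delta>\<close>, rising at
  \<open>\<delta>\<close> and falling from \<open>1 - 2 \<delta>\<close>. Both step derivatives lie
  between 0 and \<open>M\<close>, before scaling, so their difference is bounded by the same
  \<open>M\<close>.\<close>

lemma exists_cutoffs: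
  obtains \<eta> :: "nat \<Rightarrow> real \<Rightarrow> real" and \<delta> :: "nat \<Rightarrow> real" and M where
    "\<And>n. 0 < \<delta> n" "\<And>n. \<delta> n < 1/4" "\<delta> \<longlonglongrightarrow> 0" "0 \<le> M"
    "\<And>n. smooth (\<eta> n)" "\<And>n x. \<bar>\<eta> n x\<bar> \<le> 1" "\<And>n x. \<bar>deriv (\<eta> n) x\<bar> \<le> M / \<delta> n"
    "\<And>n x. x \<notin> {\<delta> n..1 - \<delta> n} \<Longrightarrow> \<eta> n x = 0"
    "\<And>n x. x \<in> {2 * \<delta> n..1 - 2 * \<delta> n} \<Longrightarrow> \<eta> n x = 1"
    "\<And>n x. x \<in> {2 * \<delta> n..1 - 2 * \<delta> n} \<Longrightarrow> deriv (\<eta> n) x = 0"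
proof -
  obtain \<sigma> M where \<sigma>: "smooth \<sigma>" "\<And>x. x \<le> 0 \<Longrightarrow> \<sigma> x = 0" "\<And>x. x \<ge> 1 \<Longrightarrow> \<sigma> x = 1"
    "\<And>x. 0 \<le> \<sigma> x \<and> \<sigma> x \<le> 1" "\<And>x. 0 \<le> deriv \<sigma> x \<and> deriv \<sigma> x \<le> M" "\<And>x. x \<notin> {0<..<1} \<Longrightarrow> deriv \<sigma> x = 0"
    by (rule exists_smooth_step) blast
  \<comment> \<open>Starting at 1/5 keeps \<open>\<delta> n\<close> below 1/4, so that the plateau
    is never empty.\<close>
  define \<delta> where "\<delta> n = 1 / (real n + 5)" for n
  have \<delta>: "0 < \<delta> n" "\<delta> n < 1/4" for n by (auto simp: \<delta>_def field_simps)
  have \<delta>lim: "\<delta> \<longlonglongrightarrow> 0" unfolding \<delta>_def[abs_def] by real_asymp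
  define S where "S n c x = \<sigma> ((1 / \<delta> n) * x + (- c / \<delta> n))" for n c x
  have S_eq: "S n c x = \<sigma> ((x - c) / \<delta> n)" for n c x by (simp add: S_def diff_divide_distrib)
  have smS: "smooth (S n c)" for n c unfolding S_def[abs_def] by (rule smooth_affine[OF \<sigma>(1)])
  have dS: "(S n c has_real_derivative deriv \<sigma> ((x - c) / \<delta> n) / \<delta> n) (at x)" for n c x
  proof -
    have "((\<lambda>x. \<sigma> ((x - c) / \<delta> n)) has_real_derivative deriv \<sigma> ((x - c) / \<delta> n) * (1 / \<delta> n)) (at x)"
      using \<delta>[of n] by (intro DERIV_chain2[OF smooth_has_deriv[OF \<sigma>(1)]]) (auto intro!: derivative_eq_intros)
    then show ?thesis by (simp add: S_eq[abs_def])
  qed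
  define \<eta> where "\<eta> n x = S n (\<delta> n) x - S n (1 - 2 * \<delta> n) x" for n x
  have d\<eta>: "deriv (\<eta> n) x = (deriv \<sigma> ((x - \<delta> n) / \<delta> n) - deriv \<sigma> ((x - (1 - 2 * \<delta> n)) / \<delta> n)) / \<delta> n" for n x
    unfolding \<eta>_def[abs_def] diff_divide_distrib[of "deriv \<sigma> _"] by (intro DERIV_imp_deriv DERIV_diff dS)
  have arg: "(x - c) / \<delta> n \<le> 0 \<longleftrightarrow> x \<le> c" "1 \<le> (x - c) / \<delta> n \<longleftrightarrow> c + \<delta> n \<le> x" for n x c
    using \<delta>[of n] by (auto simp: divide_le_0_iff le_divide_eq)
  have S0: "S n c x = 0" if "x \<le> c" for n c x using that \<sigma>(2) arg by (simp add: S_eq)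
  have S1: "S n c x = 1" if "c + \<delta> n \<le> x" for n c x using that \<sigma>(3) arg by (simp add: S_eq)
  show thesis
  proof (rule that[of \<delta> M \<eta>])
    show "0 < \<delta> n" "\<delta> n < 1/4" for n by (fact \<delta>)+
    show "\<delta> \<longlonglongrightarrow> 0" by (fact \<delta>lim)
    show "0 \<le> M" using \<sigma>(5)[of 0] by linarith
    show "smooth (\<eta> n)" for n unfolding \<eta>_def[abs_def] by (intro smooth_diff smS)
    show "\<bar>\<eta> n x\<bar> \<le> 1" for n x
      using \<sigma>(4)[of "(x - \<delta> n) / \<delta> n"] \<sigma>(4)[of "(x - (1 - 2 * \<delta> n)) / \<delta> n"]
      unfolding \<eta>_def S_eq abs_le_iff by linarith
    show "\<bar>deriv (\<eta> n) x\<bar> \<le> M / \<delta> n" for n x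
    proof -
      have "\<bar>deriv \<sigma> ((x - \<delta> n) / \<delta> n) - deriv \<sigma> ((x - (1 - 2 * \<delta> n)) / \<delta> n)\<bar> \<le> M"
        using \<sigma>(5)[of "(x - \<delta> n) / \<delta> n"] \<sigma>(5)[of "(x - (1 - 2 * \<delta> n)) / \<delta> n"] unfolding abs_le_iff by linarith
      then show ?thesis using \<delta>[of n] by (simp add: d\<eta> divide_right_mono)
    qed
    show "\<eta> n x = 0" if out: "x \<notin> {\<delta> n..1 - \<delta> n}" for n x
    proof -
      consider "x < \<delta> n" | "x > 1 - \<delta> n" using out unfolding atLeastAtMost_iff by linarith
      then show ?thesis by cases (use \<delta>[of n] in \<open>auto simp: \<eta>_def S0 S1\<close>)
    qed
    show "\<eta> n x = 1" if "x \<in> {2 * \<delta> n..1 - 2 * \<delta> n}" for n x using that by (simp add: \<eta>_def S0 S1)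
    show "deriv (\<eta> n) x = 0" if "x \<in> {2 * \<delta> n..1 - 2 * \<delta> n}" for n x
    proof -
      have "deriv \<sigma> ((x - \<delta> n) / \<delta> n) = 0" using that arg(2)[where x = x and c = "\<delta> n" and n = n] by (intro \<sigma>(6)) auto
      moreover have "deriv \<sigma> ((x - (1 - 2 * \<delta> n)) / \<delta> n) = 0"
        using that arg(1)[where x = x and c = "1 - 2 * \<delta> n" and n = n] by (intro \<sigma>(6)) auto
      ultimately show ?thesis by (simp add: d\<eta>)
    qed
  qed
qed

text \<open>The cutoff error is \<open>\<integral> f p \<eta>'\<close>, where \<open>\<eta>'\<close> is of order \<open>1/\<delta>\<close> on the strips of width \<open>\<delta>\<close>
  at the end points; the Hardy type estimate \<open>H10_deriv_boundary_strip\<close> compensates this factor.\<close>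

lemma H10_deriv_integral_by_parts:
  assumes fg: "H10_deriv f f'" and p: "sqint I01 p" and pq: "weak_deriv 0 1 p q"
    and fq: "integrable I01 (\<lambda>x. f x * q x)"
    and q: "\<And>c d. 0 < c \<Longrightarrow> c \<le> d \<Longrightarrow> d < 1 \<Longrightarrow> sqint I01 (\<lambda>x. indicator {c..d} x * q x)"
  shows "(LINT x|I01. f' x * p x) = - (LINT x|I01. f x * q x)"
proof -
  obtain \<eta> :: "nat \<Rightarrow> real \<Rightarrow> real" and \<delta> :: "nat \<Rightarrow> real" and M where \<delta>: "\<And>n. 0 < \<delta> n" "\<And>n. \<delta> n < 1/4" "\<delta> \<longlonglongrightarrow> 0" "0 \<le> M"
    and \<eta>: "\<And>n. smooth (\<eta> n)" "\<And>n x. \<bar>\<eta> n x\<bar> \<le> 1" "\<And>n x. \<bar>deriv (\<eta> n) x\<bar> \<le> M / \<delta> n"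
    and \<eta>z: "\<And>n x. x \<notin> {\<delta> n..1 - \<delta> n} \<Longrightarrow> \<eta> n x = 0"
    "\<And>n x. x \<in> {2 * \<delta> n..1 - 2 * \<delta> n} \<Longrightarrow> \<eta> n x = 1"
    "\<And>n x. x \<in> {2 * \<delta> n..1 - 2 * \<delta> n} \<Longrightarrow> deriv (\<eta> n) x = 0"
    by (rule exists_cutoffs) (rule that)
  note sq = H10_deriv_sqint[OF fg]
  have m: "\<eta> n \<in> borel_measurable I01" "deriv (\<eta> n) \<in> borel_measurable I01" for n
    using \<eta>(1)[of n] by (auto intro!: borel_measurable_lebesgue_onI borel_measurable_continuous_onI smooth_continuous_deriv)
  define S where "S n = {0<..<2 * \<delta> n} \<union> {1 - 2 * \<delta> n<..<1}" for n
  have indm: "(indicator (S n) :: real \<Rightarrow> real) \<in> borel_measurable I01" for n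
    by (intro borel_measurable_lebesgue_onI) (simp add: S_def)
  have evS: "\<forall>\<^sub>F n in sequentially. x \<in> {2 * \<delta> n..1 - 2 * \<delta> n}" if x: "x \<in> {0<..<1}" for x
  proof -
    have "(\<lambda>n. 2 * \<delta> n) \<longlonglongrightarrow> 0" using tendsto_mult_right_zero[OF \<delta>(3)] by simp
    from order_tendstoD(2)[OF this, of x] order_tendstoD(2)[OF this, of "1 - x"]
    have "\<forall>\<^sub>F n in sequentially. 2 * \<delta> n < x" "\<forall>\<^sub>F n in sequentially. 2 * \<delta> n < 1 - x"
      using x by auto
    then show ?thesis by eventually_elim auto
  qed
  have eq: "(LINT x|I01. f x * (deriv (\<eta> n) x * p x)) + (LINT x|I01. f' x * (\<eta> n x * p x))
      = - (LINT x|I01. f x * (\<eta> n x * q x))" for n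
  \<comment> \<open>One common bound is required for the cutoff and its derivative, hence the
    maximum; its growth with \<open>n\<close> is harmless as \<open>n\<close> is fixed here.\<close>
  proof (rule H10_deriv_integral_by_parts_cutoff[OF fg p pq \<eta>(1), of n "max 1 (M / \<delta> n)"])
    show "\<bar>\<eta> n x\<bar> \<le> max 1 (M / \<delta> n)" "\<bar>deriv (\<eta> n) x\<bar> \<le> max 1 (M / \<delta> n)" for x
      using \<eta>(2,3)[of n x] by auto
    have "sqint I01 (\<lambda>x. \<eta> n x * (indicator {\<delta> n..1 - \<delta> n} x * q x))"
      using \<delta>(1,2)[of n] \<eta>(2) by (intro sqint_mult_bounded[OF q m(1)]) auto
    moreover have "(\<lambda>x. \<eta> n x * (indicator {\<delta> n..1 - \<delta> n} x * q x)) = (\<lambda>x. \<eta> n x * q x)"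
      using \<eta>z(1)[of _ n] by (auto simp: fun_eq_iff indicator_def)
    ultimately show "sqint I01 (\<lambda>x. \<eta> n x * q x)" by simp
  qed
  have dom: "(\<lambda>n. LINT x|I01. h x * (\<eta> n x * k x)) \<longlonglongrightarrow> (LINT x|I01. h x * k x)"
    if hk: "integrable I01 (\<lambda>x. h x * k x)" for h k
  proof -
    have "(\<lambda>n. LINT x|I01. \<eta> n x * (h x * k x)) \<longlonglongrightarrow> (LINT x|I01. h x * k x)"
    proof (rule integral_dominated_convergence[where w = "\<lambda>x. \<bar>h x * k x\<bar>"])
      show "integrable I01 (\<lambda>x. \<bar>h x * k x\<bar>)" using hk by (rule integrable_abs)
      show "(\<lambda>x. h x * k x) \<in> borel_measurable I01" using hk by (rule borel_measurable_integrable)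
      then show "(\<lambda>x. \<eta> n x * (h x * k x)) \<in> borel_measurable I01" for n by (intro borel_measurable_times[OF m(1)])
      show "AE x in I01. (\<lambda>n. \<eta> n x * (h x * k x)) \<longlonglongrightarrow> h x * k x"
      proof (rule AE_I2)
        fix x assume "x \<in> space I01"
        then have "\<forall>\<^sub>F n in sequentially. x \<in> {2 * \<delta> n..1 - 2 * \<delta> n}" by (intro evS) simp
        then have "\<forall>\<^sub>F n in sequentially. \<eta> n x * (h x * k x) = h x * k x"
          by eventually_elim (simp only: \<eta>z(2) mult_1)
        then show "(\<lambda>n. \<eta> n x * (h x * k x)) \<longlonglongrightarrow> h x * k x" by (rule tendsto_eventually)
      qed
      show "AE x in I01. norm (\<eta> n x * (h x * k x)) \<le> \<bar>h x * k x\<bar>" for n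
      proof (rule AE_I2)
        fix x
        have "\<bar>\<eta> n x\<bar> * \<bar>h x * k x\<bar> \<le> 1 * \<bar>h x * k x\<bar>" by (intro mult_right_mono \<eta>) simp
        then show "norm (\<eta> n x * (h x * k x)) \<le> \<bar>h x * k x\<bar>" by (simp only: real_norm_def abs_mult mult_1)
      qed
    qed
    then show ?thesis by (simp add: mult.left_commute)
  qed
  have sqSp: "sqint I01 (\<lambda>x. indicator (S n) x * h x)" if "sqint I01 h" for n h
    by (rule sqint_mult_bounded[OF that indm, where K = 1]) simp
  have Sp_lim: "(\<lambda>n. l2norm I01 (\<lambda>x. indicator (S n) x * p x)) \<longlonglongrightarrow> 0"
    unfolding l2norm_tendsto_iff
  proof -
    have "(\<lambda>n. LINT x|I01. (indicator (S n) x * p x)\<^sup>2) \<longlonglongrightarrow> (LINT x|I01. 0)"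
    proof (rule integral_dominated_convergence[where w = "\<lambda>x. (p x)\<^sup>2"])
      show "integrable I01 (\<lambda>x. (p x)\<^sup>2)" by (rule sqint_integrable[OF p])
      show "(\<lambda>x. (indicator (S n) x * p x)\<^sup>2) \<in> borel_measurable I01" for n
        by (rule borel_measurable_integrable[OF sqint_integrable[OF sqSp[OF p]]])
      show "AE x in I01. (\<lambda>n. (indicator (S n) x * p x)\<^sup>2) \<longlonglongrightarrow> 0"
      proof (rule AE_I2)
        fix x assume "x \<in> space I01"
        then have "\<forall>\<^sub>F n in sequentially. x \<in> {2 * \<delta> n..1 - 2 * \<delta> n}" by (intro evS) simp
        then have "\<forall>\<^sub>F n in sequentially. (indicator (S n) x * p x)\<^sup>2 = 0"
          by eventually_elim (auto simp: S_def indicator_def)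
        then show "(\<lambda>n. (indicator (S n) x * p x)\<^sup>2) \<longlonglongrightarrow> 0" by (rule tendsto_eventually)
      qed
      show "AE x in I01. norm ((indicator (S n) x * p x)\<^sup>2) \<le> (p x)\<^sup>2" for n
        by (rule AE_I2) (simp add: indicator_def)
    qed simp
    then show "(\<lambda>n. LINT x|I01. (indicator (S n) x * p x)\<^sup>2) \<longlonglongrightarrow> 0" by simp
  qed
  have err: "(\<lambda>n. LINT x|I01. f x * (deriv (\<eta> n) x * p x)) \<longlonglongrightarrow> 0"
  proof (rule Lim_null_comparison)
    show "(\<lambda>n. 3 * M * l2norm I01 f' * l2norm I01 (\<lambda>x. indicator (S n) x * p x)) \<longlonglongrightarrow> 0"
      by (rule tendsto_mult_right_zero[OF Sp_lim])
    show "\<forall>\<^sub>F n in sequentially. norm (LINT x|I01. f x * (deriv (\<eta> n) x * p x))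
        \<le> 3 * M * l2norm I01 f' * l2norm I01 (\<lambda>x. indicator (S n) x * p x)"
    proof (rule always_eventually, rule allI)
      fix n
      have sd: "sqint I01 (\<lambda>x. deriv (\<eta> n) x * (indicator (S n) x * p x))"
        by (rule sqint_mult_bounded[OF sqSp[OF p] m(2) \<eta>(3)])
      have "l2norm I01 (\<lambda>x. deriv (\<eta> n) x * (indicator (S n) x * p x)) \<le> l2norm I01 (\<lambda>x. (M / \<delta> n) * (indicator (S n) x * p x))"
        unfolding l2norm_def
      proof (intro real_sqrt_le_mono integral_mono)
        show "integrable I01 (\<lambda>x. (deriv (\<eta> n) x * (indicator (S n) x * p x))\<^sup>2)" by (rule sqint_integrable[OF sd])
        show "integrable I01 (\<lambda>x. ((M / \<delta> n) * (indicator (S n) x * p x))\<^sup>2)"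
          by (rule sqint_integrable[OF sqint_cmult[OF sqSp[OF p]]])
        fix x
        have "(deriv (\<eta> n) x)\<^sup>2 \<le> (M / \<delta> n)\<^sup>2" using power_mono[OF \<eta>(3), of n x 2] by simp
        then show "(deriv (\<eta> n) x * (indicator (S n) x * p x))\<^sup>2 \<le> ((M / \<delta> n) * (indicator (S n) x * p x))\<^sup>2"
          unfolding power_mult_distrib[of _ "indicator (S n) x * p x"] by (rule mult_right_mono) simp
      qed
      also have "\<dots> = (M / \<delta> n) * l2norm I01 (\<lambda>x. indicator (S n) x * p x)"
      proof -
        have "0 \<le> M / \<delta> n" using \<delta>(1)[of n] \<delta>(4) by simp
        then show ?thesis
          by (simp only: l2norm_def power_mult_distrib[of "M / \<delta> n"] integral_mult_right_zero real_sqrt_mult real_sqrt_abs abs_of_nonneg)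
      qed
      finally have b: "l2norm I01 (\<lambda>x. deriv (\<eta> n) x * (indicator (S n) x * p x))
          \<le> (M / \<delta> n) * l2norm I01 (\<lambda>x. indicator (S n) x * p x)" .
      have "(LINT x|I01. f x * (deriv (\<eta> n) x * p x))
          = (LINT x|I01. (indicator (S n) x * f x) * (deriv (\<eta> n) x * (indicator (S n) x * p x)))"
      proof (rule Bochner_Integration.integral_cong[OF refl])
        fix x assume x: "x \<in> space I01"
        show "f x * (deriv (\<eta> n) x * p x) = (indicator (S n) x * f x) * (deriv (\<eta> n) x * (indicator (S n) x * p x))"
        proof (cases "x \<in> S n")
          case False
          then have "x \<in> {2 * \<delta> n..1 - 2 * \<delta> n}" using x by (auto simp: S_def)
          then show ?thesis using \<eta>z(3) by simp
        qed simp
      qed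
      also have "\<bar>\<dots>\<bar> \<le> l2norm I01 (\<lambda>x. indicator (S n) x * f x) * l2norm I01 (\<lambda>x. deriv (\<eta> n) x * (indicator (S n) x * p x))"
        by (rule l2_Cauchy_Schwarz[OF sqSp[OF sq(1)] sd])
      also have "\<dots> \<le> (3 * \<delta> n * l2norm I01 f') * ((M / \<delta> n) * l2norm I01 (\<lambda>x. indicator (S n) x * p x))"
        using H10_deriv_boundary_strip[OF fg \<delta>(1,2), of n] \<delta>(1)[of n] by (intro mult_mono b) (auto simp: S_def)
      also have "\<dots> = 3 * M * l2norm I01 f' * l2norm I01 (\<lambda>x. indicator (S n) x * p x)"
        using \<delta>(1)[of n] by simp
      finally show "norm (LINT x|I01. f x * (deriv (\<eta> n) x * p x))
        \<le> 3 * M * l2norm I01 f' * l2norm I01 (\<lambda>x. indicator (S n) x * p x)" by simp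
    qed
  qed
  have "(\<lambda>n. (LINT x|I01. f x * (deriv (\<eta> n) x * p x)) + (LINT x|I01. f' x * (\<eta> n x * p x)))
      \<longlonglongrightarrow> 0 + (LINT x|I01. f' x * p x)"
    by (intro tendsto_add err dom sqint_mult_integrable[OF sq(2) p])
  moreover have "(\<lambda>n. - (LINT x|I01. f x * (\<eta> n x * q x))) \<longlonglongrightarrow> - (LINT x|I01. f x * q x)"
    by (intro tendsto_minus dom fq)
  ultimately show ?thesis unfolding eq using LIMSEQ_unique by fastforce
qed

section \<open>The weighted space and Bochner integrals\<close>

text \<open>Completeness of Lebesgue measure. Slices and their pairings are identified only up to
  null sets, and measurability has to survive this.\<close>

lemma borel_measurable_lebesgue_on_AE:
  fixes f g :: "'a::euclidean_space \<Rightarrow> real"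
  assumes S: "S \<in> sets lebesgue" and f: "f \<in> borel_measurable (lebesgue_on S)"
    and eq: "AE x in lebesgue_on S. f x = g x"
  shows "g \<in> borel_measurable (lebesgue_on S)"
proof -
  have "(\<lambda>x. if x \<in> S then f x else 0) \<in> borel_measurable lebesgue"
    using f S by (simp add: borel_measurable_if)
  moreover have "AE x in lebesgue. (if x \<in> S then f x else 0) = (if x \<in> S then g x else 0)"
    using eq unfolding AE_lebesgue_on_iff[OF S] by eventually_elim auto
  ultimately have "(\<lambda>x. if x \<in> S then g x else 0) \<in> borel_measurable lebesgue"
    by (rule borel_measurable_AE)
  then show ?thesis using S by (simp add: borel_measurable_if)
qed

lemma borel_measurable_lebesgue_on_AE_lim:
  fixes f :: "nat \<Rightarrow> 'a::euclidean_space \<Rightarrow> real"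
  assumes S: "S \<in> sets lebesgue" and f: "\<And>n. f n \<in> borel_measurable (lebesgue_on S)"
    and lim: "AE x in lebesgue_on S. (\<lambda>n. f n x) \<longlonglongrightarrow> g x"
  shows "g \<in> borel_measurable (lebesgue_on S)"
proof (rule borel_measurable_lebesgue_on_AE[OF S])
  show "(\<lambda>x. lim (\<lambda>n. f n x)) \<in> borel_measurable (lebesgue_on S)" using f by measurable
  show "AE x in lebesgue_on S. lim (\<lambda>n. f n x) = g x" using lim by eventually_elim (rule limI)
qed

locale weight =
  fixes a :: "real \<Rightarrow> real"
  assumes cont: "continuous_on {0..1} a" and pos: "x \<in> {0<..<1} \<Longrightarrow> 0 < a x"
begin

lemma a_measurable: "a \<in> borel_measurable I01"
proof -
  have "continuous_on {0<..<1} a" by (rule continuous_on_subset[OF cont]) auto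
  then show ?thesis by (rule continuous_imp_measurable_on_sets_lebesgue) simp
qed

text \<open>Division by \<open>sqrt a\<close> is an isometry from the weighted space into
  \<open>L^2\<close> of the unit interval; facts about the weighted space are derived from
  unweighted ones through it.\<close>

definition wt :: "(real \<Rightarrow> real) \<Rightarrow> real \<Rightarrow> real" where
  "wt f x = f x / sqrt (a x)"

definition ip :: "(real \<Rightarrow> real) \<Rightarrow> (real \<Rightarrow> real) \<Rightarrow> real" where
  "ip f g = (LINT x|I01. f x * g x / a x)"

lemma wt_measurable: "f \<in> borel_measurable I01 \<Longrightarrow> wt f \<in> borel_measurable I01"
  unfolding wt_def[abs_def]
  by (intro borel_measurable_divide measurable_compose[OF a_measurable borel_measurable_sqrt])

lemma wt_mult: "x \<in> {0<..<1} \<Longrightarrow> wt f x * wt g x = f x * g x / a x"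
  using pos[of x] by (simp add: wt_def)

lemma ip_eq: "ip f g = (LINT x|I01. wt f x * wt g x)"
  unfolding ip_def by (rule Bochner_Integration.integral_cong) (auto simp: wt_mult)

lemma L2w_iff: "f \<in> L2w a \<longleftrightarrow> sqint I01 f \<and> sqint I01 (wt f)"
proof -
  have "integrable I01 (\<lambda>x. (wt f x)\<^sup>2) \<longleftrightarrow> integrable I01 (\<lambda>x. (f x)\<^sup>2 / a x)"
    by (rule Bochner_Integration.integrable_cong) (auto simp: wt_mult power2_eq_square)
  then show ?thesis
    using wt_measurable by (auto simp: L2w_def L2_iff_sqint sqint_def)
qed

lemma L2w_sqint: "f \<in> L2w a \<Longrightarrow> sqint I01 f" "f \<in> L2w a \<Longrightarrow> sqint I01 (wt f)"
  by (simp_all add: L2w_iff)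

lemma L2w_norm_eq: "L2w_norm a f = l2norm I01 (wt f)"
proof -
  have "(LINT x|I01. (f x)\<^sup>2 / a x) = (LINT x|I01. (wt f x)\<^sup>2)"
    by (rule Bochner_Integration.integral_cong) (auto simp: wt_mult power2_eq_square)
  then show ?thesis by (simp add: L2w_norm_def l2norm_def)
qed

lemma L2w_norm_nonneg: "0 \<le> L2w_norm a f"
  by (simp add: L2w_norm_eq)

lemma L2w_norm_power2: "(L2w_norm a f)\<^sup>2 = ip f f"
  by (simp only: L2w_norm_eq l2norm_power2 ip_eq) (simp only: power2_eq_square)

lemma wt_add: "wt (\<lambda>x. f x + g x) = (\<lambda>x. wt f x + wt g x)"
  and wt_diff: "wt (\<lambda>x. f x - g x) = (\<lambda>x. wt f x - wt g x)"
  and wt_cmult: "wt (\<lambda>x. c * f x) = (\<lambda>x. c * wt f x)"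
  by (simp_all add: wt_def fun_eq_iff add_divide_distrib diff_divide_distrib)

lemma L2w_add: "f \<in> L2w a \<Longrightarrow> g \<in> L2w a \<Longrightarrow> (\<lambda>x. f x + g x) \<in> L2w a"
  and L2w_diff: "f \<in> L2w a \<Longrightarrow> g \<in> L2w a \<Longrightarrow> (\<lambda>x. f x - g x) \<in> L2w a"
  and L2w_cmult: "f \<in> L2w a \<Longrightarrow> (\<lambda>x. c * f x) \<in> L2w a"
  by (simp_all add: L2w_iff wt_add wt_diff wt_cmult sqint_add sqint_diff sqint_cmult)

lemma L2w_zero: "(\<lambda>x. 0) \<in> L2w a"
  by (simp add: L2w_iff wt_def[abs_def] sqint_zero)

lemma ip_commute: "ip f g = ip g f"
  by (simp add: ip_def mult.commute)

lemma
  assumes "f \<in> L2w a" "g \<in> L2w a" "h \<in> L2w a"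
  shows ip_add_left: "ip (\<lambda>x. f x + g x) h = ip f h + ip g h"
    and ip_diff_left: "ip (\<lambda>x. f x - g x) h = ip f h - ip g h"
  using L2w_sqint(2)[OF assms(1)] L2w_sqint(2)[OF assms(2)] L2w_sqint(2)[OF assms(3)]
  by (simp_all add: ip_eq wt_add wt_diff distrib_right left_diff_distrib sqint_mult_integrable)

lemma ip_cmult_left: "ip (\<lambda>x. c * f x) h = c * ip f h"
  by (simp add: ip_eq wt_cmult mult.assoc)

lemma ip_Cauchy_Schwarz: "f \<in> L2w a \<Longrightarrow> g \<in> L2w a \<Longrightarrow> \<bar>ip f g\<bar> \<le> L2w_norm a f * L2w_norm a g"
  by (simp add: ip_eq L2w_norm_eq l2_Cauchy_Schwarz L2w_sqint)

section \<open>Bochner integrals tested against a fixed element\<close>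

lemma sum_in_L2w_ip:
  assumes "finite W" "W \<subseteq> L2w a" "v \<in> L2w a"
  shows "(\<lambda>x. \<Sum>w\<in>W. c w * w x) \<in> L2w a \<and> ip (\<lambda>x. \<Sum>w\<in>W. c w * w x) v = (\<Sum>w\<in>W. c w * ip w v)"
  using assms
proof (induction W rule: finite_induct)
  case empty
  show ?case by (simp add: L2w_zero ip_def)
next
  case (insert w W)
  then show ?case using L2w_cmult[of w "c w"]
    by (simp add: L2w_add ip_add_left ip_cmult_left)
qed

lemma simple_in_pairing:
  assumes S: "simple_in T (L2w a) S" and v: "v \<in> L2w a"
  shows "simple_integral T S \<in> L2w a"
    and "integrable (lebesgue_on {0<..<T}) (\<lambda>t. ip (S t) v)"
    and "(LINT t|lebesgue_on {0<..<T}. ip (S t) v) = ip (simple_integral T S) v"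
proof -
  let ?M = "lebesgue_on {0<..<T}"
  have sf: "simple_function ?M S" and sub: "S ` {0<..<T} \<subseteq> L2w a" using S by (auto simp: simple_in_def)
  have fin: "finite (S ` {0<..<T})" using simple_functionD(1)[OF sf] by simp
  define A where "A w = S -` {w} \<inter> {0<..<T}" for w
  have A: "A w \<in> sets ?M" for w using simple_functionD(2)[OF sf, of "{w}"] by (simp add: A_def)
  note si = sum_in_L2w_ip[OF fin sub v, of "\<lambda>w. measure lebesgue (S -` {w} \<inter> {0<..<T})"]
  have sieq: "simple_integral T S = (\<lambda>x. \<Sum>w\<in>S ` {0<..<T}. measure lebesgue (S -` {w} \<inter> {0<..<T}) * w x)"
    by (simp add: simple_integral_def fun_eq_iff)
  show "simple_integral T S \<in> L2w a" unfolding sieq using si by blast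
  have rep: "ip (S t) v = (\<Sum>w\<in>S ` {0<..<T}. indicator (A w) t * ip w v)" if t: "t \<in> {0<..<T}" for t
  proof -
    have "(\<Sum>w\<in>S ` {0<..<T}. indicator (A w) t * ip w v) = (\<Sum>w\<in>S ` {0<..<T}. if w = S t then ip w v else 0)"
      using t by (intro sum.cong) (auto simp: A_def indicator_def)
    then show ?thesis using fin t by simp
  qed
  have em: "emeasure ?M (A w) < \<infinity>" for w
  proof -
    have "emeasure ?M (A w) \<le> emeasure ?M (space ?M)" by (rule emeasure_space)
    also have "\<dots> < \<infinity>"
      using emeasure_bounded_finite[of "{0<..<T}"] by (simp add: emeasure_restrict_space)
    finally show ?thesis .
  qed
  have i: "integrable ?M (\<lambda>t. indicator (A w) t * ip w v)" for w
    using A[of w] em[of w] by simp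
  have "integrable ?M (\<lambda>t. \<Sum>w\<in>S ` {0<..<T}. indicator (A w) t * ip w v)" using i by simp
  moreover have "integrable ?M (\<lambda>t. ip (S t) v) \<longleftrightarrow> integrable ?M (\<lambda>t. \<Sum>w\<in>S ` {0<..<T}. indicator (A w) t * ip w v)"
    by (rule Bochner_Integration.integrable_cong) (auto simp: rep)
  ultimately show "integrable ?M (\<lambda>t. ip (S t) v)" by simp
  have "(LINT t|?M. ip (S t) v) = (LINT t|?M. (\<Sum>w\<in>S ` {0<..<T}. indicator (A w) t * ip w v))"
    by (rule Bochner_Integration.integral_cong) (auto simp: rep)
  also have "\<dots> = (\<Sum>w\<in>S ` {0<..<T}. measure ?M (A w) * ip w v)"
  proof (subst Bochner_Integration.integral_sum[OF i])
    have "A w \<inter> {0<..<T} = A w" for w by (auto simp: A_def)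
    then show "(\<Sum>w\<in>S ` {0<..<T}. LINT t|?M. indicator (A w) t * ip w v)
        = (\<Sum>w\<in>S ` {0<..<T}. measure ?M (A w) * ip w v)" by simp
  qed
  also have "\<dots> = ip (simple_integral T S) v"
    unfolding sieq using si by (simp add: A_def measure_restrict_space)
  finally show "(LINT t|?M. ip (S t) v) = ip (simple_integral T S) v" .
qed

lemma strongly_measurable_pairing:
  assumes U: "strongly_measurable_in T (L2w a) (L2w_norm a) U" and v: "v \<in> L2w a"
  shows "(\<lambda>t. ip (U t) v) \<in> borel_measurable (lebesgue_on {0<..<T})"
proof -
  obtain S where S: "\<And>n::nat. simple_in T (L2w a) (S n)"
    "AE t in lebesgue_on {0<..<T}. (\<lambda>n. L2w_norm a (\<lambda>x. S n t x - U t x)) \<longlonglongrightarrow> 0"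
    and UX: "AE t in lebesgue_on {0<..<T}. U t \<in> L2w a"
    using U unfolding strongly_measurable_in_def by blast
  show ?thesis
  proof (rule borel_measurable_lebesgue_on_AE_lim)
    show "(\<lambda>t. ip (S n t) v) \<in> borel_measurable (lebesgue_on {0<..<T})" for n
      by (rule borel_measurable_integrable[OF simple_in_pairing(2)[OF S(1) v]])
    have "AE t in lebesgue_on {0<..<T}. t \<in> {0<..<T}" by (rule AE_I2) simp
    with S(2) UX show "AE t in lebesgue_on {0<..<T}. (\<lambda>n. ip (S n t) v) \<longlonglongrightarrow> ip (U t) v"
    proof eventually_elim
      case (elim t)
      have St: "S n t \<in> L2w a" for n using S(1)[of n] elim(3) by (auto simp: simple_in_def)
      have "(\<lambda>n. ip (S n t) v - ip (U t) v) \<longlonglongrightarrow> 0"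
      proof (rule Lim_null_comparison)
        show "(\<lambda>n. L2w_norm a (\<lambda>x. S n t x - U t x) * L2w_norm a v) \<longlonglongrightarrow> 0"
          by (rule tendsto_mult_left_zero[OF elim(1)])
        show "\<forall>\<^sub>F n in sequentially. norm (ip (S n t) v - ip (U t) v) \<le> L2w_norm a (\<lambda>x. S n t x - U t x) * L2w_norm a v"
          using ip_Cauchy_Schwarz[OF L2w_diff[OF St elim(2)] v] ip_diff_left[OF St elim(2) v] by simp
      qed
      then show ?case by (simp add: LIM_zero_iff)
    qed
  qed simp
qed

text \<open>Pairing with \<open>v\<close> is a bounded linear functional by Cauchy-Schwarz. So both
  convergences in the definition, of the simple functions in mean and of their integrals, pass to
  scalar functions and identify the two limits.\<close>

lemma has_bochner_integral_pairing:
  assumes U: "has_bochner_integral_in T (L2w a) (L2w_norm a) U z" and v: "v \<in> L2w a"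
  shows "integrable (lebesgue_on {0<..<T}) (\<lambda>t. ip (U t) v)"
    and "(LINT t|lebesgue_on {0<..<T}. ip (U t) v) = ip z v"
proof -
  let ?M = "lebesgue_on {0<..<T}"
  obtain S where S: "\<And>n::nat. simple_in T (L2w a) (S n)"
    "(\<lambda>n. \<integral>\<^sup>+ t. ennreal (L2w_norm a (\<lambda>x. S n t x - U t x)) \<partial>?M) \<longlonglongrightarrow> 0"
    "(\<lambda>n. L2w_norm a (\<lambda>x. simple_integral T (S n) x - z x)) \<longlonglongrightarrow> 0"
    and z: "z \<in> L2w a" and sm: "strongly_measurable_in T (L2w a) (L2w_norm a) U"
    using U unfolding has_bochner_integral_in_def by blast
  have UX: "AE t in ?M. U t \<in> L2w a" using sm by (simp add: strongly_measurable_in_def)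
  have mU: "(\<lambda>t. ip (U t) v) \<in> borel_measurable ?M" by (rule strongly_measurable_pairing[OF sm v])
  note iS = simple_in_pairing(2)[OF S(1) v]
  define c where "c = L2w_norm a v + 1"
  have c: "c > 0" by (simp add: c_def L2w_norm_nonneg add_nonneg_pos)
  have bnd: "(\<integral>\<^sup>+ t. ennreal (\<bar>ip (S n t) v - ip (U t) v\<bar> / c) \<partial>?M)
      \<le> (\<integral>\<^sup>+ t. ennreal (L2w_norm a (\<lambda>x. S n t x - U t x)) \<partial>?M)" for n
  proof (rule nn_integral_mono_AE)
    have "AE t in ?M. t \<in> {0<..<T}" by (rule AE_I2) simp
    with UX show "AE t in ?M. ennreal (\<bar>ip (S n t) v - ip (U t) v\<bar> / c) \<le> ennreal (L2w_norm a (\<lambda>x. S n t x - U t x))"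
    proof eventually_elim
      case (elim t)
      have St: "S n t \<in> L2w a" using S(1)[of n] elim(2) by (auto simp: simple_in_def)
      have "\<bar>ip (S n t) v - ip (U t) v\<bar> \<le> L2w_norm a (\<lambda>x. S n t x - U t x) * L2w_norm a v"
        using ip_Cauchy_Schwarz[OF L2w_diff[OF St elim(1)] v] ip_diff_left[OF St elim(1) v] by simp
      also have "\<dots> \<le> L2w_norm a (\<lambda>x. S n t x - U t x) * c"
        by (intro mult_left_mono L2w_norm_nonneg) (simp add: c_def)
      finally show ?case using c by (intro ennreal_leI) (simp add: divide_le_eq)
    qed
  qed
  \<comment> \<open>A single simple function at finite distance from \<open>U\<close> suffices to
    make the pairing with \<open>U\<close> integrable.\<close>
  obtain n0 where n0: "(\<integral>\<^sup>+ t. ennreal (L2w_norm a (\<lambda>x. S n0 t x - U t x)) \<partial>?M) < 1"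
    using order_tendstoD(2)[OF S(2), of 1] by (auto simp: eventually_sequentially)
  have idiff: "integrable ?M (\<lambda>t. \<bar>ip (S n t) v - ip (U t) v\<bar> / c)"
    if "(\<integral>\<^sup>+ t. ennreal (L2w_norm a (\<lambda>x. S n t x - U t x)) \<partial>?M) < \<infinity>" for n
    using le_less_trans[OF bnd that] c mU borel_measurable_integrable[OF iS[of n]]
    by (intro integrableI_nonneg) auto
  have "integrable ?M (\<lambda>t. \<bar>ip (S n0 t) v - ip (U t) v\<bar> / c)"
    by (rule idiff) (use n0 in \<open>auto intro: less_trans\<close>)
  then have "integrable ?M (\<lambda>t. c * (\<bar>ip (S n0 t) v - ip (U t) v\<bar> / c))" by (rule integrable_mult_right)
  then have "integrable ?M (\<lambda>t. \<bar>ip (S n0 t) v - ip (U t) v\<bar>)" using c by simp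
  then have "integrable ?M (\<lambda>t. ip (S n0 t) v - ip (U t) v)"
    using mU borel_measurable_integrable[OF iS] by (subst (asm) integrable_abs_iff) auto
  from Bochner_Integration.integrable_diff[OF iS[of n0] this]
  show iU: "integrable ?M (\<lambda>t. ip (U t) v)" by simp
  have "(\<lambda>n. ip (simple_integral T (S n)) v) \<longlonglongrightarrow> (LINT t|?M. ip (U t) v)"
  proof -
    have nn: "(\<integral>\<^sup>+ t. ennreal (\<bar>ip (S n t) v - ip (U t) v\<bar> / c) \<partial>?M) = ennreal ((LINT t|?M. \<bar>ip (S n t) v - ip (U t) v\<bar>) / c)" for n
      using iS[of n] iU c by (subst nn_integral_eq_integral) auto
    have "(\<lambda>n. ennreal ((LINT t|?M. \<bar>ip (S n t) v - ip (U t) v\<bar>) / c)) \<longlonglongrightarrow> 0"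
      by (rule tendsto_sandwich[OF _ _ tendsto_const S(2)]) (use bnd nn in auto)
    then have "(\<lambda>n. (LINT t|?M. \<bar>ip (S n t) v - ip (U t) v\<bar>) / c) \<longlonglongrightarrow> 0"
      using c by (subst (asm) ennreal_0[symmetric], subst (asm) tendsto_ennreal_iff) (auto intro!: divide_nonneg_pos)
    from tendsto_mult_right_zero[OF this, of c]
    have l: "(\<lambda>n. LINT t|?M. \<bar>ip (S n t) v - ip (U t) v\<bar>) \<longlonglongrightarrow> 0" using c by simp
    have "(\<lambda>n. ip (simple_integral T (S n)) v - (LINT t|?M. ip (U t) v)) \<longlonglongrightarrow> 0"
    proof (rule Lim_null_comparison[OF always_eventually l], rule allI)
      fix n
      have "ip (simple_integral T (S n)) v - (LINT t|?M. ip (U t) v) = (LINT t|?M. ip (S n t) v - ip (U t) v)"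
        using simple_in_pairing(3)[OF S(1) v, of n] iS[of n] iU by simp
      then show "norm (ip (simple_integral T (S n)) v - (LINT t|?M. ip (U t) v)) \<le> (LINT t|?M. \<bar>ip (S n t) v - ip (U t) v\<bar>)"
        using integral_abs_bound[of ?M "\<lambda>t. ip (S n t) v - ip (U t) v"] by simp
    qed
    then show ?thesis by (simp add: LIM_zero_iff)
  qed
  moreover have "(\<lambda>n. ip (simple_integral T (S n)) v) \<longlonglongrightarrow> ip z v"
  proof -
    note si = simple_in_pairing(1)[OF S(1) v]
    have "(\<lambda>n. ip (simple_integral T (S n)) v - ip z v) \<longlonglongrightarrow> 0"
    proof (rule Lim_null_comparison)
      show "(\<lambda>n. L2w_norm a (\<lambda>x. simple_integral T (S n) x - z x) * L2w_norm a v) \<longlonglongrightarrow> 0"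
        by (rule tendsto_mult_left_zero[OF S(3)])
      show "\<forall>\<^sub>F n in sequentially. norm (ip (simple_integral T (S n)) v - ip z v)
          \<le> L2w_norm a (\<lambda>x. simple_integral T (S n) x - z x) * L2w_norm a v"
        using ip_Cauchy_Schwarz[OF L2w_diff[OF si z] v] ip_diff_left[OF si z v] by simp
    qed
    then show ?thesis by (simp add: LIM_zero_iff)
  qed
  ultimately show "(LINT t|?M. ip (U t) v) = ip z v" by (rule LIMSEQ_unique)
qed

end

section \<open>Null sets and iterated integrals on the cylinder\<close>

lemma AE_lborel_prod:
  fixes P :: "real \<times> real \<Rightarrow> bool"
  assumes "AE z in lborel. P z"
  shows "AE t in lborel. AE x in lborel. P (x, t)"
proof -
  obtain N where N: "{z \<in> space lborel. \<not> P z} \<subseteq> N" "emeasure lborel N = 0" "N \<in> sets lborel"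
    by (rule AE_E[OF assms])
  have [measurable]: "N \<in> sets borel" using N(3) by simp
  have "(\<integral>\<^sup>+t. \<integral>\<^sup>+x. indicator N (x, t) \<partial>lborel \<partial>lborel) = (\<integral>\<^sup>+z. indicator N z \<partial>lborel)"
    by (rule nn_integral_lborel_prod) simp
  also have "\<dots> = 0" using N by simp
  finally have z: "(\<integral>\<^sup>+t. \<integral>\<^sup>+x. indicator N (x, t) \<partial>lborel \<partial>lborel) = 0" .
  have m1: "(\<lambda>t. \<integral>\<^sup>+x. indicator N (x, t) \<partial>lborel) \<in> borel_measurable lborel" by measurable
  have m2: "(\<lambda>x. indicator N (x, t) :: ennreal) \<in> borel_measurable lborel" for t by measurable
  have "AE t in lborel. (\<integral>\<^sup>+x. indicator N (x, t) \<partial>lborel) = 0"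
    using z nn_integral_0_iff_AE[OF m1] by blast
  then show ?thesis
  proof (rule eventually_mono)
    fix t assume "(\<integral>\<^sup>+x. indicator N (x, t) \<partial>lborel) = 0"
    then have "AE x in lborel. indicator N (x, t) = (0 :: ennreal)"
      using nn_integral_0_iff_AE[OF m2] by blast
    then show "AE x in lborel. P (x, t)"
    proof (rule eventually_mono)
      fix x assume "indicator N (x, t) = (0 :: ennreal)"
      then have "(x, t) \<notin> N" by (auto simp: indicator_def)
      then show "P (x, t)" using N(1) by auto
    qed
  qed
qed

lemma sets_cyl: "{0<..<1} \<times> {0<..<T} \<in> sets (lebesgue :: (real \<times> real) measure)"
  by (intro sets_completionI_sets) (simp add: open_Times)

lemma AE_cyl:
  assumes "AE z in cyl T. P z"
  shows "AE t in lebesgue_on {0<..<T}. AE x in I01. P (x, t)"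
proof -
  have "AE z in lebesgue. z \<in> {0<..<1} \<times> {0<..<T} \<longrightarrow> P z"
    using assms unfolding AE_lebesgue_on_iff[OF sets_cyl] .
  then have "AE z in lborel. z \<in> {0<..<1} \<times> {0<..<T} \<longrightarrow> P z" by (simp add: AE_completion_iff)
  from AE_lborel_prod[OF this]
  have "AE t in lborel. AE x in lborel. (x, t) \<in> {0<..<1} \<times> {0<..<T} \<longrightarrow> P (x, t)" .
  then have "AE t in lborel. t \<in> {0<..<T} \<longrightarrow> (AE x in I01. P (x, t))"
  proof eventually_elim
    case (elim t)
    show ?case
    proof
      assume "t \<in> {0<..<T}"
      with elim have "AE x in lborel. x \<in> {0<..<1} \<longrightarrow> P (x, t)" by simp
      then show "AE x in I01. P (x, t)"
        unfolding AE_lebesgue_on_interval by (rule AE_completion)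
    qed
  qed
  then show ?thesis unfolding AE_lebesgue_on_interval by (rule AE_completion)
qed

text \<open>Lebesgue measure on the plane is a completion and not a product, and slices of a
  Lebesgue measurable function are measurable only for almost every time. Tonelli's theorem is
  therefore applied to a Borel representative, whose slices agree with the given ones for almost
  every time.\<close>

lemma nn_integral_cyl:
  fixes f :: "real \<Rightarrow> real \<Rightarrow> ennreal"
  assumes f: "(\<lambda>(x, t). f x t) \<in> borel_measurable (cyl T)"
  shows "(\<integral>\<^sup>+(x, t). f x t \<partial>cyl T) = (\<integral>\<^sup>+t. \<integral>\<^sup>+x. f x t \<partial>I01 \<partial>lebesgue_on {0<..<T})"
proof -
  define F where "F z = (\<lambda>(x, t). f x t) z * indicator ({0<..<1} \<times> {0<..<T}) z" for z
  have Fm: "F \<in> borel_measurable lebesgue"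
    using f sets_cyl[of T] unfolding F_def[abs_def]
    by (subst (asm) borel_measurable_restrict_space_iff_ennreal) auto
  obtain F' where F': "F' \<in> borel_measurable lborel" "AE z in lborel. F z = F' z"
    using completion_ex_borel_measurable[OF Fm] by blast
  have F'm [measurable]: "F' \<in> borel_measurable borel" using F'(1) by simp
  have "(\<integral>\<^sup>+(x, t). f x t \<partial>cyl T) = (\<integral>\<^sup>+z. F z \<partial>lebesgue)"
    unfolding F_def using sets_cyl[of T] by (subst nn_integral_restrict_space) auto
  also have "\<dots> = (\<integral>\<^sup>+z. F' z \<partial>lebesgue)" using F'(2) by (intro nn_integral_cong_AE AE_completion)
  also have "\<dots> = (\<integral>\<^sup>+z. F' z \<partial>lborel)" by (rule nn_integral_completion) 
  also have "\<dots> = (\<integral>\<^sup>+t. \<integral>\<^sup>+x. F' (x, t) \<partial>lborel \<partial>lborel)" by (rule nn_integral_lborel_prod[symmetric]) simp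
  also have "\<dots> = (\<integral>\<^sup>+t. \<integral>\<^sup>+x. F' (x, t) \<partial>lborel \<partial>lebesgue)" by (rule nn_integral_completion[symmetric]) 
  also have "\<dots> = (\<integral>\<^sup>+t. (\<integral>\<^sup>+x. f x t \<partial>I01) * indicator {0<..<T} t \<partial>lebesgue)"
  proof (rule nn_integral_cong_AE, rule AE_completion, use AE_lborel_prod[OF F'(2)] in eventually_elim)
    case (elim t)
    have "(\<integral>\<^sup>+x. F' (x, t) \<partial>lborel) = (\<integral>\<^sup>+x. F' (x, t) \<partial>lebesgue)" by (rule nn_integral_completion[symmetric]) 
    also have "\<dots> = (\<integral>\<^sup>+x. (f x t * indicator {0<..<T} t) * indicator {0<..<1} x \<partial>lebesgue)"
    proof (rule nn_integral_cong_AE, rule AE_completion, use elim in eventually_elim)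
      case (elim x)
      then show ?case by (auto simp: F_def indicator_def)
    qed
    also have "\<dots> = (\<integral>\<^sup>+x. f x t * indicator {0<..<T} t \<partial>I01)" by (subst nn_integral_restrict_space) auto
    also have "\<dots> = (\<integral>\<^sup>+x. f x t \<partial>I01) * indicator {0<..<T} t" by (auto simp: indicator_def)
    finally show ?case .
  qed
  also have "\<dots> = (\<integral>\<^sup>+t. \<integral>\<^sup>+x. f x t \<partial>I01 \<partial>lebesgue_on {0<..<T})" by (subst nn_integral_restrict_space) auto
  finally show ?thesis .
qed

lemma integral_lebesgue_on_eq:
  fixes f :: "real \<Rightarrow> real"
  shows "(LINT t|lebesgue_on {l<..<r}. f t) = (LINT t|lebesgue. indicator {l<..<r} t * f t)"
    and "integrable (lebesgue_on {l<..<r}) f \<longleftrightarrow> integrable lebesgue (\<lambda>t. indicator {l<..<r} t * f t)"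
  by (simp_all add: integral_restrict_space integrable_restrict_space)

section \<open>The fundamental theorem of calculus for pairings\<close>

context weight
begin

lemma sqint_pairing_bochner_L2:
  assumes V: "V \<in> bochner_L2 T (L2w a) (L2w_norm a)" and v: "v \<in> L2w a"
  shows "integrable (lebesgue_on {0<..<T}) (\<lambda>t. ip (V t) v)"
proof -
  let ?M = "lebesgue_on {0<..<T}"
  have sm: "strongly_measurable_in T (L2w a) (L2w_norm a) V"
    and fin: "(\<integral>\<^sup>+ t. ennreal ((L2w_norm a (V t))\<^sup>2) \<partial>?M) < \<infinity>"
    using V by (auto simp: bochner_L2_def)
  have VX: "AE t in ?M. V t \<in> L2w a" using sm by (simp add: strongly_measurable_in_def)
  have m: "(\<lambda>t. ip (V t) v) \<in> borel_measurable ?M" by (rule strongly_measurable_pairing[OF sm v])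
  define c where "c = L2w_norm a v + 1"
  have c: "c > 0" by (simp add: c_def L2w_norm_nonneg add_nonneg_pos)
  have "(\<integral>\<^sup>+ t. ennreal ((ip (V t) v / c)\<^sup>2) \<partial>?M) \<le> (\<integral>\<^sup>+ t. ennreal ((L2w_norm a (V t))\<^sup>2) \<partial>?M)"
  proof (rule nn_integral_mono_AE, use VX in eventually_elim)
    case (elim t)
    have "\<bar>ip (V t) v\<bar> \<le> L2w_norm a (V t) * L2w_norm a v" by (rule ip_Cauchy_Schwarz[OF elim v])
    also have "\<dots> \<le> L2w_norm a (V t) * c" by (intro mult_left_mono L2w_norm_nonneg) (simp add: c_def)
    finally have "\<bar>ip (V t) v / c\<bar> \<le> L2w_norm a (V t)" using c by (simp add: abs_divide divide_le_eq)
    then have "\<bar>ip (V t) v / c\<bar>\<^sup>2 \<le> (L2w_norm a (V t))\<^sup>2" by (rule power_mono) simp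
    then show ?case unfolding power2_abs by (rule ennreal_leI)
  qed
  then have "sqint ?M (\<lambda>t. ip (V t) v / c)"
    using m fin unfolding sqint_def by (intro conjI integrableI_nonneg) (auto intro: le_less_trans)
  moreover have "sqint ?M (\<lambda>t. c)"
  proof -
    have "finite_measure ?M"
      using emeasure_bounded_finite[of "{0<..<T}"] by (intro finite_measureI) (simp add: emeasure_restrict_space)
    then show ?thesis by (simp add: sqint_def finite_measure.integrable_const)
  qed
  ultimately have "integrable ?M (\<lambda>t. (ip (V t) v / c) * c)" by (rule sqint_mult_integrable)
  then show ?thesis using c by simp
qed

lemma bochner_H1_pairing_continuous:
  assumes H: "bochner_H1 T (L2w a) (L2w_norm a) U V" and v: "v \<in> L2w a"
  shows "continuous_on {0..T} (\<lambda>t. ip (U t) v)"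
  unfolding continuous_on_def
proof
  fix t assume t: "t \<in> {0..T}"
  have UX: "U s \<in> L2w a" if "s \<in> {0..T}" for s using H that by (simp add: bochner_H1_def)
  have lim: "((\<lambda>\<tau>. L2w_norm a (\<lambda>x. U \<tau> x - U t x)) \<longlongrightarrow> 0) (at t within {0..T})"
    using H t by (simp add: bochner_H1_def)
  have "((\<lambda>\<tau>. ip (U \<tau>) v - ip (U t) v) \<longlongrightarrow> 0) (at t within {0..T})"
  proof (rule Lim_null_comparison)
    show "((\<lambda>\<tau>. L2w_norm a (\<lambda>x. U \<tau> x - U t x) * L2w_norm a v) \<longlongrightarrow> 0) (at t within {0..T})"
      by (rule tendsto_mult_left_zero[OF lim])
    show "\<forall>\<^sub>F \<tau> in at t within {0..T}. norm (ip (U \<tau>) v - ip (U t) v) \<le> L2w_norm a (\<lambda>x. U \<tau> x - U t x) * L2w_norm a v"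
      unfolding eventually_at_filter
    proof (intro always_eventually allI impI)
      fix s assume "s \<in> {0..T}"
      then show "norm (ip (U s) v - ip (U t) v) \<le> L2w_norm a (\<lambda>x. U s x - U t x) * L2w_norm a v"
        using ip_Cauchy_Schwarz[OF L2w_diff[OF UX UX[OF t]] v, of s] ip_diff_left[OF UX UX[OF t] v, of s] by simp
    qed
  qed
  then show "((\<lambda>\<tau>. ip (U \<tau>) v) \<longlongrightarrow> ip (U t) v) (at t within {0..T})" by (simp add: LIM_zero_iff)
qed

text \<open>The weak time derivative is tested with approximations of the indicator of
  \<open>{t1<..t2}\<close>. The side with the differentiated test functions converges to the
  difference of the end values because the pairing is continuous in time.\<close>

lemma bochner_H1_FTC_interior:
  assumes H: "bochner_H1 T (L2w a) (L2w_norm a) U V" and v: "v \<in> L2w a"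
    and t12: "0 < t1" "t1 \<le> t2" "t2 < T"
  shows "ip (U t2) v - ip (U t1) v = (LINT t|lebesgue_on {t1<..<t2}. ip (V t) v)"
proof -
  let ?w = "\<lambda>t. ip (U t) v" and ?b = "\<lambda>t. ip (V t) v"
  have ib: "integrable lebesgue (\<lambda>t. indicator {0<..<T} t * ?b t)"
    using sqint_pairing_bochner_L2[OF _ v, of V T] H by (simp add: bochner_H1_def integral_lebesgue_on_eq)
  obtain \<psi> d' where d': "t2 \<le> d'" "d' < T" and \<psi>: "\<And>n::nat. test_fun 0 T (\<psi> n)" "\<And>n x. \<bar>\<psi> n x\<bar> \<le> indicator {t1..d'} x"
    "\<And>x. (\<lambda>n. \<psi> n x) \<longlonglongrightarrow> indicator {t1<..t2} x"
    "\<And>f. continuous_on {t1..d'} f \<Longrightarrow> (\<lambda>n. LINT x|lebesgue. deriv (\<psi> n) x * f x) \<longlonglongrightarrow> f t1 - f t2"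
    by (rule test_fun_approx_indicator[OF t12]) blast
  have dz: "deriv (\<psi> n) t = 0" if t: "t \<notin> {0<..<T}" for n t
  proof -
    obtain c d where "0 < c" "d < T" "\<And>x. x \<notin> {c..d} \<Longrightarrow> deriv (\<psi> n) x = 0"
      using test_fun_support[OF \<psi>(1)[of n]] by metis
    then show ?thesis using t by auto
  qed
  have wd: "(LINT t|lebesgue. deriv (\<psi> n) t * ?w t) = - (LINT t|lebesgue. \<psi> n t * (indicator {0<..<T} t * ?b t))" for n
  proof -
    obtain z where z: "has_bochner_integral_in T (L2w a) (L2w_norm a) (\<lambda>t x. deriv (\<psi> n) t * U t x) z"
      "has_bochner_integral_in T (L2w a) (L2w_norm a) (\<lambda>t x. \<psi> n t * V t x) (\<lambda>x. - z x)"
      using H \<psi>(1)[of n] unfolding bochner_H1_def weak_time_deriv_def by (elim conjE allE impE exE)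
    have "(LINT t|lebesgue. deriv (\<psi> n) t * ?w t) = (LINT t|lebesgue_on {0<..<T}. deriv (\<psi> n) t * ?w t)"
      unfolding integral_lebesgue_on_eq
    proof (rule Bochner_Integration.integral_cong[OF refl])
      fix t show "deriv (\<psi> n) t * ?w t = indicator {0<..<T} t * (deriv (\<psi> n) t * ?w t)"
        using dz[of t n] by (cases "t \<in> {0<..<T}") auto
    qed
    also have "\<dots> = ip z v" using has_bochner_integral_pairing(2)[OF z(1) v] by (simp add: ip_cmult_left)
    also have "\<dots> = - ip (\<lambda>x. - z x) v" using ip_cmult_left[of "-1" z v] by simp
    also have "ip (\<lambda>x. - z x) v = (LINT t|lebesgue_on {0<..<T}. \<psi> n t * ?b t)"
      using has_bochner_integral_pairing(2)[OF z(2) v] by (simp add: ip_cmult_left)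
    also have "\<dots> = (LINT t|lebesgue. \<psi> n t * (indicator {0<..<T} t * ?b t))"
      unfolding integral_lebesgue_on_eq by (rule Bochner_Integration.integral_cong) auto
    finally show ?thesis .
  qed
  have "(\<lambda>n. LINT t|lebesgue. deriv (\<psi> n) t * ?w t) \<longlonglongrightarrow> ?w t1 - ?w t2"
    by (rule \<psi>(4), rule continuous_on_subset[OF bochner_H1_pairing_continuous[OF H v]]) (use t12 d' in auto)
  moreover have "(\<lambda>n. - (LINT t|lebesgue. \<psi> n t * (indicator {0<..<T} t * ?b t)))
      \<longlonglongrightarrow> - (LINT t|lebesgue. indicator {t1<..t2} t * (indicator {0<..<T} t * ?b t))"
  proof (rule tendsto_minus, rule integral_dominated_convergence[where w = "\<lambda>t. \<bar>indicator {0<..<T} t * ?b t\<bar>"])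
    show "integrable lebesgue (\<lambda>t. \<bar>indicator {0<..<T} t * ?b t\<bar>)" using ib by (rule integrable_abs)
    show "(\<lambda>t. indicator {t1<..t2} t * (indicator {0<..<T} t * ?b t)) \<in> borel_measurable lebesgue"
      by (intro borel_measurable_times[OF _ borel_measurable_integrable[OF ib]] borel_measurable_indicator) simp
    show "(\<lambda>t. \<psi> n t * (indicator {0<..<T} t * ?b t)) \<in> borel_measurable lebesgue" for n
      using test_fun_measurable(1)[OF \<psi>(1)]
      by (intro borel_measurable_times[OF _ borel_measurable_integrable[OF ib]] measurable_completion) simp
    show "AE t in lebesgue. (\<lambda>n. \<psi> n t * (indicator {0<..<T} t * ?b t)) \<longlonglongrightarrow> indicator {t1<..t2} t * (indicator {0<..<T} t * ?b t)"
      by (intro AE_I2 tendsto_mult_right \<psi>)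
    show "AE t in lebesgue. norm (\<psi> n t * (indicator {0<..<T} t * ?b t)) \<le> \<bar>indicator {0<..<T} t * ?b t\<bar>" for n
    proof (rule AE_I2)
      fix t
      have "\<bar>\<psi> n t\<bar> * \<bar>indicator {0<..<T} t * ?b t\<bar> \<le> 1 * \<bar>indicator {0<..<T} t * ?b t\<bar>"
        by (intro mult_right_mono order_trans[OF \<psi>(2)[of n t] indicator_le_1]) simp
      then show "norm (\<psi> n t * (indicator {0<..<T} t * ?b t)) \<le> \<bar>indicator {0<..<T} t * ?b t\<bar>"
        by (simp only: real_norm_def abs_mult mult_1)
    qed
  qed
  ultimately have "?w t1 - ?w t2 = - (LINT t|lebesgue. indicator {t1<..t2} t * (indicator {0<..<T} t * ?b t))"
    unfolding wd by (rule LIMSEQ_unique)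
  then have "?w t2 - ?w t1 = (LINT t|lebesgue. indicator {t1<..t2} t * (indicator {0<..<T} t * ?b t))"
    by linarith
  also have "\<dots> = (LINT t|lebesgue. indicator {t1<..<t2} t * (indicator {0<..<T} t * ?b t))"
  proof (rule integral_cong_AE)
    have "AE t in lebesgue. t \<noteq> t2" by (rule AE_completion[OF AE_lborel_singleton])
    then show "AE t in lebesgue. indicator {t1<..t2} t * (indicator {0<..<T} t * ?b t)
        = indicator {t1<..<t2} t * (indicator {0<..<T} t * ?b t)"
      by eventually_elim (auto simp: indicator_def)
    show "(\<lambda>t. indicator {t1<..t2} t * (indicator {0<..<T} t * ?b t)) \<in> borel_measurable lebesgue"
      by (intro borel_measurable_times[OF _ borel_measurable_integrable[OF ib]] borel_measurable_indicator) simp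
    show "(\<lambda>t. indicator {t1<..<t2} t * (indicator {0<..<T} t * ?b t)) \<in> borel_measurable lebesgue"
      by (intro borel_measurable_times[OF _ borel_measurable_integrable[OF ib]] borel_measurable_indicator) simp
  qed
  also have "\<dots> = (LINT t|lebesgue_on {t1<..<t2}. ?b t)"
    unfolding integral_lebesgue_on_eq using t12
    by (intro Bochner_Integration.integral_cong) (auto simp: indicator_def)
  finally show ?thesis .
qed

text \<open>Test functions vanish near \<open>T\<close>, so the final time is reached only as a
  limit: by continuity on the left-hand side, by dominated convergence on the right-hand
  side.\<close>

lemma bochner_H1_FTC:
  assumes H: "bochner_H1 T (L2w a) (L2w_norm a) U V" and v: "v \<in> L2w a"
    and t12: "0 < t1" "t1 \<le> t2" "t2 \<le> T"
  shows "ip (U t2) v - ip (U t1) v = (LINT t|lebesgue_on {t1<..<t2}. ip (V t) v)"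
proof (cases "t2 < T \<or> t1 = t2")
  case True
  then show ?thesis
    using bochner_H1_FTC_interior[OF H v, of t1 t2] t12 by (auto simp: integral_lebesgue_on_eq)
next
  case False
  then have t2: "t2 = T" "t1 < T" using t12 by auto
  let ?b = "\<lambda>t. ip (V t) v"
  have ib: "integrable lebesgue (\<lambda>t. indicator {0<..<T} t * ?b t)"
    using sqint_pairing_bochner_L2[OF _ v, of V T] H by (simp add: bochner_H1_def integral_lebesgue_on_eq)
  define s where "s n = T - (T - t1) / (real n + 2)" for n
  have s: "t1 \<le> s n" "s n < T" for n
  proof -
    have "(T - t1) / (real n + 2) \<le> (T - t1) / 1" by (rule divide_left_mono) (use t2 in auto)
    moreover have "0 < (T - t1) / (real n + 2)" using t2 by simp
    ultimately show "t1 \<le> s n" "s n < T" unfolding s_def by simp_all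
  qed
  have slim: "s \<longlonglongrightarrow> T" unfolding s_def[abs_def] by real_asymp
  have "(\<lambda>n. ip (U (s n)) v) \<longlonglongrightarrow> ip (U T) v"
  proof (rule continuous_on_tendsto_compose[OF bochner_H1_pairing_continuous[OF H v] slim])
    show "T \<in> {0..T}" using t12 by simp
    have "s n \<in> {0..T}" for n using s[of n] t12 by simp
    then show "\<forall>\<^sub>F n in sequentially. s n \<in> {0..T}" by simp
  qed
  then have "(\<lambda>n. ip (U (s n)) v - ip (U t1) v) \<longlonglongrightarrow> ip (U T) v - ip (U t1) v" by (intro tendsto_intros)
  moreover have "(\<lambda>n. ip (U (s n)) v - ip (U t1) v) \<longlonglongrightarrow> (LINT t|lebesgue. indicator {t1<..<T} t * (indicator {0<..<T} t * ?b t))"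
  proof -
    have eq: "ip (U (s n)) v - ip (U t1) v = (LINT t|lebesgue. indicator {t1<..<s n} t * (indicator {0<..<T} t * ?b t))" for n
      unfolding bochner_H1_FTC_interior[OF H v t12(1) s(1) s(2), of n] integral_lebesgue_on_eq
      using t12 s[of n] by (intro Bochner_Integration.integral_cong) (auto simp: indicator_def)
    show ?thesis unfolding eq
    proof (rule integral_dominated_convergence[where w = "\<lambda>t. \<bar>indicator {0<..<T} t * ?b t\<bar>"])
      show "integrable lebesgue (\<lambda>t. \<bar>indicator {0<..<T} t * ?b t\<bar>)" using ib by (rule integrable_abs)
      show "(\<lambda>t. indicator {t1<..<T} t * (indicator {0<..<T} t * ?b t)) \<in> borel_measurable lebesgue"
        by (intro borel_measurable_times[OF _ borel_measurable_integrable[OF ib]] borel_measurable_indicator) simp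
      show "(\<lambda>t. indicator {t1<..<s n} t * (indicator {0<..<T} t * ?b t)) \<in> borel_measurable lebesgue" for n
        by (intro borel_measurable_times[OF _ borel_measurable_integrable[OF ib]] borel_measurable_indicator) simp
      show "AE t in lebesgue. (\<lambda>n. indicator {t1<..<s n} t * (indicator {0<..<T} t * ?b t))
          \<longlonglongrightarrow> indicator {t1<..<T} t * (indicator {0<..<T} t * ?b t)"
      proof (rule AE_I2)
        fix t
        show "(\<lambda>n. indicator {t1<..<s n} t * (indicator {0<..<T} t * ?b t))
          \<longlonglongrightarrow> indicator {t1<..<T} t * (indicator {0<..<T} t * ?b t)"
        proof (cases "t < T")
          case True
          have "\<forall>\<^sub>F n in sequentially. t < s n" using slim True by (rule order_tendstoD)
          then have "\<forall>\<^sub>F n in sequentially. indicator {t1<..<s n} t * (indicator {0<..<T} t * ?b t)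
              = indicator {t1<..<T} t * (indicator {0<..<T} t * ?b t)"
            by eventually_elim (use True in \<open>auto simp: indicator_def\<close>)
          then show ?thesis by (rule tendsto_eventually)
        qed (simp add: indicator_def)
      qed
      show "AE t in lebesgue. norm (indicator {t1<..<s n} t * (indicator {0<..<T} t * ?b t)) \<le> \<bar>indicator {0<..<T} t * ?b t\<bar>" for n
        by (intro AE_I2) (auto simp: indicator_def)
    qed
  qed
  ultimately have "ip (U T) v - ip (U t1) v = (LINT t|lebesgue. indicator {t1<..<T} t * (indicator {0<..<T} t * ?b t))"
    by (rule LIMSEQ_unique)
  also have "\<dots> = (LINT t|lebesgue_on {t1<..<T}. ?b t)"
    unfolding integral_lebesgue_on_eq using t12
    by (intro Bochner_Integration.integral_cong) (auto simp: indicator_def)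
  finally show ?thesis by (simp add: t2)
qed

end

section \<open>Borel representatives on the cylinder\<close>

text \<open>Being Borel measurable and zero off the cylinder, the representative is defined on the
  whole plane, where Fubini's theorem and translations in time apply directly.\<close>

lemma exists_Borel_representative:
  fixes v :: "real \<Rightarrow> real \<Rightarrow> real"
  assumes v: "(\<lambda>(x, t). v x t) \<in> borel_measurable (cyl T)"
  obtains v' where "v' \<in> borel_measurable borel" "\<And>z. z \<notin> {0<..<1} \<times> {0<..<T} \<Longrightarrow> v' z = 0"
    "AE t in lebesgue_on {0<..<T}. AE x in I01. v' (x, t) = v x t"
proof -
  let ?S = "{0<..<1} \<times> {0<..<T}"
  have Fm: "(\<lambda>z. if z \<in> ?S then (\<lambda>(x, t). v x t) z else 0) \<in> borel_measurable lebesgue"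
    using v sets_cyl[of T] by (simp add: borel_measurable_if)
  obtain F where F: "F \<in> borel_measurable lborel" "AE z in lborel. (if z \<in> ?S then (\<lambda>(x, t). v x t) z else 0) = F z"
    using completion_ex_borel_measurable_real[OF Fm] by blast
  define v' where "v' z = indicator ?S z * F z" for z
  have "?S \<in> sets (borel :: (real \<times> real) measure)" by (simp add: open_Times)
  then have m: "v' \<in> borel_measurable borel" using F(1) unfolding v'_def[abs_def] by simp
  have "AE z in lborel. z \<in> ?S \<longrightarrow> v' z = (\<lambda>(x, t). v x t) z"
    using F(2) by eventually_elim (auto simp: v'_def)
  then have "AE z in lebesgue. z \<in> ?S \<longrightarrow> v' z = (\<lambda>(x, t). v x t) z" by (rule AE_completion)
  then have "AE z in cyl T. v' z = (\<lambda>(x, t). v x t) z" unfolding AE_lebesgue_on_iff[OF sets_cyl] .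
  from AE_cyl[OF this] have ae: "AE t in lebesgue_on {0<..<T}. AE x in I01. v' (x, t) = v x t" by simp
  show thesis by (rule that[OF m _ ae]) (auto simp: v'_def)
qed

lemma slice_measurable:
  fixes v' :: "real \<times> real \<Rightarrow> real"
  assumes [measurable]: "v' \<in> borel_measurable borel"
  shows "(\<lambda>x. v' (x, t)) \<in> borel_measurable borel"
  by measurable

lemma integral_slice:
  fixes h :: "real \<Rightarrow> real"
  assumes h: "h \<in> borel_measurable borel" and z: "\<And>x. x \<notin> {0<..<1} \<Longrightarrow> h x = 0"
    and eq: "AE x in I01. h x = k x"
  shows "(LINT x|lborel. h x) = (LINT x|I01. k x)" and "k \<in> borel_measurable I01"
proof -
  have hm: "h \<in> borel_measurable I01" by (rule borel_measurable_lebesgue_onI[OF h])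
  show km: "k \<in> borel_measurable I01" by (rule borel_measurable_lebesgue_on_AE[OF _ hm eq]) simp
  have "(\<lambda>x. indicator {0<..<1} x * h x) = h" using z by (auto simp: indicator_def fun_eq_iff)
  then have "(LINT x|lborel. h x) = (LINT x|I01. h x)" by (simp add: integral_I01_borel[OF h])
  also have "\<dots> = (LINT x|I01. k x)" by (rule integral_cong_AE[OF hm km eq])
  finally show "(LINT x|lborel. h x) = (LINT x|I01. k x)" .
qed

lemma nn_integral_slice:
  fixes h :: "real \<Rightarrow> real"
  assumes h: "h \<in> borel_measurable borel" and z: "\<And>x. x \<notin> {0<..<1} \<Longrightarrow> h x = 0"
  shows "(\<integral>\<^sup>+x. ennreal (h x) \<partial>lborel) = (\<integral>\<^sup>+x. ennreal (h x) \<partial>I01)"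
proof -
  have "(\<integral>\<^sup>+x. ennreal (h x) \<partial>lborel) = (\<integral>\<^sup>+x. ennreal (h x) \<partial>lebesgue)" by (rule nn_integral_completion[symmetric])
  also have "\<dots> = (\<integral>\<^sup>+x. ennreal (h x) * indicator {0<..<1} x \<partial>lebesgue)"
    using z by (intro nn_integral_cong) (auto simp: indicator_def)
  also have "\<dots> = (\<integral>\<^sup>+x. ennreal (h x) \<partial>I01)" by (subst nn_integral_restrict_space) auto
  finally show ?thesis .
qed

lemma sqint_Borel_representative:
  fixes v :: "real \<Rightarrow> real \<Rightarrow> real"
  assumes v': "v' \<in> borel_measurable borel" "\<And>z. z \<notin> {0<..<1} \<times> {0<..<T} \<Longrightarrow> v' z = 0"
    "AE t in lebesgue_on {0<..<T}. AE x in I01. v' (x, t) = v x t"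
    and bnd: "AE t in lebesgue_on {0<..<T}. sqint I01 (\<lambda>x. v x t) \<and> (LINT x|I01. (v x t)\<^sup>2) \<le> M t"
    and M: "(\<integral>\<^sup>+t. ennreal (M t) \<partial>lebesgue_on {0<..<T}) < \<infinity>"
  shows "sqint lborel v'"
proof -
  have [measurable]: "v' \<in> borel_measurable borel" by (fact v'(1))
  have sm: "(\<lambda>x. (v' (x, t))\<^sup>2) \<in> borel_measurable borel" for t by measurable
  have "(\<integral>\<^sup>+z. ennreal ((v' z)\<^sup>2) \<partial>lborel) = (\<integral>\<^sup>+t. \<integral>\<^sup>+x. ennreal ((v' (x, t))\<^sup>2) \<partial>lborel \<partial>lborel)"
    by (rule nn_integral_lborel_prod[symmetric]) measurable
  also have "\<dots> = (\<integral>\<^sup>+t. \<integral>\<^sup>+x. ennreal ((v' (x, t))\<^sup>2) \<partial>lborel \<partial>lebesgue)" by (rule nn_integral_completion[symmetric])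
  also have "\<dots> = (\<integral>\<^sup>+t. (\<integral>\<^sup>+x. ennreal ((v' (x, t))\<^sup>2) \<partial>lborel) * indicator {0<..<T} t \<partial>lebesgue)"
    using v'(2) by (intro nn_integral_cong) (auto simp: indicator_def)
  also have "\<dots> = (\<integral>\<^sup>+t. \<integral>\<^sup>+x. ennreal ((v' (x, t))\<^sup>2) \<partial>lborel \<partial>lebesgue_on {0<..<T})"
    by (subst nn_integral_restrict_space) auto
  also have "\<dots> \<le> (\<integral>\<^sup>+t. ennreal (M t) \<partial>lebesgue_on {0<..<T})"
  proof (rule nn_integral_mono_AE, use v'(3) bnd in eventually_elim)
    case (elim t)
    have "(\<integral>\<^sup>+x. ennreal ((v' (x, t))\<^sup>2) \<partial>lborel) = (\<integral>\<^sup>+x. ennreal ((v' (x, t))\<^sup>2) \<partial>I01)"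
      by (rule nn_integral_slice[OF sm]) (use v'(2) in auto)
    also have "\<dots> = (\<integral>\<^sup>+x. ennreal ((v x t)\<^sup>2) \<partial>I01)"
      by (rule nn_integral_cong_AE) (use elim(1) in eventually_elim, simp)
    also have "\<dots> = ennreal (LINT x|I01. (v x t)\<^sup>2)"
      using elim(2) by (intro nn_integral_eq_integral) (auto simp: sqint_def)
    also have "\<dots> \<le> ennreal (M t)" using elim(2) by (intro ennreal_leI) simp
    finally show ?case .
  qed
  finally have "(\<integral>\<^sup>+z. ennreal ((v' z)\<^sup>2) \<partial>lborel) < \<infinity>" using M by (rule le_less_trans)
  then show ?thesis unfolding sqint_def by (intro conjI integrableI_nonneg) auto
qed

lemma AE_lborel_translate:
  fixes h :: real
  assumes "AE t in lborel. P t"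
  shows "AE t in lborel. P (h + t)"
proof -
  have "AE t in distr lborel borel (\<lambda>t. h + t). P t" unfolding lborel_distr_translate by (fact assms)
  then show ?thesis by (rule AE_distrD[rotated]) simp
qed

lemma AE_lebesgue_on_lborel:
  fixes l r :: real
  shows "(AE t in lebesgue_on {l<..<r}. P t) \<longleftrightarrow> (AE t in lborel. t \<in> {l<..<r} \<longrightarrow> P t)"
  unfolding AE_lebesgue_on_interval by (rule AE_completion_iff)

section \<open>Transfer of the energy inequality to functions with values in the weighted
  space\<close>

context weight
begin

lemma integral_slices_eq_ip:
  fixes V' G' :: "real \<times> real \<Rightarrow> real"
  assumes V': "V' \<in> borel_measurable borel" "\<And>x. x \<notin> {0<..<1} \<Longrightarrow> V' (x, s) = 0"
    and G': "G' \<in> borel_measurable borel"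
    and eq: "AE x in I01. V' (x, s) = wt f x" "AE x in I01. G' (x, t) = wt g x"
  shows "(LINT x|lborel. V' (x, s) * G' (x, t)) = ip f g"
  unfolding ip_eq
proof (rule integral_slice(1))
  show "(\<lambda>x. V' (x, s) * G' (x, t)) \<in> borel_measurable borel"
    by (rule borel_measurable_times[OF slice_measurable[OF V'(1)] slice_measurable[OF G']])
  show "V' (x, s) * G' (x, t) = 0" if "x \<notin> {0<..<1}" for x using V'(2)[OF that] by simp
  show "AE x in I01. V' (x, s) * G' (x, t) = wt f x * wt g x" using eq by eventually_elim simp
qed

text \<open>Here \<open>B t\<close> is the gradient of half the energy at \<open>U t\<close>, and
  \<open>conv\<close> is convexity. The fundamental theorem turns the integral of the pairing of
  \<open>V\<close> with the fixed element \<open>B t\<close> into a difference of values of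
  \<open>U\<close>, which is what \<open>conv\<close> estimates. The predicate \<open>P\<close>
  marks the good times, which have full measure; the final time has an assumption of its
  own.\<close>

lemma energy_balance:
  assumes T: "0 < T" and H: "bochner_H1 T (L2w a) (L2w_norm a) U V"
    and V': "sqint lborel V'" "\<And>z. z \<notin> {0<..<1} \<times> {0<..<T} \<Longrightarrow> V' z = 0"
      "AE t in lebesgue_on {0<..<T}. AE x in I01. V' (x, t) = wt (V t) x"
    and G': "sqint lborel G'" "AE t in lebesgue_on {0<..<T}. AE x in I01. G' (x, t) = wt (B t) x"
    and J: "integrable (lebesgue_on {0<..<T}) J" "\<And>t. 0 \<le> J t" "0 \<le> JT"
    and P: "AE t in lebesgue_on {0<..<T}. P t" "\<And>t. P t \<Longrightarrow> B t \<in> L2w a"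
    and conv: "\<And>s t. P s \<Longrightarrow> P t \<Longrightarrow> 0 < t \<Longrightarrow> t < s \<Longrightarrow> s < T \<Longrightarrow> 2 * (ip (U s) (B t) - ip (U t) (B t)) \<le> J s - J t"
      "\<And>t. P t \<Longrightarrow> 0 < t \<Longrightarrow> t < T \<Longrightarrow> 2 * (ip (U T) (B t) - ip (U t) (B t)) \<le> JT - J t"
    and \<psi>: "\<And>t. (\<psi> has_real_derivative \<psi>' t) (at t)" "continuous_on {0..T} \<psi>'" "\<And>t. t \<in> {0..T} \<Longrightarrow> 0 \<le> \<psi> t"
  shows "(LINT t|lebesgue_on {0<..<T}. \<psi>' t * J t) + 2 * (LINT t|lebesgue_on {0<..<T}. \<psi> t * ip (V t) (B t)) \<le> \<psi> T * JT"
proof -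
  have V'm [measurable]: "V' \<in> borel_measurable borel" and G'm [measurable]: "G' \<in> borel_measurable borel"
    using V'(1) G'(1) by (auto simp: sqint_def)
  have V'x: "V' (x, s) = 0" if "x \<notin> {0<..<1}" for x s using V'(2) that by auto
  have iJ: "integrable lebesgue (\<lambda>t. indicator {0<..<T} t * J t)" using J(1) by (simp add: integral_lebesgue_on_eq)
  obtain J0 where J0: "J0 \<in> borel_measurable lborel" "AE t in lborel. indicator {0<..<T} t * J t = J0 t"
    using completion_ex_borel_measurable_real[OF borel_measurable_integrable[OF iJ]] by blast
  \<comment> \<open>The Borel version of \<open>J\<close> is only almost everywhere equal to it; the
    maximum restores nonnegativity at every time.\<close>
  define J' where "J' t = max 0 (J0 t)" for t
  have [measurable]: "J' \<in> borel_measurable borel" using J0(1) unfolding J'_def[abs_def] by simp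
  have J'eq: "AE t in lborel. t \<in> {0<..<T} \<longrightarrow> J' t = J t"
    using J0(2)
  proof eventually_elim
    case (elim t) then show ?case using J(2)[of t] by (auto simp: J'_def indicator_def)
  qed
  have J'eqI: "AE t in lebesgue. indicator {0<..<T} t * J' t = indicator {0<..<T} t * J t"
    by (rule AE_completion) (use J'eq in eventually_elim, auto simp: indicator_def)
  have J'm: "(\<lambda>t. indicator {0<..<T} t * J' t) \<in> borel_measurable lebesgue"
    by (intro measurable_completion) measurable
  have "integrable lebesgue (\<lambda>t. indicator {0<..<T} t * J' t)"
    using iJ integrable_cong_AE[OF J'm borel_measurable_integrable[OF iJ] J'eqI] by blast
  then have iJ': "integrable lborel (\<lambda>t. indicator {0<..<T} t * J' t)"
    by (subst (asm) integrable_completion) measurable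
  have Vae: "AE s in lborel. s \<in> {0<..<T} \<longrightarrow> (AE x in I01. V' (x, s) = wt (V s) x)"
    using V'(3) unfolding AE_lebesgue_on_lborel .
  have Gae: "AE t in lborel. t \<in> {0<..<T} \<longrightarrow> (AE x in I01. G' (x, t) = wt (B t) x)"
    using G'(2) unfolding AE_lebesgue_on_lborel .
  have Pae: "AE t in lborel. t \<in> {0<..<T} \<longrightarrow> P t" using P(1) unfolding AE_lebesgue_on_lborel .
  \<comment> \<open>Both \<open>t\<close> and \<open>t + \<sigma>\<close> have to be good times,
    which is why the null sets are also translated by \<open>\<sigma>\<close>.\<close>
  have key: "AE t in lborel. t \<in> {0<..<T} \<longrightarrow>
      2 * (LINT \<tau>:{0<..<\<sigma>}|lborel. LINT x|lborel. V' (x, t + \<tau>) * G' (x, t))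
        \<le> (if t + \<sigma> < T then J' (t + \<sigma>) else JT) - J' t" if \<sigma>: "0 < \<sigma>" "\<sigma> < T" for \<sigma>
    using Gae Pae J'eq AE_lborel_translate[OF Pae, of \<sigma>] AE_lborel_translate[OF J'eq, of \<sigma>]
  proof (eventually_elim)
    case (elim t)
    show ?case
    proof
    assume t0: "t \<in> {0<..<T}"
    have t: "0 < t" "t < T" using t0 by simp_all
    have Pt: "P t" and Gt: "AE x in I01. G' (x, t) = wt (B t) x" and Jt: "J' t = J t"
      using elim(1-3) t0 by blast+
    have Bt: "B t \<in> L2w a" by (rule P(2)[OF Pt])
    \<comment> \<open>Since \<open>V'\<close> vanishes after \<open>T\<close>, the integral over the
      shifts effectively stops at \<open>T\<close>; the two cases of the claim are
      \<open>r = t + \<sigma>\<close> and \<open>r = T\<close>.\<close>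
    define r where "r = min (t + \<sigma>) T"
    have r: "t < r" "r \<le> T" "r \<le> t + \<sigma>" "0 < r" using t \<sigma> by (auto simp: r_def)
    define \<phi> where "\<phi> s = (LINT x|lborel. V' (x, s) * G' (x, t))" for s
    have [measurable]: "\<phi> \<in> borel_measurable borel" unfolding \<phi>_def[abs_def] by measurable
    have \<phi>eq: "AE s in lborel. s \<in> {0<..<T} \<longrightarrow> \<phi> s = ip (V s) (B t)"
      using Vae
    proof eventually_elim
      case (elim s)
      then show ?case using integral_slices_eq_ip[OF V'm V'x G'm _ Gt, of s "V s"] by (auto simp: \<phi>_def)
    qed
    have \<phi>0: "\<phi> s = 0" if "T \<le> s" for s using V'(2) that by (simp add: \<phi>_def)
    have ib: "integrable lebesgue (\<lambda>s. indicator {0<..<T} s * ip (V s) (B t))"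
      using sqint_pairing_bochner_L2[OF _ Bt, of V T] H by (simp add: bochner_H1_def integral_lebesgue_on_eq)
    have "(LINT \<tau>:{0<..<\<sigma>}|lborel. LINT x|lborel. V' (x, t + \<tau>) * G' (x, t))
        = (LINT \<tau>|lborel. indicator {0<..<\<sigma>} \<tau> * \<phi> (t + \<tau>))"
      by (simp add: set_lebesgue_integral_def \<phi>_def)
    also have "\<dots> = (LINT s|lborel. indicator {0<..<\<sigma>} (s - t) * \<phi> s)"
      using lborel_integral_real_affine[of 1 "\<lambda>s. indicator {0<..<\<sigma>} (s - t) * \<phi> s" t] by simp
    also have "\<dots> = (LINT s|lebesgue. indicator {0<..<\<sigma>} (s - t) * \<phi> s)"
      by (rule integral_completion[symmetric]) measurable
    also have "\<dots> = (LINT s|lebesgue. indicator {t<..<r} s * (indicator {0<..<T} s * ip (V s) (B t)))"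
    proof (rule integral_cong_AE)
      show "(\<lambda>s. indicator {0<..<\<sigma>} (s - t) * \<phi> s) \<in> borel_measurable lebesgue"
        by (intro measurable_completion) measurable
      show "(\<lambda>s. indicator {t<..<r} s * (indicator {0<..<T} s * ip (V s) (B t))) \<in> borel_measurable lebesgue"
        by (intro borel_measurable_times[OF _ borel_measurable_integrable[OF ib]] borel_measurable_indicator) simp
      show "AE s in lebesgue. indicator {0<..<\<sigma>} (s - t) * \<phi> s
          = indicator {t<..<r} s * (indicator {0<..<T} s * ip (V s) (B t))"
        using AE_completion[OF \<phi>eq]
      proof eventually_elim
        case (elim s)
        show ?case
        proof (cases "s < T")
          case True
          then show ?thesis using elim t by (auto simp: indicator_def r_def)
        next
          case False
          then show ?thesis using \<phi>0[of s] by (simp add: indicator_def)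
        qed
      qed
    qed
    also have "\<dots> = (LINT s|lebesgue_on {t<..<r}. ip (V s) (B t))"
      unfolding integral_lebesgue_on_eq using t r
      by (intro Bochner_Integration.integral_cong) (auto simp: indicator_def)
    also have "\<dots> = ip (U r) (B t) - ip (U t) (B t)"
      using bochner_H1_FTC[OF H Bt t(1) _ r(2)] r(1) by simp
    finally have i: "(LINT \<tau>:{0<..<\<sigma>}|lborel. LINT x|lborel. V' (x, t + \<tau>) * G' (x, t)) = ip (U r) (B t) - ip (U t) (B t)" .
    show "2 * (LINT \<tau>:{0<..<\<sigma>}|lborel. LINT x|lborel. V' (x, t + \<tau>) * G' (x, t))
        \<le> (if t + \<sigma> < T then J' (t + \<sigma>) else JT) - J' t"
    proof (cases "t + \<sigma> < T")
      case True
      then have "\<sigma> + t \<in> {0<..<T}" using t \<sigma> by simp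
      then have "P (t + \<sigma>)" "J' (t + \<sigma>) = J (t + \<sigma>)"
        using elim(4,5) by (simp_all only: add.commute[of t] simp_thms)
      then show ?thesis unfolding i using True conv(1)[of "t + \<sigma>" t] Pt t \<sigma> by (simp add: r_def Jt)
    next
      case False
      then show ?thesis unfolding i using conv(2)[OF Pt t] by (simp add: r_def Jt)
    qed
    qed
  qed
  have "(LINT t:{0<..<T}|lborel. \<psi>' t * J' t)
      + 2 * (LINT t:{0<..<T}|lborel. \<psi> t * (LINT x|lborel. V' (x, t) * G' (x, t))) \<le> \<psi> T * JT"
  proof (rule energy_inequality[OF T V'(1) G'(1) _ _ J(3) \<psi> key])
    show "set_integrable lborel {0<..<T} J'" using iJ' by (simp add: set_integrable_def)
    show "0 \<le> J' t" for t by (simp add: J'_def)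
  qed
  moreover have "(LINT t:{0<..<T}|lborel. \<psi>' t * J' t) = (LINT t|lebesgue_on {0<..<T}. \<psi>' t * J t)"
  proof -
    have m0: "(\<lambda>t. indicator {0..T} t * \<psi>' t) \<in> borel_measurable lborel"
      using borel_measurable_continuous_on_indicator[OF _ \<psi>(2)] by simp
    have e: "indicator {0<..<T} t * (\<psi>' t * h t) = (indicator {0..T} t * \<psi>' t) * (indicator {0<..<T} t * h t)" for t and h :: "real \<Rightarrow> real"
      by (auto simp: indicator_def)
    have "(LINT t:{0<..<T}|lborel. \<psi>' t * J' t) = (LINT t|lborel. (indicator {0..T} t * \<psi>' t) * (indicator {0<..<T} t * J' t))"
      by (simp only: set_lebesgue_integral_def real_scaleR_def e)
    also have "\<dots> = (LINT t|lebesgue. (indicator {0..T} t * \<psi>' t) * (indicator {0<..<T} t * J' t))"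
    proof (rule integral_completion[symmetric], rule borel_measurable_times[OF m0])
      show "(\<lambda>t. indicator {0<..<T} t * J' t) \<in> borel_measurable lborel" by measurable
    qed
    also have "\<dots> = (LINT t|lebesgue. (indicator {0..T} t * \<psi>' t) * (indicator {0<..<T} t * J t))"
      by (rule integral_cong_AE[OF borel_measurable_times[OF measurable_completion[OF m0] J'm]
            borel_measurable_times[OF measurable_completion[OF m0] borel_measurable_integrable[OF iJ]]])
        (use J'eqI in eventually_elim, simp only:)
    also have "\<dots> = (LINT t|lebesgue_on {0<..<T}. \<psi>' t * J t)" by (simp only: integral_lebesgue_on_eq e)
    finally show ?thesis .
  qed
  moreover have "(LINT t:{0<..<T}|lborel. \<psi> t * (LINT x|lborel. V' (x, t) * G' (x, t)))
      = (LINT t|lebesgue_on {0<..<T}. \<psi> t * ip (V t) (B t))"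
  proof -
    have "continuous_on UNIV \<psi>" using \<psi>(1) by (meson DERIV_isCont continuous_at_imp_continuous_on)
    then have [measurable]: "\<psi> \<in> borel_measurable borel" by (rule borel_measurable_continuous_onI)
    let ?h = "\<lambda>t. indicator {0<..<T} t * (\<psi> t * (LINT x|lborel. V' (x, t) * G' (x, t)))"
    have hm: "?h \<in> borel_measurable lborel" by measurable
    have eq: "AE t in lebesgue. ?h t = indicator {0<..<T} t * (\<psi> t * ip (V t) (B t))"
    proof (rule AE_completion, use Vae Gae in eventually_elim)
      case (elim t)
      then show ?case
        using integral_slices_eq_ip[OF V'm V'x G'm, of t "V t" t "B t"] by (auto simp: indicator_def)
    qed
    have "(LINT t:{0<..<T}|lborel. \<psi> t * (LINT x|lborel. V' (x, t) * G' (x, t))) = (LINT t|lborel. ?h t)"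
      by (simp add: set_lebesgue_integral_def)
    also have "\<dots> = (LINT t|lebesgue. ?h t)" by (rule integral_completion[OF hm, symmetric])
    also have "\<dots> = (LINT t|lebesgue. indicator {0<..<T} t * (\<psi> t * ip (V t) (B t)))"
      by (rule integral_cong_AE[OF measurable_completion[OF hm] borel_measurable_AE[OF measurable_completion[OF hm] eq] eq])
    also have "\<dots> = (LINT t|lebesgue_on {0<..<T}. \<psi> t * ip (V t) (B t))" by (simp only: integral_lebesgue_on_eq)
    finally show ?thesis .
  qed
  ultimately show ?thesis by simp
qed

end

section \<open>Regularity of the time slices\<close>

context weight
begin

lemma a_bounded:
  obtains K where "0 < K" "\<And>x. x \<in> {0<..<1} \<Longrightarrow> a x \<le> K"
proof -
  have "compact (a ` {0..1})" using cont by (intro compact_continuous_image) auto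
  then obtain K where K: "\<forall>y\<in>a ` {0..1}. norm y \<le> K" using compact_imp_bounded bounded_iff by metis
  show thesis
  proof (rule that[of "max 1 K"])
    fix x :: real assume "x \<in> {0<..<1}"
    then have "a x \<in> a ` {0..1}" by auto
    then have "norm (a x) \<le> K" using K by blast
    then show "a x \<le> max 1 K" by simp
  qed simp
qed

lemma L2w_cong_AE:
  assumes f: "f \<in> L2w a" and eq: "AE x in I01. f x = g x" and g: "g \<in> borel_measurable I01"
  shows "g \<in> L2w a"
  unfolding L2w_iff
proof
  show "sqint I01 g" by (rule sqint_cong_AE[OF L2w_sqint(1)[OF f] eq g])
  have "AE x in I01. wt f x = wt g x" using eq by eventually_elim (simp add: wt_def)
  then show "sqint I01 (wt g)" by (rule sqint_cong_AE[OF L2w_sqint(2)[OF f] _ wt_measurable[OF g]])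
qed

lemma wt_a_mult: "x \<in> {0<..<1} \<Longrightarrow> wt (\<lambda>x. a x * q x) x = sqrt (a x) * q x"
  using pos[of x] by (simp add: wt_def field_simps)

text \<open>The arguments are a slice and its first two space derivatives. The function
  \<open>- (a x * q x)\<close> is the gradient, with respect to \<open>ip\<close>, of half the
  integral of \<open>p^2\<close>; its image under \<open>wt\<close> is
  \<open>sqrt (a x) * q x\<close> up to sign.\<close>

definition regular :: "(real \<Rightarrow> real) \<Rightarrow> (real \<Rightarrow> real) \<Rightarrow> (real \<Rightarrow> real) \<Rightarrow> bool" where
  "regular f p q \<longleftrightarrow> f \<in> L2w a \<and> H10_deriv f p \<and> weak_deriv 0 1 p q \<and>
     sqint I01 (\<lambda>x. sqrt (a x) * q x) \<and> (\<lambda>x. - (a x * q x)) \<in> L2w a"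

lemma regularD:
  assumes "regular f p q"
  shows "f \<in> L2w a" "H10_deriv f p" "weak_deriv 0 1 p q" "sqint I01 (\<lambda>x. sqrt (a x) * q x)"
    "(\<lambda>x. - (a x * q x)) \<in> L2w a" "sqint I01 p"
  using assms H10_deriv_sqint(2) by (auto simp: regular_def)

lemma wderiv_weak_deriv: "weak_deriv 0 1 f g \<Longrightarrow> weak_deriv 0 1 f (wderiv f)"
  unfolding wderiv_def by (rule someI[of "weak_deriv 0 1 f"])

lemma weak_deriv_measurable:
  assumes "weak_deriv 0 1 f g"
  shows "f \<in> borel_measurable I01" "g \<in> borel_measurable I01"
  using assms unfolding weak_deriv_def by (auto intro: locally_integrable_measurable)

lemma wderiv_square_integral:
  assumes "weak_deriv 0 1 f g"
  shows "(LINT x|I01. (wderiv f x)\<^sup>2) = (LINT x|I01. (g x)\<^sup>2)"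
proof (rule integral_cong_AE)
  have w: "weak_deriv 0 1 f (wderiv f)" by (rule wderiv_weak_deriv[OF assms])
  have "AE x in I01. wderiv f x = g x" by (rule weak_deriv_unique[OF w assms]) simp
  then show "AE x in I01. (wderiv f x)\<^sup>2 = (g x)\<^sup>2" by eventually_elim simp
  show "(\<lambda>x. (wderiv f x)\<^sup>2) \<in> borel_measurable I01" "(\<lambda>x. (g x)\<^sup>2) \<in> borel_measurable I01"
    using weak_deriv_measurable[OF w] weak_deriv_measurable[OF assms] by (auto intro: borel_measurable_power)
qed

text \<open>Membership and norm are formulated with a chosen \<open>wderiv\<close>; uniqueness of
  weak derivatives replaces it by the derivatives at hand. The norm identity later makes the single
  finite integral in the Bochner space control \<open>u\<close>, \<open>u_x\<close> and
  \<open>a u_xx\<close> at once.\<close>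

lemma regular_H2w:
  assumes f: "f \<in> H2w a" and p: "weak_deriv 0 1 f p" and q: "weak_deriv 0 1 p q"
  shows "regular f p q"
    and "(H2w_norm a f)\<^sup>2 = (L2w_norm a f)\<^sup>2 + (LINT x|I01. (p x)\<^sup>2) + (LINT x|I01. (sqrt (a x) * q x)\<^sup>2)"
proof -
  have fL: "f \<in> L2w a" and fH: "f \<in> H10" using f by (simp_all add: H2w_def H1w_def)
  obtain g where g: "weak_deriv 0 1 (wderiv f) g" "(\<lambda>x. a x * g x) \<in> L2w a"
    using f unfolding H2w_def by blast
  have wf: "weak_deriv 0 1 f (wderiv f)" by (rule wderiv_weak_deriv[OF p])
  have wwf: "weak_deriv 0 1 (wderiv f) (wderiv (wderiv f))" by (rule wderiv_weak_deriv[OF g(1)])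
  have eqp: "AE x in I01. wderiv f x = p x" by (rule weak_deriv_unique[OF wf p]) simp
  have eqg: "AE x in I01. g x = q x" by (rule weak_deriv_unique[OF g(1) q eqp])
  have eqw: "AE x in I01. wderiv (wderiv f) x = q x" by (rule weak_deriv_unique[OF wwf q eqp])
  have qm: "q \<in> borel_measurable I01" by (rule weak_deriv_measurable(2)[OF q])
  have aq: "(\<lambda>x. a x * q x) \<in> L2w a"
    by (rule L2w_cong_AE[OF g(2)]) (use eqg in eventually_elim, simp, intro borel_measurable_times a_measurable qm)
  have "sqint I01 (\<lambda>x. sqrt (a x) * q x)"
  proof (rule sqint_cong_AE[OF L2w_sqint(2)[OF aq]])
    show "AE x in I01. wt (\<lambda>x. a x * q x) x = sqrt (a x) * q x" by (rule AE_I2) (simp add: wt_a_mult)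
    show "(\<lambda>x. sqrt (a x) * q x) \<in> borel_measurable I01"
      by (intro borel_measurable_times qm measurable_compose[OF a_measurable borel_measurable_sqrt])
  qed
  then show "regular f p q"
    unfolding regular_def using fL H10_derivI_weak_deriv[OF fH p] q L2w_cmult[OF aq, of "-1"] by simp
  have "(LINT x|I01. a x * (wderiv (wderiv f) x)\<^sup>2) = (LINT x|I01. (sqrt (a x) * q x)\<^sup>2)"
  proof (rule integral_cong_AE)
    have "AE x in I01. x \<in> {0<..<1}" by (rule AE_I2) simp
    with eqw show "AE x in I01. a x * (wderiv (wderiv f) x)\<^sup>2 = (sqrt (a x) * q x)\<^sup>2"
    proof eventually_elim
      case (elim x)
      then show ?case using pos[of x] by (simp add: power_mult_distrib)
    qed
    show "(\<lambda>x. a x * (wderiv (wderiv f) x)\<^sup>2) \<in> borel_measurable I01"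
      by (intro borel_measurable_times borel_measurable_power a_measurable weak_deriv_measurable(2)[OF wwf])
    show "(\<lambda>x. (sqrt (a x) * q x)\<^sup>2) \<in> borel_measurable I01"
      by (intro borel_measurable_times borel_measurable_power qm measurable_compose[OF a_measurable borel_measurable_sqrt])
  qed
  moreover have "0 \<le> (H1w_norm a f)\<^sup>2 + (LINT x|I01. a x * (wderiv (wderiv f) x)\<^sup>2)"
  proof (intro add_nonneg_nonneg integral_nonneg_AE AE_I2)
    fix x assume "x \<in> space I01"
    then show "0 \<le> a x * (wderiv (wderiv f) x)\<^sup>2" using pos[of x] by simp
  qed simp
  moreover have "0 \<le> (L2w_norm a f)\<^sup>2 + (LINT x|I01. (wderiv f x)\<^sup>2)" by (intro add_nonneg_nonneg) simp_all
  ultimately show "(H2w_norm a f)\<^sup>2 = (L2w_norm a f)\<^sup>2 + (LINT x|I01. (p x)\<^sup>2) + (LINT x|I01. (sqrt (a x) * q x)\<^sup>2)"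
    by (simp add: H2w_norm_def H1w_norm_def wderiv_square_integral[OF p])
qed

text \<open>Although \<open>q\<close> may be singular where \<open>a\<close> vanishes,
  \<open>h q\<close> is the product of the \<open>L^2\<close> functions \<open>h / sqrt a\<close>
  and \<open>sqrt a q\<close>, hence integrable. On compact subintervals \<open>1 / sqrt a\<close>
  is bounded, so \<open>q\<close> is square integrable there. These are the two requirements for
  integration by parts.\<close>

lemma regular_pairing:
  assumes r: "regular f p q" and h: "h \<in> L2w a" "H10_deriv h h'"
  shows "(LINT x|I01. h' x * p x) = ip h (\<lambda>x. - (a x * q x))"
proof -
  note R = regularD[OF r]
  have "(LINT x|I01. h' x * p x) = - (LINT x|I01. h x * q x)"
  proof (rule H10_deriv_integral_by_parts[OF h(2) R(6,3)])
    have "integrable I01 (\<lambda>x. wt h x * (sqrt (a x) * q x))"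
      by (rule sqint_mult_integrable[OF L2w_sqint(2)[OF h(1)] R(4)])
    moreover have "integrable I01 (\<lambda>x. wt h x * (sqrt (a x) * q x)) \<longleftrightarrow> integrable I01 (\<lambda>x. h x * q x)"
    proof (rule Bochner_Integration.integrable_cong[OF refl])
      fix x assume "x \<in> space I01"
      then show "wt h x * (sqrt (a x) * q x) = h x * q x" using pos[of x] by (simp add: wt_def)
    qed
    ultimately show "integrable I01 (\<lambda>x. h x * q x)" by simp
    fix c d :: real assume cd: "0 < c" "c \<le> d" "d < 1"
    have "continuous_on {c..d} (\<lambda>x. 1 / sqrt (a x))"
    proof (intro continuous_intros)
      show "continuous_on {c..d} a" by (rule continuous_on_subset[OF cont]) (use cd in auto)
      show "\<forall>x\<in>{c..d}. sqrt (a x) \<noteq> 0"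
      proof
        fix x assume "x \<in> {c..d}"
        then have "0 < a x" using cd by (intro pos) auto
        then show "sqrt (a x) \<noteq> 0" by simp
      qed
    qed
    then have "compact ((\<lambda>x. 1 / sqrt (a x)) ` {c..d})" by (intro compact_continuous_image) auto
    then obtain K where K: "\<forall>y\<in>(\<lambda>x. 1 / sqrt (a x)) ` {c..d}. norm y \<le> K" using compact_imp_bounded bounded_iff by metis
    have K': "\<bar>1 / sqrt (a x)\<bar> \<le> K" if "x \<in> {c..d}" for x using K that by force
    have K0: "0 \<le> K" by (rule order_trans[OF abs_ge_zero K'[of c]]) (use cd in simp)
    have "sqint I01 (\<lambda>x. (indicator {c..d} x * (1 / sqrt (a x))) * (sqrt (a x) * q x))"
    proof (rule sqint_mult_bounded[OF R(4), where K = K])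
      show "(\<lambda>x. indicator {c..d} x * (1 / sqrt (a x))) \<in> borel_measurable I01"
        by (intro borel_measurable_times borel_measurable_divide borel_measurable_const
            measurable_compose[OF a_measurable borel_measurable_sqrt] borel_measurable_lebesgue_onI) simp
      fix x
      show "\<bar>indicator {c..d} x * (1 / sqrt (a x))\<bar> \<le> K"
        using K'[of x] K0 by (cases "x \<in> {c..d}") auto
    qed
    moreover have "(indicator {c..d} x * (1 / sqrt (a x))) * (sqrt (a x) * q x) = indicator {c..d} x * q x" for x
    proof (cases "x \<in> {c..d}")
      case True
      then have "0 < a x" using cd by (intro pos) auto
      then show ?thesis by simp
    qed simp
    ultimately show "sqint I01 (\<lambda>x. indicator {c..d} x * q x)" by simp
  qed
  also have "- (LINT x|I01. h x * q x) = (LINT x|I01. - (h x * q x))" by simp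
  also have "\<dots> = ip h (\<lambda>x. - (a x * q x))"
    unfolding ip_def
  proof (rule Bochner_Integration.integral_cong[OF refl])
    fix x assume "x \<in> space I01"
    then show "- (h x * q x) = h x * - (a x * q x) / a x" using pos[of x] by simp
  qed
  finally show ?thesis .
qed

text \<open>The square is expanded and the cross term is evaluated by
  \<open>regular_pairing\<close>. An identity is kept because the trace argument needs the distance
  of two gradients and not merely its sign, as convexity does.\<close>

lemma regular_energy_difference:
  assumes r: "regular f p q" and h: "h \<in> L2w a" "H10_deriv h h'"
  shows "(LINT x|I01. (h' x - p x)\<^sup>2) = (LINT x|I01. (h' x)\<^sup>2) - (LINT x|I01. (p x)\<^sup>2)
    - 2 * (ip h (\<lambda>x. - (a x * q x)) - ip f (\<lambda>x. - (a x * q x)))"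
proof -
  note R = regularD[OF r]
  have h': "sqint I01 h'" by (rule H10_deriv_sqint(2)[OF h(2)])
  have "(LINT x|I01. (h' x - p x)\<^sup>2) = (LINT x|I01. (h' x)\<^sup>2 + (p x)\<^sup>2 - 2 * (h' x * p x))"
    by (rule Bochner_Integration.integral_cong) (simp_all add: power2_diff)
  also have "\<dots> = (LINT x|I01. (h' x)\<^sup>2) + (LINT x|I01. (p x)\<^sup>2) - 2 * (LINT x|I01. h' x * p x)"
    using sqint_integrable[OF h'] sqint_integrable[OF R(6)] sqint_mult_integrable[OF h' R(6)] by simp
  finally have e: "(LINT x|I01. (h' x - p x)\<^sup>2) = (LINT x|I01. (h' x)\<^sup>2) + (LINT x|I01. (p x)\<^sup>2) - 2 * (LINT x|I01. h' x * p x)" .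
  have "(LINT x|I01. (p x)\<^sup>2) = ip f (\<lambda>x. - (a x * q x))"
    using regular_pairing[OF r R(1,2)] by (simp add: power2_eq_square)
  then show ?thesis using e regular_pairing[OF r h] by simp
qed

lemma regular_convexity:
  assumes r: "regular f p q" and h: "h \<in> L2w a" "H10_deriv h h'"
  shows "2 * (ip h (\<lambda>x. - (a x * q x)) - ip f (\<lambda>x. - (a x * q x)))
    \<le> (LINT x|I01. (h' x)\<^sup>2) - (LINT x|I01. (p x)\<^sup>2)"
proof -
  have "0 \<le> (LINT x|I01. (h' x - p x)\<^sup>2)" by simp
  then show ?thesis unfolding regular_energy_difference[OF assms] by simp
qed

lemma ip_convexity:
  assumes f: "f \<in> L2w a" and h: "h \<in> L2w a"
  shows "2 * (ip h f - ip f f) \<le> ip h h - ip f f"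
proof -
  have d: "(\<lambda>x. h x - f x) \<in> L2w a" by (rule L2w_diff[OF h f])
  have "0 \<le> ip (\<lambda>x. h x - f x) (\<lambda>x. h x - f x)" unfolding L2w_norm_power2[symmetric] by simp
  also have "\<dots> = ip h (\<lambda>x. h x - f x) - ip f (\<lambda>x. h x - f x)" by (rule ip_diff_left[OF h f d])
  also have "\<dots> = (ip h h - ip f h) - (ip h f - ip f f)"
    unfolding ip_commute[of _ "\<lambda>x. h x - f x"] ip_diff_left[OF h f h] ip_diff_left[OF h f f] ..
  finally show ?thesis using ip_commute[of f h] by simp
qed

end

section \<open>The trace at the final time\<close>

lemma integrable_lebesgue_on_subinterval:
  fixes D :: "real \<Rightarrow> real"
  assumes D: "integrable (lebesgue_on {l<..<r}) D" and sub: "l \<le> c" "d \<le> r"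
  shows "integrable (lebesgue_on {c<..<d}) D"
proof -
  have "integrable lebesgue (\<lambda>t. indicator {c<..<d} t *\<^sub>R (indicator {l<..<r} t * D t))"
    by (rule integrable_mult_indicator) (use D in \<open>simp_all add: integral_lebesgue_on_eq\<close>)
  moreover have "indicator {c<..<d} t *\<^sub>R (indicator {l<..<r} t * D t) = indicator {c<..<d} t * D t" for t
    using sub by (auto simp: indicator_def)
  ultimately show ?thesis by (simp only: integral_lebesgue_on_eq)
qed

lemma integral_lebesgue_on_combine:
  fixes D :: "real \<Rightarrow> real"
  assumes D: "integrable (lebesgue_on {l<..<r}) D" and o: "l \<le> t" "t \<le> s" "s \<le> r"
  shows "(LINT x|lebesgue_on {l<..<s}. D x) - (LINT x|lebesgue_on {l<..<t}. D x) = (LINT x|lebesgue_on {t<..<s}. D x)"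
proof -
  have i: "integrable lebesgue (\<lambda>x. indicator {c<..<d} x * D x)" if "l \<le> c" "d \<le> r" for c d
    using integrable_lebesgue_on_subinterval[OF D that] by (simp add: integral_lebesgue_on_eq)
  have i3: "integrable lebesgue (\<lambda>x. indicator {l<..<s} x * D x)" "integrable lebesgue (\<lambda>x. indicator {l<..<t} x * D x)"
    "integrable lebesgue (\<lambda>x. indicator {t<..<s} x * D x)" by (intro i; use o in simp)+
  have "(LINT x|lebesgue. indicator {l<..<s} x * D x) = (LINT x|lebesgue. indicator {l<..<t} x * D x + indicator {t<..<s} x * D x)"
  proof (rule integral_cong_AE)
    have "AE x in lebesgue. x \<noteq> t" by (rule AE_completion[OF AE_lborel_singleton])
    then show "AE x in lebesgue. indicator {l<..<s} x * D x = indicator {l<..<t} x * D x + indicator {t<..<s} x * D x"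
      by eventually_elim (use o in \<open>auto simp: indicator_def\<close>)
  qed (intro borel_measurable_integrable i3 Bochner_Integration.integrable_add)+
  then show ?thesis using i3 by (simp add: integral_lebesgue_on_eq)
qed

text \<open>If no such point existed, the integrand would exceed its mean by a fixed amount almost
  everywhere. The slack \<open>e\<close> makes the contradiction strict after integration.\<close>

lemma exists_point_le_mean:
  fixes D :: "real \<Rightarrow> real"
  assumes D: "integrable (lebesgue_on {c<..<d}) D" and P: "AE t in lebesgue_on {c<..<d}. P t"
    and cd: "c < d" and e: "0 < e"
  obtains t where "t \<in> {c<..<d}" "P t" "D t * (d - c) \<le> (LINT x|lebesgue_on {c<..<d}. D x) + e"
proof -
  let ?M = "lebesgue_on {c<..<d}"
  let ?I = "LINT x|?M. D x"
  have "\<exists>t. t \<in> {c<..<d} \<and> P t \<and> D t * (d - c) \<le> ?I + e"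
  proof (rule ccontr)
    assume n: "\<not> ?thesis"
    have fm: "integrable ?M (\<lambda>r. k)" and fc: "(LINT r|?M. k) = (d - c) * k" for k :: real
      using cd emeasure_bounded_finite[of "{c<..<d}"]
      by (auto simp: measure_restrict_space emeasure_restrict_space intro!: finite_measure.integrable_const finite_measureI)
    have "AE t in ?M. t \<in> {c<..<d}" by (rule AE_I2) simp
    with P have "AE t in ?M. ?I + e \<le> D t * (d - c)"
      by eventually_elim (use n in force)
    then have "(LINT r|?M. ?I + e) \<le> (LINT r|?M. D r * (d - c))"
      using D fm by (intro integral_mono_AE) auto
    then have "(d - c) * (?I + e) \<le> (d - c) * ?I" unfolding fc by (simp add: mult.commute)
    then show False using cd e by simp
  qed
  then show thesis using that by blast
qed

context weight
begin

text \<open>The square of the norm of an integral is bounded by the length of the interval times the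
  integral of the squared norms. To use scalar pairings only, the increment is paired with itself;
  Young's inequality is balanced so that half of its squared norm is absorbed on the left.\<close>

lemma bochner_H1_increment:
  assumes H: "bochner_H1 T (L2w a) (L2w_norm a) U V" and D: "integrable (lebesgue_on {0<..<T}) D"
    and VD: "AE t in lebesgue_on {0<..<T}. (L2w_norm a (V t))\<^sup>2 \<le> D t" and ts: "0 < t" "t \<le> s" "s \<le> T"
  shows "(L2w_norm a (\<lambda>x. U s x - U t x))\<^sup>2 \<le> (s - t) * (LINT r|lebesgue_on {t<..<s}. D r)"
proof (cases "t = s")
  case True
  then show ?thesis by (simp add: L2w_norm_def)
next
  case False
  then have st: "t < s" using ts by simp
  let ?M = "lebesgue_on {t<..<s}"
  have UX: "U t \<in> L2w a" "U s \<in> L2w a" using H ts by (auto simp: bochner_H1_def)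
  define w where "w x = U s x - U t x" for x
  have w: "w \<in> L2w a" unfolding w_def[abs_def] by (rule L2w_diff[OF UX(2,1)])
  have V: "V \<in> bochner_L2 T (L2w a) (L2w_norm a)" using H by (simp add: bochner_H1_def)
  have VX: "AE r in lebesgue_on {0<..<T}. V r \<in> L2w a" using V by (simp add: bochner_L2_def strongly_measurable_in_def)
  have sub: "AE r in ?M. Q r" if "AE r in lebesgue_on {0<..<T}. Q r" for Q
    using that unfolding AE_lebesgue_on_interval by eventually_elim (use ts in auto)
  have iV: "integrable ?M (\<lambda>r. ip (V r) w)"
    by (rule integrable_lebesgue_on_subinterval[OF sqint_pairing_bochner_L2[OF V w]]) (use ts in auto)
  have iD: "integrable ?M D" by (rule integrable_lebesgue_on_subinterval[OF D]) (use ts in auto)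
  have fm: "integrable ?M (\<lambda>r. c)" and fc: "(LINT r|?M. c) = (s - t) * c" for c :: real
    using st emeasure_bounded_finite[of "{t<..<s}"]
    by (auto simp: measure_restrict_space emeasure_restrict_space intro!: finite_measure.integrable_const finite_measureI)
  define N where "N = (L2w_norm a w)\<^sup>2"
  have "N = ip w w" by (simp add: N_def L2w_norm_power2)
  also have "\<dots> = ip (U s) w - ip (U t) w" using ip_diff_left[OF UX(2,1) w] by (simp add: w_def[abs_def])
  also have "\<dots> = (LINT r|?M. ip (V r) w)" by (rule bochner_H1_FTC[OF H w ts])
  also have "\<dots> \<le> (LINT r|?M. (s - t) / 2 * D r + N / (2 * (s - t)))"
  proof (rule integral_mono_AE[OF iV])
    show "integrable ?M (\<lambda>r. (s - t) / 2 * D r + N / (2 * (s - t)))" using iD fm by simp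
    show "AE r in ?M. ip (V r) w \<le> (s - t) / 2 * D r + N / (2 * (s - t))"
      using sub[OF VX] sub[OF VD]
    proof eventually_elim
      case (elim r)
      let ?b = "L2w_norm a (V r)" and ?n = "L2w_norm a w"
      have "2 * h * (b * n) \<le> h\<^sup>2 * b\<^sup>2 + n\<^sup>2" for h b n :: real
        using zero_le_power2[of "h * b - n"] by (simp add: power2_diff power_mult_distrib mult_ac)
      then have "2 * (s - t) * (?b * ?n) \<le> (s - t)\<^sup>2 * ?b\<^sup>2 + N" unfolding N_def .
      also have "\<dots> \<le> (s - t)\<^sup>2 * D r + N" using elim(2) by (intro add_right_mono mult_left_mono) auto
      also have "\<dots> = 2 * (s - t) * ((s - t) / 2 * D r + N / (2 * (s - t)))" using st by (simp add: field_simps power2_eq_square)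
      finally have "?b * ?n \<le> (s - t) / 2 * D r + N / (2 * (s - t))" using st by simp
      then show ?case using ip_Cauchy_Schwarz[OF elim(1) w] by linarith
    qed
  qed
  also have "\<dots> = (s - t) / 2 * (LINT r|?M. D r) + (LINT r|?M. N / (2 * (s - t)))" using iD fm by simp
  also have "(LINT r|?M. N / (2 * (s - t))) = (s - t) * (N / (2 * (s - t)))" by (rule fc)
  also have "(s - t) * (N / (2 * (s - t))) = N / 2" using st by (simp add: divide_simps)
  finally show ?thesis unfolding N_def w_def by simp
qed

text \<open>The weight is bounded above. This converts continuity in time in the weighted norm into
  the \<open>L^2\<close> convergence that \<open>H10_deriv_limit\<close> asks for.\<close>

lemma l2norm_le_L2w_norm:
  obtains K where "0 < K" "\<And>f. f \<in> L2w a \<Longrightarrow> l2norm I01 f \<le> K * L2w_norm a f"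
proof -
  obtain K where K: "0 < K" "\<And>x. x \<in> {0<..<1} \<Longrightarrow> a x \<le> K" by (rule a_bounded) blast
  show thesis
  proof (rule that[of "sqrt K"])
    show "0 < sqrt K" using K(1) by simp
    fix f assume f: "f \<in> L2w a"
    have "(LINT x|I01. (f x)\<^sup>2) \<le> (LINT x|I01. K * (wt f x)\<^sup>2)"
    proof (rule integral_mono)
      show "integrable I01 (\<lambda>x. (f x)\<^sup>2)" "integrable I01 (\<lambda>x. K * (wt f x)\<^sup>2)"
        using L2w_sqint[OF f] by (simp_all add: sqint_def)
      fix x assume "x \<in> space I01"
      then have x: "0 < a x" "a x \<le> K" using pos K(2) by auto
      have "(f x)\<^sup>2 = a x * (wt f x)\<^sup>2" using x by (simp add: wt_def power_divide)
      also have "\<dots> \<le> K * (wt f x)\<^sup>2" using x by (intro mult_right_mono) auto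
      finally show "(f x)\<^sup>2 \<le> K * (wt f x)\<^sup>2" .
    qed
    then have "(LINT x|I01. (f x)\<^sup>2) \<le> K * (LINT x|I01. (wt f x)\<^sup>2)" by simp
    then show "l2norm I01 f \<le> sqrt K * L2w_norm a f"
      unfolding L2w_norm_eq l2norm_def real_sqrt_mult[symmetric] by (rule real_sqrt_le_mono)
  qed
qed

text \<open>Dyadic intervals of length \<open>l n\<close> approach \<open>T\<close>; in each a time \<open>t n\<close> is chosen where \<open>l n * D (t n)\<close> does not exceed
  the integral of \<open>D\<close> over the interval by more than \<open>2\<^sup>-\<^sup>n\<close>. Convexity bounds both
  \<open>E (t (n + 1)) - E (t n)\<close> and the distance of the gradients at \<open>t m\<close> and \<open>t n\<close>; thus \<open>E (t n)\<close> converges, and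
  then the gradients do.\<close>

lemma regular_trace:
  assumes T: "0 < T" and H: "bochner_H1 T (L2w a) (L2w_norm a) U V"
    and D: "integrable (lebesgue_on {0<..<T}) D" "\<And>t. 0 \<le> D t"
    and VD: "AE t in lebesgue_on {0<..<T}. (L2w_norm a (V t))\<^sup>2 \<le> D t"
    and reg: "AE t in lebesgue_on {0<..<T}. regular (U t) (p t) (q t)"
    and AD: "AE t in lebesgue_on {0<..<T}. (L2w_norm a (\<lambda>x. - (a x * q t x)))\<^sup>2 \<le> D t"
  obtains g where "H10_deriv (U T) g"
proof -
  define B where "B t = (\<lambda>x. - (a x * q t x))" for t
  define E where "E t = (LINT x|I01. (p t x)\<^sup>2)" for t
  define \<Phi> where "\<Phi> t = (LINT r|lebesgue_on {0<..<t}. D r)" for t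
  define P where "P t \<longleftrightarrow> regular (U t) (p t) (q t) \<and> (L2w_norm a (B t))\<^sup>2 \<le> D t" for t
  have AEP: "AE t in lebesgue_on {0<..<T}. P t"
    using reg AD by eventually_elim (simp add: P_def B_def)
  have \<Phi>diff: "\<Phi> s - \<Phi> t = (LINT r|lebesgue_on {t<..<s}. D r)" if "0 \<le> t" "t \<le> s" "s \<le> T" for s t
    unfolding \<Phi>_def by (rule integral_lebesgue_on_combine[OF D(1) that])
  have \<Phi>mono: "\<Phi> t \<le> \<Phi> s" if "0 \<le> t" "t \<le> s" "s \<le> T" for s t
  proof -
    have "0 \<le> (LINT r|lebesgue_on {t<..<s}. D r)" by (rule integral_nonneg_AE) (simp add: D(2))
    then show ?thesis using \<Phi>diff[OF that] by simp
  qed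
  have \<Phi>0: "0 \<le> \<Phi> t" for t unfolding \<Phi>_def by (rule integral_nonneg_AE) (simp add: D(2))
  have UX: "U t \<in> L2w a" if "0 \<le> t" "t \<le> T" for t using H that by (simp add: bochner_H1_def)
  have incr: "(L2w_norm a (\<lambda>x. U s x - U t x))\<^sup>2 \<le> (s - t) * (\<Phi> s - \<Phi> t)" if "0 < t" "t \<le> s" "s \<le> T" for s t
    using bochner_H1_increment[OF H D(1) VD that] \<Phi>diff[of t s] that by simp
  \<comment> \<open>The parameter \<open>c\<close> is a free length of time. Later \<open>r\<close>
    is one of the chosen times and \<open>c\<close> is comparable to its dyadic interval, so that
    \<open>c * D r\<close> is controlled by the choice and the quotient \<open>(s - t) / c\<close>
    stays bounded.\<close>
  have young: "2 * \<bar>ip (U s) (B r) - ip (U t) (B r)\<bar> \<le> c * D r + (s - t) / c * (\<Phi> s - \<Phi> t)"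
    if "0 < t" "t \<le> s" "s \<le> T" "P r" "0 < c" for s t r c
  proof -
    have Br: "B r \<in> L2w a" using \<open>P r\<close> regularD(5) unfolding P_def B_def by blast
    let ?w = "\<lambda>x. U s x - U t x"
    let ?n = "L2w_norm a ?w" and ?b = "L2w_norm a (B r)"
    have Us: "U s \<in> L2w a" "U t \<in> L2w a" using UX that by auto
    have "2 * \<bar>ip (U s) (B r) - ip (U t) (B r)\<bar> \<le> 2 * (?n * ?b)"
      using ip_Cauchy_Schwarz[OF L2w_diff[OF Us] Br] by (simp add: ip_diff_left[OF Us Br])
    also have "2 * (?n * ?b) \<le> c * ?b\<^sup>2 + ?n\<^sup>2 / c"
    proof -
      have "0 \<le> (c * ?b - ?n)\<^sup>2 / c" using \<open>0 < c\<close> by simp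
      also have "\<dots> = c * ?b\<^sup>2 + ?n\<^sup>2 / c - 2 * (?n * ?b)"
        unfolding power2_diff power_mult_distrib using \<open>0 < c\<close> by (simp add: field_simps power2_eq_square)
      finally show ?thesis by simp
    qed
    also have "\<dots> \<le> c * D r + (s - t) / c * (\<Phi> s - \<Phi> t)"
    proof (rule add_mono)
      show "c * ?b\<^sup>2 \<le> c * D r" using \<open>P r\<close> \<open>0 < c\<close> by (simp add: P_def)
      show "?n\<^sup>2 / c \<le> (s - t) / c * (\<Phi> s - \<Phi> t)"
        using divide_right_mono[OF incr[OF that(1-3)], of c] \<open>0 < c\<close> by simp
    qed
    finally show ?thesis .
  qed
  have ediff: "(LINT x|I01. (p s x - p t x)\<^sup>2) = E s - E t - 2 * (ip (U s) (B t) - ip (U t) (B t))" if "P s" "P t" for s t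
    using regular_energy_difference[of "U t" "p t" "q t" "U s" "p s"] that regularD(1,2) unfolding P_def E_def B_def by blast
  \<comment> \<open>The interval from \<open>c n\<close> to \<open>c (Suc n)\<close> has length
    \<open>l n\<close>, and \<open>2 * l n\<close> is the time left until \<open>T\<close>.\<close>
  define c where "c n = T - T * (1/2) ^ n" for n :: nat
  define l where "l n = T * (1/2) ^ n / 2" for n :: nat
  have l0: "0 < l n" for n using T by (simp add: l_def)
  have cl: "c (Suc n) = c n + l n" "T = c n + 2 * l n" "l (Suc n) = l n / 2" for n by (simp_all add: c_def l_def)
  have c0: "0 \<le> c n" "c n < T" for n
  proof -
    have "T * (1/2) ^ n \<le> T * 1" using T by (intro mult_left_mono power_le_one) auto
    then show "0 \<le> c n" by (simp add: c_def)
    show "c n < T" using l0[of n] cl(2)[of n] by linarith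
  qed
  have "\<exists>t. t \<in> {c n<..<c (Suc n)} \<and> P t \<and> D t * l n \<le> \<Phi> (c (Suc n)) - \<Phi> (c n) + (1/2) ^ n" for n
  proof -
    have lt: "c n < c (Suc n)" using cl(1) l0[of n] by simp
    have i: "integrable (lebesgue_on {c n<..<c (Suc n)}) D"
      by (rule integrable_lebesgue_on_subinterval[OF D(1)]) (use c0[of n] c0[of "Suc n"] in auto)
    have "AE t in lebesgue_on {c n<..<c (Suc n)}. P t"
      using AEP unfolding AE_lebesgue_on_interval by eventually_elim (use c0[of n] c0[of "Suc n"] in auto)
    from exists_point_le_mean[OF i this lt, of "(1/2) ^ n"]
    obtain t where "t \<in> {c n<..<c (Suc n)}" "P t"
      "D t * (c (Suc n) - c n) \<le> (LINT x|lebesgue_on {c n<..<c (Suc n)}. D x) + (1/2) ^ n" by auto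
    then show ?thesis using \<Phi>diff[of "c n" "c (Suc n)"] c0[of n] c0[of "Suc n"] lt by (auto simp: cl(1))
  qed
  then obtain t where t: "\<And>n. t n \<in> {c n<..<c (Suc n)}" "\<And>n. P (t n)"
    "\<And>n. D (t n) * l n \<le> \<Phi> (c (Suc n)) - \<Phi> (c n) + (1/2) ^ n" by metis
  have tT: "0 < t n" "t n < T" for n using t(1)[of n] c0[of n] c0[of "Suc n"] by auto
  have tc: "c n < t n" "t n < c n + l n" for n using t(1)[of n] cl(1)[of n] by auto
  have tmono: "t n \<le> t m" if "n \<le> m" for n m
  proof (rule lift_Suc_mono_le[OF _ that])
    fix k show "t k \<le> t (Suc k)" using tc[of k] tc[of "Suc k"] cl(1)[of k] by linarith
  qed
  \<comment> \<open>The corrections absorb the possible growth of \<open>E\<close> along the chosen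
    times: the first and the last term that of \<open>l n * D (t n)\<close>, where
    \<open>2 * (1/2) ^ Suc n\<close> drops by exactly \<open>(1/2) ^ Suc n\<close> in each step. The
    factor 3 is the bound of \<open>t (Suc n) - t n\<close> by
    \<open>l n + l (Suc n) = 3 * l (Suc n)\<close>.\<close>
  define X where "X n = E (t n) - \<Phi> (c (Suc n)) - 3 * \<Phi> (t n) + 2 * (1/2) ^ Suc n" for n
  have Xstep: "X (Suc n) \<le> X n" for n
  proof -
    let ?s = "t (Suc n)" and ?t = "t n" and ?l = "l (Suc n)"
    have o: "?t \<le> ?s" by (rule tmono) simp
    \<comment> \<open>Convexity is used with the gradient at the later time, which bounds the
      increment of \<open>E\<close> from above.\<close>
    have "0 \<le> (LINT x|I01. (p ?t x - p ?s x)\<^sup>2)" by simp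
    then have "E ?s \<le> E ?t + 2 * \<bar>ip (U ?s) (B ?s) - ip (U ?t) (B ?s)\<bar>"
      unfolding ediff[OF t(2) t(2)] using abs_ge_self[of "ip (U ?s) (B ?s) - ip (U ?t) (B ?s)"] by argo
    also have "2 * \<bar>ip (U ?s) (B ?s) - ip (U ?t) (B ?s)\<bar> \<le> ?l * D ?s + (?s - ?t) / ?l * (\<Phi> ?s - \<Phi> ?t)"
      by (rule young) (use tT o t(2) l0 in \<open>auto intro: less_imp_le\<close>)
    also have "(?s - ?t) / ?l * (\<Phi> ?s - \<Phi> ?t) \<le> 3 * (\<Phi> ?s - \<Phi> ?t)"
    proof (rule mult_right_mono)
      have "?s - ?t \<le> 3 * ?l" using tc[of n] tc[of "Suc n"] cl[of n] by simp
      then show "(?s - ?t) / ?l \<le> 3" using l0[of "Suc n"] by (simp add: divide_le_eq)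
      show "0 \<le> \<Phi> ?s - \<Phi> ?t" using \<Phi>mono[of ?t ?s] tT o by (simp add: less_imp_le)
    qed
    also have "?l * D ?s \<le> \<Phi> (c (Suc (Suc n))) - \<Phi> (c (Suc n)) + (1/2) ^ Suc n"
      using t(3)[of "Suc n"] by (simp add: mult.commute)
    finally show ?thesis by (simp add: X_def)
  qed
  have c\<Phi>: "convergent (\<lambda>n. \<Phi> (f n))" if "\<And>n. 0 \<le> f n" "\<And>n. f n \<le> f (Suc n)" "\<And>n. f n \<le> T" for f :: "nat \<Rightarrow> real"
  proof (rule Bseq_mono_convergent)
    show "Bseq (\<lambda>n. \<Phi> (f n))" by (rule BseqI'[of _ "\<Phi> T"]) (use \<Phi>0 \<Phi>mono that in simp)
    show "\<forall>m n. m \<le> n \<longrightarrow> \<Phi> (f m) \<le> \<Phi> (f n)"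
      by (intro allI impI \<Phi>mono[OF that(1) lift_Suc_mono_le[of f, OF that(2)] that(3)])
  qed
  have c\<Phi>c: "convergent (\<lambda>n. \<Phi> (c n))"
    using c0(2)[THEN less_imp_le] cl(1) l0[THEN less_imp_le] by (intro c\<Phi> c0) auto
  have c\<Phi>t: "convergent (\<lambda>n. \<Phi> (t n))"
    by (intro c\<Phi> tmono tT[THEN less_imp_le]) simp
  have conv: "convergent (\<lambda>n. E (t n))"
  proof -
    have "- 4 * \<Phi> T \<le> X n" for n
    proof -
      have "0 \<le> E (t n)" by (simp add: E_def)
      moreover have "\<Phi> (c (Suc n)) \<le> \<Phi> T" "\<Phi> (t n) \<le> \<Phi> T" 
        by (intro \<Phi>mono c0 c0(2)[THEN less_imp_le] tT[THEN less_imp_le] order_refl)+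
      moreover have "0 \<le> (1/2::real) ^ Suc n" by simp
      ultimately show ?thesis unfolding X_def by linarith
    qed
    then have "\<forall>n. - 4 * \<Phi> T \<le> X n" ..
    moreover have "decseq X" using Xstep by (simp add: decseq_Suc_iff)
    ultimately obtain L where "X \<longlonglongrightarrow> L" using decseq_convergent by blast
    then have "(\<lambda>n. X n + \<Phi> (c (Suc n)) + 3 * \<Phi> (t n) - 2 * (1/2) ^ Suc n)
        \<longlonglongrightarrow> L + lim (\<lambda>n. \<Phi> (c n)) + 3 * lim (\<lambda>n. \<Phi> (t n)) - 2 * 0"
      by (intro tendsto_intros LIMSEQ_Suc[where f = "\<lambda>n. \<Phi> (c n)"] c\<Phi>c[unfolded convergent_LIMSEQ_iff]
          c\<Phi>t[unfolded convergent_LIMSEQ_iff] LIMSEQ_Suc[where f = "\<lambda>n. (1/2) ^ n"] LIMSEQ_power_zero) auto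
    moreover have "(\<lambda>n. X n + \<Phi> (c (Suc n)) + 3 * \<Phi> (t n) - 2 * (1/2) ^ Suc n) = (\<lambda>n. E (t n))"
      by (rule ext) (simp add: X_def)
    ultimately show ?thesis by (metis convergentI)
  qed
  define Z where "Z n = E (t n) + \<Phi> (t n)" for n
  define \<epsilon> where "\<epsilon> n = 2 * (\<Phi> (c (Suc n)) - \<Phi> (c n) + (1/2) ^ n)" for n
  have "convergent Z" unfolding Z_def[abs_def] by (intro convergent_add conv c\<Phi>t)
  have \<epsilon>: "\<epsilon> \<longlonglongrightarrow> 0"
  proof -
    obtain L where L: "(\<lambda>n. \<Phi> (c n)) \<longlonglongrightarrow> L" using c\<Phi>c by (auto simp: convergent_def)
    have "(\<lambda>n. (1/2::real) ^ n) \<longlonglongrightarrow> 0" by real_asymp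
    have "\<epsilon> \<longlonglongrightarrow> 2 * (L - L + 0)"
      unfolding \<epsilon>_def[abs_def] by (intro tendsto_intros LIMSEQ_Suc[OF L] L \<open>(\<lambda>n. (1/2::real) ^ n) \<longlonglongrightarrow> 0\<close>)
    then show ?thesis by simp
  qed
  \<comment> \<open>Young's inequality is used with \<open>2 * l n\<close>, the time left after
    \<open>c n\<close>: it bounds \<open>t m - t n\<close> for all later \<open>m\<close> at once,
    so the estimate is uniform in \<open>m\<close>. Here the gradient is taken at the earlier
    time.\<close>
  have diff: "(LINT x|I01. (p (t m) x - p (t n) x)\<^sup>2) \<le> \<bar>Z m - Z n\<bar> + \<epsilon> n" if "n \<le> m" for m n
  proof -
    let ?d = "ip (U (t m)) (B (t n)) - ip (U (t n)) (B (t n))"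
    have o: "t n \<le> t m" by (rule tmono[OF that])
    have "2 * \<bar>?d\<bar> \<le> 2 * l n * D (t n) + (t m - t n) / (2 * l n) * (\<Phi> (t m) - \<Phi> (t n))"
      by (rule young) (use tT o t(2) l0 in \<open>auto intro: less_imp_le\<close>)
    also have "(t m - t n) / (2 * l n) * (\<Phi> (t m) - \<Phi> (t n)) \<le> 1 * (\<Phi> (t m) - \<Phi> (t n))"
    proof (rule mult_right_mono)
      have "t m - t n \<le> 2 * l n" using tc[of n] tT[of m] cl(2)[of n] by linarith
      then show "(t m - t n) / (2 * l n) \<le> 1" using l0[of n] by (simp add: divide_le_eq)
      show "0 \<le> \<Phi> (t m) - \<Phi> (t n)" using \<Phi>mono[of "t n" "t m"] tT o by (simp add: less_imp_le)
    qed
    also have "2 * l n * D (t n) \<le> \<epsilon> n" using t(3)[of n] by (simp add: \<epsilon>_def mult_ac)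
    finally have "2 * \<bar>?d\<bar> \<le> \<epsilon> n + (\<Phi> (t m) - \<Phi> (t n))" by simp
    then show ?thesis unfolding ediff[OF t(2) t(2)] Z_def
      using abs_ge_minus_self[of ?d] abs_ge_self[of "E (t m) + \<Phi> (t m) - (E (t n) + \<Phi> (t n))"] by argo
  qed
  have Cauchy: "\<exists>N. \<forall>m\<ge>N. \<forall>n\<ge>N. (LINT x|I01. (p (t m) x - p (t n) x)\<^sup>2) < e" if "0 < e" for e
  proof -
    obtain N1 where N1: "\<bar>Z m - Z n\<bar> < e / 2" if "m \<ge> N1" "n \<ge> N1" for m n
      using CauchyD[OF convergent_Cauchy[OF \<open>convergent Z\<close>], of "e / 2"] \<open>0 < e\<close> by (auto simp: real_norm_def)
    obtain N2 where N2: "\<epsilon> n < e / 2" if "n \<ge> N2" for n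
      using order_tendstoD(2)[OF \<epsilon>, of "e / 2"] \<open>0 < e\<close> by (auto simp: eventually_sequentially)
    have less: "(LINT x|I01. (p (t m) x - p (t n) x)\<^sup>2) < e" if "n \<le> m" "max N1 N2 \<le> n" for m n
      using diff[OF that(1)] N1[of m n] N2[of n] that by simp
    show ?thesis
    proof (intro exI allI impI)
      fix m n assume "max N1 N2 \<le> m" "max N1 N2 \<le> n"
      then show "(LINT x|I01. (p (t m) x - p (t n) x)\<^sup>2) < e"
        using less[of n m] less[of m n] by (cases "n \<le> m") (simp_all add: power2_commute)
    qed
  qed
  have psq: "sqint I01 (p (t n))" for n using t(2)[of n] regularD(6) unfolding P_def by blast
  obtain g where g: "sqint I01 g" "(\<lambda>n. l2norm I01 (\<lambda>x. p (t n) x - g x)) \<longlonglongrightarrow> 0"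
    using Riesz_Fischer[of I01 "\<lambda>n. p (t n)", OF psq Cauchy] by blast
  have UT: "U T \<in> L2w a" using UX T by simp
  have tlim: "t \<longlonglongrightarrow> T"
  proof (rule tendsto_sandwich[OF always_eventually always_eventually _ tendsto_const])
    show "\<forall>n. c n \<le> t n" "\<forall>n. t n \<le> T" using tc(1)[THEN less_imp_le] tT(2)[THEN less_imp_le] by auto
    show "c \<longlonglongrightarrow> T" unfolding c_def[abs_def] by real_asymp
  qed
  have Ulim: "(\<lambda>n. l2norm I01 (\<lambda>x. U (t n) x - U T x)) \<longlonglongrightarrow> 0"
  proof -
    obtain K where K: "\<And>f. f \<in> L2w a \<Longrightarrow> l2norm I01 f \<le> K * L2w_norm a f" using l2norm_le_L2w_norm by blast
    have "filterlim t (at T within {0..T}) sequentially"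
      unfolding filterlim_at using tlim tT[THEN less_imp_le] tT(2)[THEN less_imp_neq] by (auto intro!: always_eventually)
    moreover have "((\<lambda>\<tau>. L2w_norm a (\<lambda>x. U \<tau> x - U T x)) \<longlongrightarrow> 0) (at T within {0..T})"
      using H T by (simp add: bochner_H1_def)
    ultimately have "(\<lambda>n. L2w_norm a (\<lambda>x. U (t n) x - U T x)) \<longlonglongrightarrow> 0" by (rule filterlim_compose[rotated])
    then have lim: "(\<lambda>n. K * L2w_norm a (\<lambda>x. U (t n) x - U T x)) \<longlonglongrightarrow> 0" by (rule tendsto_mult_right_zero)
    show ?thesis
    proof (rule Lim_null_comparison[OF always_eventually lim], rule allI)
      fix n
      have "U (t n) \<in> L2w a" by (intro UX tT[THEN less_imp_le])
      from K[OF L2w_diff[OF this UT]]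
      show "norm (l2norm I01 (\<lambda>x. U (t n) x - U T x)) \<le> K * L2w_norm a (\<lambda>x. U (t n) x - U T x)" by simp
    qed
  qed
  have "H10_deriv (U T) g"
  proof (rule H10_deriv_limit[OF _ L2w_sqint(1)[OF UT] g(1) Ulim g(2)])
    show "H10_deriv (U (t n)) (p (t n))" for n using t(2)[of n] regularD(2) unfolding P_def by blast
  qed
  then show thesis by (rule that)
qed

end

section \<open>The Carleman estimate\<close>

lemma integrable_slices_mult:
  fixes v g :: "real \<Rightarrow> real \<Rightarrow> real"
  assumes V': "sqint lborel V'" "\<And>z. z \<notin> {0<..<1} \<times> {0<..<T} \<Longrightarrow> V' z = 0"
      "AE t in lebesgue_on {0<..<T}. AE x in I01. V' (x, t) = v t x"
    and G': "sqint lborel G'" "AE t in lebesgue_on {0<..<T}. AE x in I01. G' (x, t) = g t x"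
  shows "integrable (lebesgue_on {0<..<T}) (\<lambda>t. LINT x|I01. v t x * g t x)"
proof -
  let ?h = "\<lambda>t. LINT x|lborel. V' (x, t) * G' (x, t)"
  have m: "V' \<in> borel_measurable borel" "G' \<in> borel_measurable borel" using V'(1) G'(1) by (auto simp: sqint_def)
  have i: "integrable lborel ?h" by (rule integral_lborel_prod(2)[OF sqint_mult_integrable[OF V'(1) G'(1)]])
  then have "integrable lebesgue ?h" by (subst integrable_completion) auto
  then have "integrable lebesgue (\<lambda>t. indicator {0<..<T} t *\<^sub>R ?h t)" by (intro integrable_mult_indicator) auto
  then have ih: "integrable (lebesgue_on {0<..<T}) ?h" by (simp add: integral_lebesgue_on_eq)
  have eq: "AE t in lebesgue_on {0<..<T}. ?h t = (LINT x|I01. v t x * g t x)"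
    using V'(3) G'(2)
  proof eventually_elim
    case (elim t)
    show ?case
    proof (rule integral_slice(1))
      show "(\<lambda>x. V' (x, t) * G' (x, t)) \<in> borel_measurable borel"
        by (rule borel_measurable_times[OF slice_measurable[OF m(1)] slice_measurable[OF m(2)]])
      show "V' (x, t) * G' (x, t) = 0" if "x \<notin> {0<..<1}" for x using V'(2) that by auto
      show "AE x in I01. V' (x, t) * G' (x, t) = v t x * g t x" using elim by eventually_elim simp
    qed
  qed
  have "(\<lambda>t. LINT x|I01. v t x * g t x) \<in> borel_measurable (lebesgue_on {0<..<T})"
    by (rule borel_measurable_lebesgue_on_AE[OF _ borel_measurable_integrable[OF ih] eq]) simp
  then show ?thesis using integrable_cong_AE[OF borel_measurable_integrable[OF ih] _ eq] ih by blast
qed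

lemma exists_sqint_representative:
  fixes v :: "real \<Rightarrow> real \<Rightarrow> real"
  assumes v: "(\<lambda>(x, t). v x t) \<in> borel_measurable (cyl T)"
    and bnd: "AE t in lebesgue_on {0<..<T}. sqint I01 (\<lambda>x. v x t) \<and> (LINT x|I01. (v x t)\<^sup>2) \<le> M t"
    and M: "(\<integral>\<^sup>+t. ennreal (M t) \<partial>lebesgue_on {0<..<T}) < \<infinity>"
  obtains v' where "sqint lborel v'" "\<And>z. z \<notin> {0<..<1} \<times> {0<..<T} \<Longrightarrow> v' z = 0"
    "AE t in lebesgue_on {0<..<T}. AE x in I01. v' (x, t) = v x t"
proof -
  obtain v' where v': "v' \<in> borel_measurable borel" "\<And>z. z \<notin> {0<..<1} \<times> {0<..<T} \<Longrightarrow> v' z = 0"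
    "AE t in lebesgue_on {0<..<T}. AE x in I01. v' (x, t) = v x t"
    by (rule exists_Borel_representative[OF v]) blast
  show thesis by (rule that[OF sqint_Borel_representative[OF v' bnd M] v'(2,3)])
qed

lemma integrable_lebesgue_on_continuous_mult:
  fixes w h :: "real \<Rightarrow> real"
  assumes w: "continuous_on {0..T} w" and h: "integrable (lebesgue_on {0<..<T}) h"
  shows "integrable (lebesgue_on {0<..<T}) (\<lambda>t. w t * h t)"
proof -
  have "compact (w ` {0..T})" using w by (intro compact_continuous_image) auto
  then obtain K where K: "\<forall>y\<in>w ` {0..T}. norm y \<le> K" using compact_imp_bounded bounded_iff by metis
  have m: "(\<lambda>t. indicator {0..T} t * w t) \<in> borel_measurable (lebesgue_on {0<..<T})"
    using borel_measurable_continuous_on_indicator[OF _ w] by (intro borel_measurable_lebesgue_onI) simp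
  have m': "w \<in> borel_measurable (lebesgue_on {0<..<T})"
    using m by (rule measurable_cong[THEN iffD1, rotated]) (simp add: indicator_def)
  show ?thesis
  proof (rule Bochner_Integration.integrable_bound[of _ "\<lambda>t. K * h t"])
    show "integrable (lebesgue_on {0<..<T}) (\<lambda>t. K * h t)" using h by simp
    show "(\<lambda>t. w t * h t) \<in> borel_measurable (lebesgue_on {0<..<T})"
      by (intro borel_measurable_times m' borel_measurable_integrable[OF h])
    show "AE t in lebesgue_on {0<..<T}. norm (w t * h t) \<le> norm (K * h t)"
    proof (rule AE_I2)
      fix t assume "t \<in> space (lebesgue_on {0<..<T})"
      then have "\<bar>w t\<bar> \<le> K" using K by simp
      then have "\<bar>w t\<bar> \<le> \<bar>K\<bar>" by simp
      then show "norm (w t * h t) \<le> norm (K * h t)" by (simp add: abs_mult mult_right_mono)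
    qed
  qed
qed

section \<open>The two energies of a strong solution\<close>

locale strong_solution = weight +
  fixes T :: real and u ut ux uxx :: "real \<Rightarrow> real \<Rightarrow> real"
  assumes T: "0 < T" and strong: "strong_fun a T u ut ux uxx"
begin

abbreviation "U t \<equiv> (\<lambda>x. u x t)"
abbreviation "V t \<equiv> (\<lambda>x. ut x t)"
abbreviation "B t \<equiv> (\<lambda>x. - (a x * uxx x t))"
abbreviation "J t \<equiv> (LINT x|I01. (ux x t)\<^sup>2)"
abbreviation "timeM \<equiv> lebesgue_on {0<..<T}"

lemma H1: "bochner_H1 T (L2w a) (L2w_norm a) U V"
  using strong by (simp add: strong_fun_def)

lemma AE_regular: "AE t in timeM. regular (U t) (\<lambda>x. ux x t) (\<lambda>x. uxx x t)
    \<and> (H2w_norm a (U t))\<^sup>2 = (L2w_norm a (U t))\<^sup>2 + J t + (L2w_norm a (B t))\<^sup>2"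
proof -
  have "AE t in timeM. U t \<in> H2w a" "AE t in timeM. weak_deriv 0 1 (U t) (\<lambda>x. ux x t) \<and> weak_deriv 0 1 (\<lambda>x. ux x t) (\<lambda>x. uxx x t)"
    using strong by (simp_all add: strong_fun_def bochner_L2_def strongly_measurable_in_def)
  then show ?thesis
  proof eventually_elim
    case (elim t)
    have "(L2w_norm a (B t))\<^sup>2 = (LINT x|I01. (sqrt (a x) * uxx x t)\<^sup>2)"
      unfolding L2w_norm_eq l2norm_power2
    proof (rule Bochner_Integration.integral_cong[OF refl])
      fix x assume "x \<in> space I01"
      then show "(wt (B t) x)\<^sup>2 = (sqrt (a x) * uxx x t)\<^sup>2"
        using wt_a_mult[of x "\<lambda>x. uxx x t"] by (simp add: wt_def)
    qed
    then show ?case using regular_H2w[OF elim(1), of "\<lambda>x. ux x t" "\<lambda>x. uxx x t"] elim(2) by simp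
  qed
qed

lemma AE_V: "AE t in timeM. V t \<in> L2w a"
  using H1 by (simp add: bochner_H1_def bochner_L2_def strongly_measurable_in_def)

lemma U_L2w: "t \<in> {0..T} \<Longrightarrow> U t \<in> L2w a"
  using H1 by (simp add: bochner_H1_def)

lemma AE_time: "AE t in timeM. 0 < t \<and> t < T"
  by (rule AE_I2) simp

lemma a_measurable_cyl: "(\<lambda>(x, t). a x) \<in> borel_measurable (cyl T)"
proof -
  have "(\<lambda>x. indicator {0..1} x * a x) \<in> borel_measurable borel"
    using borel_measurable_continuous_on_indicator[OF _ cont] by simp
  then have "(\<lambda>z :: real \<times> real. indicator {0..1} (fst z) * a (fst z)) \<in> borel_measurable borel"
    by (rule measurable_compose[rotated]) (simp add: borel_prod[symmetric])
  then have "(\<lambda>z. indicator {0..1} (fst z) * a (fst z)) \<in> borel_measurable (cyl T)"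
    by (rule borel_measurable_lebesgue_onI)
  then show ?thesis
    by (rule measurable_cong[THEN iffD1, rotated]) (auto simp: indicator_def)
qed

lemma u_measurable_cyl:
  "(\<lambda>(x, t). u x t) \<in> borel_measurable (cyl T)" "(\<lambda>(x, t). ut x t) \<in> borel_measurable (cyl T)"
  "(\<lambda>(x, t). ux x t) \<in> borel_measurable (cyl T)" "(\<lambda>(x, t). uxx x t) \<in> borel_measurable (cyl T)"
  using strong by (simp_all add: strong_fun_def)

lemma wt_measurable_cyl:
  assumes "(\<lambda>(x, t). v x t) \<in> borel_measurable (cyl T)"
  shows "(\<lambda>(x, t). wt (\<lambda>x. v x t) x) \<in> borel_measurable (cyl T)"
proof -
  have "(\<lambda>z. (\<lambda>(x, t). v x t) z / sqrt ((\<lambda>(x, t). a x) z)) \<in> borel_measurable (cyl T)"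
    by (intro borel_measurable_divide assms measurable_compose[OF a_measurable_cyl borel_measurable_sqrt])
  moreover have "(\<lambda>z. (\<lambda>(x, t). v x t) z / sqrt ((\<lambda>(x, t). a x) z)) = (\<lambda>(x, t). wt (\<lambda>x. v x t) x)"
    by (auto simp: fun_eq_iff wt_def)
  ultimately show ?thesis by simp
qed

lemma B_measurable_cyl: "(\<lambda>(x, t). B t x) \<in> borel_measurable (cyl T)"
proof -
  have "(\<lambda>z. - ((\<lambda>(x, t). a x) z * (\<lambda>(x, t). uxx x t) z)) \<in> borel_measurable (cyl T)"
    by (intro borel_measurable_uminus borel_measurable_times a_measurable_cyl u_measurable_cyl)
  moreover have "(\<lambda>z. - ((\<lambda>(x, t). a x) z * (\<lambda>(x, t). uxx x t) z)) = (\<lambda>(x, t). B t x)" by auto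
  ultimately show ?thesis by simp
qed

text \<open>The three properties that \<open>energy_balance\<close> asks of \<open>V'\<close>,
  stated for an arbitrary family of slices.\<close>

definition represents :: "(real \<times> real \<Rightarrow> real) \<Rightarrow> (real \<Rightarrow> real \<Rightarrow> real) \<Rightarrow> bool" where
  "represents v' v \<longleftrightarrow> sqint lborel v' \<and> (\<forall>z. z \<notin> {0<..<1} \<times> {0<..<T} \<longrightarrow> v' z = 0) \<and>
     (AE t in timeM. AE x in I01. v' (x, t) = v t x)"

lemma representsD:
  assumes "represents v' v"
  shows "sqint lborel v'" "\<And>z. z \<notin> {0<..<1} \<times> {0<..<T} \<Longrightarrow> v' z = 0"
    "AE t in timeM. AE x in I01. v' (x, t) = v t x"
  using assms unfolding represents_def by blast+

lemma represents_integrable: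
  assumes v: "represents v' v" and g: "represents g' g"
  shows "integrable timeM (\<lambda>t. LINT x|I01. v t x * g t x)"
  by (rule integrable_slices_mult[OF representsD[OF v] representsD(1,3)[OF g]])

lemma exists_representatives:
  shows "\<exists>v'. represents v' (\<lambda>t. wt (V t))" "\<exists>v'. represents v' (\<lambda>t. wt (U t))"
    "\<exists>v'. represents v' (\<lambda>t x. ux x t)" "\<exists>v'. represents v' (\<lambda>t. wt (B t))"
proof -
  have fin: "(\<integral>\<^sup>+t. ennreal ((L2w_norm a (V t))\<^sup>2) \<partial>timeM) < \<infinity>"
    "(\<integral>\<^sup>+t. ennreal ((H2w_norm a (U t))\<^sup>2) \<partial>timeM) < \<infinity>"
    using strong by (simp_all add: strong_fun_def bochner_H1_def bochner_L2_def)
  have ex: "\<exists>v'. represents v' v" if "(\<lambda>(x, t). v t x) \<in> borel_measurable (cyl T)"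
    "AE t in timeM. sqint I01 (v t) \<and> (LINT x|I01. (v t x)\<^sup>2) \<le> M t"
    "(\<integral>\<^sup>+t. ennreal (M t) \<partial>timeM) < \<infinity>" for v M
    by (rule exists_sqint_representative[OF that(1), of M]) (use that(2,3) in \<open>auto simp: represents_def\<close>)
  have sq: "(LINT x|I01. (wt f x)\<^sup>2) = (L2w_norm a f)\<^sup>2" for f by (simp add: L2w_norm_eq l2norm_power2)
  show "\<exists>v'. represents v' (\<lambda>t. wt (V t))"
    by (rule ex[OF wt_measurable_cyl[OF u_measurable_cyl(2)] _ fin(1)])
      (use AE_V in eventually_elim, simp add: sq L2w_sqint)
  show "\<exists>v'. represents v' (\<lambda>t. wt (U t))"
  proof (rule ex[OF wt_measurable_cyl[OF u_measurable_cyl(1)] _ fin(2)], use AE_regular in eventually_elim)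
    case (elim t)
    then have "U t \<in> L2w a" by (blast intro: regularD(1))
    then show ?case using elim by (simp add: sq L2w_sqint)
  qed
  show "\<exists>v'. represents v' (\<lambda>t x. ux x t)"
  proof (rule ex[OF u_measurable_cyl(3) _ fin(2)], use AE_regular in eventually_elim)
    case (elim t)
    then have "sqint I01 (\<lambda>x. ux x t)" by (blast intro: regularD(6))
    moreover have "J t \<le> (H2w_norm a (U t))\<^sup>2" using elim by simp
    ultimately show ?case by simp
  qed
  show "\<exists>v'. represents v' (\<lambda>t. wt (B t))"
  proof (rule ex[OF wt_measurable_cyl[OF B_measurable_cyl] _ fin(2)], use AE_regular in eventually_elim)
    case (elim t)
    have "B t \<in> L2w a" by (rule regularD(5)[OF conjunct1[OF elim]])
    then show ?case using elim by (simp add: sq L2w_sqint)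
  qed
qed

text \<open>The integrability, and already the measurability in time, of these quantities comes from
  Fubini's theorem for products of square integrable representatives.\<close>

lemma time_integrable:
  "integrable timeM J" "integrable timeM (\<lambda>t. ip (U t) (U t))" "integrable timeM (\<lambda>t. ip (V t) (V t))"
  "integrable timeM (\<lambda>t. ip (B t) (B t))" "integrable timeM (\<lambda>t. ip (V t) (B t))" "integrable timeM (\<lambda>t. ip (V t) (U t))"
proof -
  obtain v' u' p' b' where "represents v' (\<lambda>t. wt (V t))" "represents u' (\<lambda>t. wt (U t))"
    "represents p' (\<lambda>t x. ux x t)" "represents b' (\<lambda>t. wt (B t))" using exists_representatives by blast
  note R = represents_integrable[OF this(3,3)] represents_integrable[OF this(2,2)] represents_integrable[OF this(1,1)]
    represents_integrable[OF this(4,4)] represents_integrable[OF this(1,4)] represents_integrable[OF this(1,2)]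
  show "integrable timeM J" using R(1) by (simp add: power2_eq_square)
  show "integrable timeM (\<lambda>t. ip (U t) (U t))" "integrable timeM (\<lambda>t. ip (V t) (V t))"
  "integrable timeM (\<lambda>t. ip (B t) (B t))" "integrable timeM (\<lambda>t. ip (V t) (B t))" "integrable timeM (\<lambda>t. ip (V t) (U t))"
    using R(2-6) unfolding ip_eq by blast+
qed

lemma ip_nonneg: "0 \<le> ip f f"
  unfolding L2w_norm_power2[symmetric] by simp

lemma trace: obtains g where "H10_deriv (U T) g"
proof (rule regular_trace[OF T H1, of "\<lambda>t. ip (V t) (V t) + ip (B t) (B t)" "\<lambda>t x. ux x t" "\<lambda>t x. uxx x t"])
  show "integrable timeM (\<lambda>t. ip (V t) (V t) + ip (B t) (B t))" using time_integrable by simp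
  show "0 \<le> ip (V t) (V t) + ip (B t) (B t)" for t using ip_nonneg by (simp add: add_nonneg_nonneg)
  show "AE t in timeM. (L2w_norm a (V t))\<^sup>2 \<le> ip (V t) (V t) + ip (B t) (B t)"
    "AE t in timeM. (L2w_norm a (B t))\<^sup>2 \<le> ip (V t) (V t) + ip (B t) (B t)"
    using ip_nonneg by (auto simp: L2w_norm_power2)
  show "AE t in timeM. regular (U t) (\<lambda>x. ux x t) (\<lambda>x. uxx x t)" using AE_regular by eventually_elim simp
qed

text \<open>The trace provides a gradient of \<open>U T\<close>, so convexity can compare the
  interior times with the final one; uniqueness then rewrites its energy in terms of
  \<open>wderiv\<close>, the form in which the norm at \<open>T\<close> is defined.\<close>

lemma gradient_energy:
  assumes \<psi>: "\<And>t. (\<psi> has_real_derivative \<psi>' t) (at t)" "continuous_on {0..T} \<psi>'" "\<And>t. t \<in> {0..T} \<Longrightarrow> 0 \<le> \<psi> t"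
  shows "(LINT t|timeM. \<psi>' t * J t) + 2 * (LINT t|timeM. \<psi> t * ip (V t) (B t))
    \<le> \<psi> T * (LINT x|I01. (wderiv (U T) x)\<^sup>2)"
proof -
  obtain v' b' where v': "represents v' (\<lambda>t. wt (V t))" and b': "represents b' (\<lambda>t. wt (B t))"
    using exists_representatives by blast
  obtain g where g: "H10_deriv (U T) g" by (rule trace)
  have UT: "U T \<in> L2w a" using U_L2w T by simp
  have "(LINT t|timeM. \<psi>' t * J t) + 2 * (LINT t|timeM. \<psi> t * ip (V t) (B t)) \<le> \<psi> T * (LINT x|I01. (g x)\<^sup>2)"
  proof (rule energy_balance[OF T H1 representsD[OF v'] representsD(1,3)[OF b'] time_integrable(1) _ _ _ _ _ _ \<psi>,
        where P = "\<lambda>t. regular (U t) (\<lambda>x. ux x t) (\<lambda>x. uxx x t)"])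
    show "AE t in timeM. regular (U t) (\<lambda>x. ux x t) (\<lambda>x. uxx x t)" using AE_regular by eventually_elim simp
    show "B t \<in> L2w a" if "regular (U t) (\<lambda>x. ux x t) (\<lambda>x. uxx x t)" for t by (rule regularD(5)[OF that])
    show "2 * (ip (U s) (B t) - ip (U t) (B t)) \<le> J s - J t"
      if "regular (U s) (\<lambda>x. ux x s) (\<lambda>x. uxx x s)" "regular (U t) (\<lambda>x. ux x t) (\<lambda>x. uxx x t)" for s t
      by (rule regular_convexity[OF that(2) regularD(1,2)[OF that(1)]])
    show "2 * (ip (U T) (B t) - ip (U t) (B t)) \<le> (LINT x|I01. (g x)\<^sup>2) - J t"
      if "regular (U t) (\<lambda>x. ux x t) (\<lambda>x. uxx x t)" for t
      by (rule regular_convexity[OF that UT g])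
  qed simp_all
  then show ?thesis unfolding wderiv_square_integral[OF H10_deriv_weak_deriv[OF g]] .
qed

lemma weighted_energy:
  assumes \<psi>: "\<And>t. (\<psi> has_real_derivative \<psi>' t) (at t)" "continuous_on {0..T} \<psi>'" "\<And>t. t \<in> {0..T} \<Longrightarrow> 0 \<le> \<psi> t"
  shows "(LINT t|timeM. \<psi>' t * ip (U t) (U t)) + 2 * (LINT t|timeM. \<psi> t * ip (V t) (U t)) \<le> \<psi> T * ip (U T) (U T)"
proof -
  obtain v' u' where v': "represents v' (\<lambda>t. wt (V t))" and u': "represents u' (\<lambda>t. wt (U t))"
    using exists_representatives by blast
  have UT: "U T \<in> L2w a" using U_L2w T by simp
  show ?thesis
  proof (rule energy_balance[OF T H1 representsD[OF v'] representsD(1,3)[OF u'] time_integrable(2) ip_nonneg ip_nonneg _ _ _ _ \<psi>,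
        where P = "\<lambda>t. U t \<in> L2w a"])
    show "AE t in timeM. U t \<in> L2w a" using AE_regular by eventually_elim (blast intro: regularD(1))
    show "2 * (ip (U s) (U t) - ip (U t) (U t)) \<le> ip (U s) (U s) - ip (U t) (U t)"
      if "U s \<in> L2w a" "U t \<in> L2w a" for s t by (rule ip_convexity[OF that(2,1)])
    show "2 * (ip (U T) (U t) - ip (U t) (U t)) \<le> ip (U T) (U T) - ip (U t) (U t)"
      if "U t \<in> L2w a" for t by (rule ip_convexity[OF that UT])
  qed
qed

text \<open>Here \<open>\<beta> + 2 p M + p\<^sup>2 N\<close> and \<open>\<alpha> + 2 p E + p\<^sup>2 N\<close> stand for the squared norms of \<open>u\<^sub>t + p u\<close> and
  \<open>a u\<^sub>x\<^sub>x - p u\<close>, and \<open>\<beta> - 2 K + \<alpha>\<close> for that of \<open>F\<close>.\<close>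

lemma slice_inequality:
  fixes \<alpha> \<beta> E K M N e p \<rho> l :: real
  assumes nonneg: "0 \<le> \<alpha>" "0 \<le> E" "0 \<le> N" "0 \<le> e" "0 \<le> p" and "e \<le> \<rho>" and \<rho>: "l * \<rho> = p * e"
    and sq: "0 \<le> \<beta> + 2 * p * M + p\<^sup>2 * N" "0 \<le> \<beta> + 4 * p * M + 4 * p\<^sup>2 * N"
  shows "e * (\<beta> + \<alpha> + p * E + p\<^sup>2 * N)
    \<le> 3 * (\<rho> * (\<beta> - 2 * K + \<alpha>) + 2 * (\<rho> * K) + 2 * (\<rho> * p * M) + (l * \<rho> + 2 * p * \<rho>) * E + (2 * l * \<rho> * p + 2 * p\<^sup>2 * \<rho>) * N)"
proof -
  define X where "X = \<beta> + 2 * p * M + p\<^sup>2 * N"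
  define Y where "Y = \<alpha> + 2 * p * E + p\<^sup>2 * N"
  \<comment> \<open>Recovers \<open>u_t\<close> from \<open>u_t + p u\<close>: the difference
    \<open>2 X + 2 p^2 N - \<beta>\<close> is the squared norm of \<open>u_t + 2 p u\<close>, whose
    nonnegativity is the second part of \<open>sq\<close>.\<close>
  have X: "0 \<le> X" "\<beta> \<le> 2 * X + 2 * p\<^sup>2 * N" using sq by (simp_all add: X_def algebra_simps)
  have Y: "0 \<le> Y" "\<alpha> \<le> 2 * Y + 2 * p\<^sup>2 * N" using nonneg by (simp_all add: Y_def)
  have pe: "0 \<le> p * e * E" "0 \<le> p\<^sup>2 * e * N" using nonneg by simp_all
  have "e * (\<beta> + \<alpha> + p * E + p\<^sup>2 * N) \<le> e * ((2 * X + 2 * p\<^sup>2 * N) + (2 * Y + 2 * p\<^sup>2 * N) + p * E + p\<^sup>2 * N)"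
    using X Y nonneg by (intro mult_left_mono add_mono) auto
  also have "\<dots> = 2 * (e * (X + Y)) + p * e * E + 5 * (p\<^sup>2 * e * N)" by (simp add: algebra_simps)
  \<comment> \<open>The coefficients 2, 1 and 5 are raised to 3, 3 and 6. This is the proportion on
    the right-hand side, where the surplus is \<open>l * \<rho> * E = p e E\<close> and
    \<open>2 * l * \<rho> * p * N = 2 p^2 e N\<close>; it is the origin of the constant 3.\<close>
  also have "\<dots> \<le> 3 * (\<rho> * (X + Y)) + 3 * (p * e * E) + 6 * (p\<^sup>2 * e * N)"
  proof -
    have "e * (X + Y) \<le> \<rho> * (X + Y)" using \<open>e \<le> \<rho>\<close> X Y by (intro mult_right_mono) auto
    moreover have "0 \<le> \<rho> * (X + Y)" using \<open>e \<le> \<rho>\<close> nonneg X Y by (intro mult_nonneg_nonneg) auto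
    ultimately show ?thesis using pe by linarith
  qed
  also have "\<dots> = 3 * (\<rho> * (X + Y)) + 3 * ((l * \<rho>) * E) + 6 * (p * (l * \<rho>) * N)"
    unfolding \<rho> by (simp add: power2_eq_square)
  also have "\<dots> = 3 * (\<rho> * (\<beta> - 2 * K + \<alpha>) + 2 * (\<rho> * K) + 2 * (\<rho> * p * M) + (l * \<rho> + 2 * p * \<rho>) * E + (2 * l * \<rho> * p + 2 * p\<^sup>2 * \<rho>) * N)"
    unfolding X_def Y_def by (simp add: algebra_simps power2_eq_square)
  finally show ?thesis .
qed

section \<open>Assembling the estimate\<close>

lemma ip_add_multiple_nonneg:
  assumes f: "f \<in> L2w a" and g: "g \<in> L2w a"
  shows "0 \<le> ip f f + 2 * c * ip f g + c\<^sup>2 * ip g g"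
proof -
  have cg: "(\<lambda>x. c * g x) \<in> L2w a" by (rule L2w_cmult[OF g])
  have h: "(\<lambda>x. f x + c * g x) \<in> L2w a" by (rule L2w_add[OF f cg])
  have e: "ip (\<lambda>x. f x + c * g x) k = ip f k + c * ip g k" if "k \<in> L2w a" for k
    using ip_add_left[OF f cg that] by (simp add: ip_cmult_left)
  have "ip (\<lambda>x. f x + c * g x) (\<lambda>x. f x + c * g x) = ip f f + 2 * c * ip f g + c\<^sup>2 * ip g g"
    unfolding e[OF h] ip_commute[of f "\<lambda>x. f x + c * g x"] ip_commute[of g "\<lambda>x. f x + c * g x"] e[OF f] e[OF g]
    by (simp add: ip_commute[of g f] algebra_simps power2_eq_square)
  then show ?thesis using ip_nonneg[of "\<lambda>x. f x + c * g x"] by simp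
qed

text \<open>The pointwise inequality is integrated in time. Apart from the term with
  \<open>F\<close>, its right-hand side is the sum of the left-hand sides of the two energy
  estimates with weights \<open>\<rho>\<close> and \<open>\<eta>\<close>, so only the energies at
  \<open>T\<close> remain.\<close>

lemma Carleman_time_integrals:
  fixes l s :: real
  assumes l: "0 < l" and s: "1 \<le> s"
  defines "\<phi> \<equiv> \<lambda>t. exp (l * t)"
  defines "p \<equiv> \<lambda>t. s * l * \<phi> t" and "e \<equiv> \<lambda>t. exp (2 * s * \<phi> t)"
  defines "f \<equiv> \<lambda>t. ip (V t) (V t) - 2 * ip (V t) (B t) + ip (B t) (B t)"
  defines "\<Psi> \<equiv> \<lambda>t. e t * (ip (V t) (V t) + ip (B t) (B t) + p t * J t + (p t)\<^sup>2 * ip (U t) (U t))"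
  shows "integrable timeM \<Psi>" "integrable timeM (\<lambda>t. s * \<phi> t * e t * f t)"
    "(LINT t|timeM. \<Psi> t) \<le> 3 * (LINT t|timeM. s * \<phi> t * e t * f t)
       + 3 * (s * \<phi> T * e T * ((LINT x|I01. (wderiv (U T) x)\<^sup>2) + p T * ip (U T) (U T)))"
proof -
  note I = time_integrable
  \<comment> \<open>This is the weight of \<open>F\<close> in the estimate. The second weight
    \<open>\<eta>\<close> has the further factor \<open>p\<close> because the cross term of
    \<open>u_t\<close> and \<open>p u\<close> carries it. The formulas for \<open>\<rho>'\<close>
    and \<open>\<eta>'\<close> use that \<open>\<phi>' = l \<phi>\<close>, \<open>p' = l p\<close>
    and \<open>e' = 2 p e\<close>.\<close>
  define \<rho> where "\<rho> t = s * \<phi> t * e t" for t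
  define \<rho>' where "\<rho>' t = l * \<rho> t + 2 * p t * \<rho> t" for t
  define \<eta> where "\<eta> t = \<rho> t * p t" for t
  define \<eta>' where "\<eta>' t = 2 * l * \<rho> t * p t + 2 * (p t)\<^sup>2 * \<rho> t" for t
  note defs = \<rho>_def \<rho>'_def \<eta>_def \<eta>'_def p_def e_def \<phi>_def
  have d\<rho>: "(\<rho> has_real_derivative \<rho>' t) (at t)" for t
    unfolding defs by (auto intro!: derivative_eq_intros simp: algebra_simps)
  have d\<eta>: "(\<eta> has_real_derivative \<eta>' t) (at t)" for t
    unfolding defs by (auto intro!: derivative_eq_intros simp: algebra_simps power2_eq_square)
  have c: "continuous_on {0..T} \<rho>" "continuous_on {0..T} \<rho>'" "continuous_on {0..T} \<eta>" "continuous_on {0..T} \<eta>'"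
    "continuous_on {0..T} e" "continuous_on {0..T} (\<lambda>t. e t * p t)" "continuous_on {0..T} (\<lambda>t. e t * (p t)\<^sup>2)"
    unfolding defs by (intro continuous_intros)+
  have nn: "0 \<le> \<rho> t" "0 \<le> \<eta> t" "0 \<le> p t" "0 \<le> e t" for t using l s by (auto simp: defs)
  note w = integrable_lebesgue_on_continuous_mult
  have if': "integrable timeM f" unfolding f_def using I by simp
  have i\<rho>f: "integrable timeM (\<lambda>t. \<rho> t * f t)" by (rule w[OF c(1) if'])
  then show "integrable timeM (\<lambda>t. s * \<phi> t * e t * f t)" by (simp add: \<rho>_def)
  have "integrable timeM (\<lambda>t. e t * ip (V t) (V t) + e t * ip (B t) (B t) + (e t * p t) * J t + (e t * (p t)\<^sup>2) * ip (U t) (U t))"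
    by (intro Bochner_Integration.integrable_add w[OF c(5)] w[OF c(6)] w[OF c(7)] I)
  then show i\<Psi>: "integrable timeM \<Psi>" by (simp add: \<Psi>_def algebra_simps)
  have A: "(LINT t|timeM. \<rho>' t * J t) + 2 * (LINT t|timeM. \<rho> t * ip (V t) (B t))
    \<le> \<rho> T * (LINT x|I01. (wderiv (U T) x)\<^sup>2)" by (rule gradient_energy[OF d\<rho> c(2) nn(1)])
  have A': "(LINT t|timeM. \<eta>' t * ip (U t) (U t)) + 2 * (LINT t|timeM. \<eta> t * ip (V t) (U t)) \<le> \<eta> T * ip (U T) (U T)"
    by (rule weighted_energy[OF d\<eta> c(4) nn(2)])
  have i4: "integrable timeM (\<lambda>t. \<rho> t * ip (V t) (B t))" "integrable timeM (\<lambda>t. \<eta> t * ip (V t) (U t))"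
    "integrable timeM (\<lambda>t. \<rho>' t * J t)" "integrable timeM (\<lambda>t. \<eta>' t * ip (U t) (U t))"
    by (intro w c I)+
  let ?R = "\<lambda>t. 3 * (\<rho> t * f t + 2 * (\<rho> t * ip (V t) (B t)) + 2 * (\<eta> t * ip (V t) (U t)) + \<rho>' t * J t + \<eta>' t * ip (U t) (U t))"
  have iR: "integrable timeM ?R" using i\<rho>f i4 by simp
  have "(LINT t|timeM. \<Psi> t) \<le> (LINT t|timeM. ?R t)"
  proof (rule integral_mono_AE[OF i\<Psi> iR], use AE_regular AE_V AE_time in eventually_elim)
    case (elim t)
    have Ut: "U t \<in> L2w a" using elim(1) by (blast intro: regularD(1))
    \<comment> \<open>The largeness of \<open>s\<close> enters here: with \<open>1 \<le> s\<close>
      and \<open>1 \<le> \<phi> t\<close> the weight \<open>e t\<close> is at most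
      \<open>\<rho> t\<close>.\<close>
    have "1 \<le> \<phi> t" using elim(3) l by (simp add: \<phi>_def)
    then have "1 * 1 \<le> s * \<phi> t" using s by (intro mult_mono) auto
    then have "e t \<le> \<rho> t" using mult_right_mono[OF _ nn(4)[of t], of 1 "s * \<phi> t"] by (simp add: \<rho>_def)
    moreover have "l * \<rho> t = p t * e t" by (simp add: \<rho>_def p_def)
    moreover have "0 \<le> ip (V t) (V t) + 2 * p t * ip (V t) (U t) + (p t)\<^sup>2 * ip (U t) (U t)"
      by (rule ip_add_multiple_nonneg[OF elim(2) Ut])
    moreover have "0 \<le> ip (V t) (V t) + 4 * p t * ip (V t) (U t) + 4 * (p t)\<^sup>2 * ip (U t) (U t)"
      using ip_add_multiple_nonneg[OF elim(2) Ut, of "2 * p t"] by (simp add: power_mult_distrib)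
    ultimately show ?case
      using slice_inequality[of "ip (B t) (B t)" "J t" "ip (U t) (U t)" "e t" "p t" "\<rho> t" l "ip (V t) (V t)" "ip (V t) (U t)" "ip (V t) (B t)"]
        ip_nonneg nn[of t] unfolding \<Psi>_def f_def \<eta>_def \<eta>'_def \<rho>'_def by simp
  qed
  also have "\<dots> = 3 * ((LINT t|timeM. \<rho> t * f t) + 2 * (LINT t|timeM. \<rho> t * ip (V t) (B t)) + 2 * (LINT t|timeM. \<eta> t * ip (V t) (U t))
      + (LINT t|timeM. \<rho>' t * J t) + (LINT t|timeM. \<eta>' t * ip (U t) (U t)))"
    using i\<rho>f i4 by simp
  also have "\<dots> \<le> 3 * (LINT t|timeM. \<rho> t * f t) + 3 * (\<rho> T * (LINT x|I01. (wderiv (U T) x)\<^sup>2) + \<eta> T * ip (U T) (U T))"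
    using A A' by argo
  also have "\<dots> = 3 * (LINT t|timeM. s * \<phi> t * e t * f t)
       + 3 * (s * \<phi> T * e T * ((LINT x|I01. (wderiv (U T) x)\<^sup>2) + p T * ip (U T) (U T)))"
    by (simp add: \<rho>_def \<eta>_def algebra_simps)
  finally show "(LINT t|timeM. \<Psi> t) \<le> 3 * (LINT t|timeM. s * \<phi> t * e t * f t)
       + 3 * (s * \<phi> T * e T * ((LINT x|I01. (wderiv (U T) x)\<^sup>2) + p T * ip (U T) (U T)))" .
qed

lemma time_function_measurable_cyl:
  fixes w :: "real \<Rightarrow> real"
  assumes "continuous_on UNIV w"
  shows "(\<lambda>(x, t). w t) \<in> borel_measurable (cyl T)"
proof -
  have "(\<lambda>z :: real \<times> real. w (snd z)) \<in> borel_measurable borel"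
    by (rule measurable_compose[OF _ borel_measurable_continuous_onI[OF assms]]) (simp add: borel_prod[symmetric])
  then have "(\<lambda>z. w (snd z)) \<in> borel_measurable (cyl T)" by (rule borel_measurable_lebesgue_onI)
  then show ?thesis by (simp add: case_prod_beta')
qed

text \<open>Tonelli's theorem rewrites the two cylinder integrals as time integrals of slice
  quantities, for which the estimate is known. Under the isometry \<open>wt\<close>, the four terms
  on the left become squares of the representable slices.\<close>

lemma Carleman_estimate:
  fixes l s :: real and F :: "real \<Rightarrow> real \<Rightarrow> real"
  assumes l: "0 < l" and s: "1 \<le> s" and F: "AE (x, t) in cyl T. ut x t + a x * uxx x t = F x t"
  defines "\<phi> \<equiv> \<lambda>t. exp (l * t)"
  shows "(\<integral>\<^sup>+ (x, t). ennreal
          ((1 / a x * \<bar>ut x t\<bar>\<^sup>2 + a x * \<bar>uxx x t\<bar>\<^sup>2 + s * l * \<phi> t * \<bar>ux x t\<bar>\<^sup>2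
             + s\<^sup>2 * l\<^sup>2 * (\<phi> t)\<^sup>2 / a x * \<bar>u x t\<bar>\<^sup>2) * exp (2 * s * \<phi> t)) \<partial>cyl T)
      \<le> ennreal (3 * \<phi> T) *
          (\<integral>\<^sup>+ (x, t). ennreal (s * \<phi> t * (1 / a x) * \<bar>F x t\<bar>\<^sup>2 * exp (2 * s * \<phi> t)) \<partial>cyl T)
        + ennreal (3 * \<phi> T * s * (s * l * \<phi> T * (L2w_norm a (U T))\<^sup>2 + (H1w_norm a (U T))\<^sup>2) * exp (2 * s * \<phi> T))"
    (is "?lhs \<le> ennreal _ * ?rhs + ennreal ?bdry")
proof -
  define p where "p t = s * l * \<phi> t" for t
  define e where "e t = exp (2 * s * \<phi> t)" for t
  define f where "f t = ip (V t) (V t) - 2 * ip (V t) (B t) + ip (B t) (B t)" for t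
  define \<Psi> where "\<Psi> t = e t * (ip (V t) (V t) + ip (B t) (B t) + p t * J t + (p t)\<^sup>2 * ip (U t) (U t))" for t
  have main: "integrable timeM \<Psi>" "integrable timeM (\<lambda>t. s * \<phi> t * e t * f t)"
    "(LINT t|timeM. \<Psi> t) \<le> 3 * (LINT t|timeM. s * \<phi> t * e t * f t)
       + 3 * (s * \<phi> T * e T * ((LINT x|I01. (wderiv (U T) x)\<^sup>2) + p T * ip (U T) (U T)))"
    using Carleman_time_integrals[OF l s]
    unfolding \<Psi>_def[abs_def] f_def[abs_def] e_def[abs_def] p_def[abs_def] \<phi>_def by - assumption+
  have cont_w: "continuous_on UNIV e" "continuous_on UNIV p" "continuous_on UNIV (\<lambda>t. s * \<phi> t * e t)"
    unfolding e_def[abs_def] p_def[abs_def] \<phi>_def by (intro continuous_intros)+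
  have nn: "0 \<le> e t" "0 \<le> p t" "0 \<le> s * \<phi> t * e t" for t using l s by (simp_all add: e_def p_def \<phi>_def)
  have isq: "integrable I01 (\<lambda>x. (wt g x)\<^sup>2)" "(LINT x|I01. (wt g x)\<^sup>2) = ip g g" if "g \<in> L2w a" for g
    using L2w_sqint(2)[OF that] by (simp_all add: sqint_def ip_eq power2_eq_square)
  define g where "g x t = e t * ((wt (V t) x)\<^sup>2 + (wt (B t) x)\<^sup>2 + p t * (ux x t)\<^sup>2 + (p t)\<^sup>2 * (wt (U t) x)\<^sup>2)" for x t
  have "?lhs = (\<integral>\<^sup>+ (x, t). ennreal (g x t) \<partial>cyl T)"
  proof (rule nn_integral_cong, clarsimp)
    fix x t :: real assume x: "0 < x" "x < 1"
    then have ax: "0 < a x" using pos by simp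
    have sq: "(wt k x)\<^sup>2 = (k x)\<^sup>2 / a x" for k using ax by (simp add: wt_def power_divide)
    have "(wt (B t) x)\<^sup>2 = a x * (uxx x t)\<^sup>2" unfolding sq using ax by (simp add: power_mult_distrib power2_eq_square)
    then have "g x t = ((ut x t)\<^sup>2 / a x + a x * (uxx x t)\<^sup>2 + s * l * \<phi> t * (ux x t)\<^sup>2 + s\<^sup>2 * l\<^sup>2 * (\<phi> t)\<^sup>2 * (u x t)\<^sup>2 / a x) * exp (2 * s * \<phi> t)"
      unfolding g_def sq e_def p_def by (simp add: power_mult_distrib mult_ac)
    then show "ennreal (((ut x t)\<^sup>2 / a x + a x * (uxx x t)\<^sup>2 + s * l * \<phi> t * (ux x t)\<^sup>2 + s\<^sup>2 * l\<^sup>2 * (\<phi> t)\<^sup>2 * (u x t)\<^sup>2 / a x) * exp (2 * s * \<phi> t))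
      = ennreal (g x t)" by simp
  qed
  also have "\<dots> = (\<integral>\<^sup>+t. \<integral>\<^sup>+x. ennreal (g x t) \<partial>I01 \<partial>timeM)"
  proof (rule nn_integral_cyl)
    have "(\<lambda>z. (\<lambda>(x, t). e t) z * (((\<lambda>(x, t). wt (V t) x) z)\<^sup>2 + ((\<lambda>(x, t). wt (B t) x) z)\<^sup>2
        + (\<lambda>(x, t). p t) z * ((\<lambda>(x, t). ux x t) z)\<^sup>2 + ((\<lambda>(x, t). p t) z)\<^sup>2 * ((\<lambda>(x, t). wt (U t) x) z)\<^sup>2)) \<in> borel_measurable (cyl T)"
      by (intro borel_measurable_times borel_measurable_add borel_measurable_power time_function_measurable_cyl cont_w
          wt_measurable_cyl u_measurable_cyl B_measurable_cyl)
    then have "(\<lambda>(x, t). g x t) \<in> borel_measurable (cyl T)"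
      by (rule measurable_cong[THEN iffD1, rotated]) (auto simp: g_def)
    then have "(\<lambda>z. ennreal ((\<lambda>(x, t). g x t) z)) \<in> borel_measurable (cyl T)" by simp
    then show "(\<lambda>(x, t). ennreal (g x t)) \<in> borel_measurable (cyl T)" by (simp add: case_prod_beta')
  qed
  also have "\<dots> = (\<integral>\<^sup>+t. ennreal (\<Psi> t) \<partial>timeM)"
  proof (rule nn_integral_cong_AE, use AE_regular AE_V in eventually_elim)
    case (elim t)
    note R = regularD[OF conjunct1[OF elim(1)]]
    have "integrable I01 (\<lambda>x. g x t)" "(LINT x|I01. g x t) = \<Psi> t"
      unfolding g_def \<Psi>_def using isq[OF R(1)] isq[OF R(5)] isq[OF elim(2)] sqint_integrable[OF R(6)] by simp_all
    moreover have "0 \<le> g x t" for x using nn[of t] unfolding g_def by (intro mult_nonneg_nonneg add_nonneg_nonneg) auto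
    ultimately show ?case using nn_integral_eq_integral[of I01 "\<lambda>x. g x t"] by simp
  qed
  also have "\<dots> = ennreal (LINT t|timeM. \<Psi> t)"
  proof (rule nn_integral_eq_integral[OF main(1)], rule AE_I2)
    fix t
    have "0 \<le> J t" by simp
    then show "0 \<le> \<Psi> t" unfolding \<Psi>_def using nn[of t] ip_nonneg
      by (intro mult_nonneg_nonneg add_nonneg_nonneg) auto
  qed
  finally have L: "?lhs = ennreal (LINT t|timeM. \<Psi> t)" .
  define h where "h x t = s * \<phi> t * e t * (wt (V t) x - wt (B t) x)\<^sup>2" for x t
  have f0: "AE t in timeM. 0 \<le> f t \<and> (\<integral>\<^sup>+x. ennreal (h x t) \<partial>I01) = ennreal (s * \<phi> t * e t * f t)"
    using AE_regular AE_V
  proof eventually_elim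
    case (elim t)
    note R = regularD[OF conjunct1[OF elim(1)]]
    have i: "integrable I01 (\<lambda>x. wt (V t) x * wt (B t) x)"
      by (rule sqint_mult_integrable[OF L2w_sqint(2)[OF elim(2)] L2w_sqint(2)[OF R(5)]])
    have "(LINT x|I01. (wt (V t) x - wt (B t) x)\<^sup>2) = (LINT x|I01. (wt (V t) x)\<^sup>2 - 2 * (wt (V t) x * wt (B t) x) + (wt (B t) x)\<^sup>2)"
      by (rule Bochner_Integration.integral_cong) (simp_all add: power2_diff)
    also have "\<dots> = f t" unfolding f_def using isq[OF R(5)] isq[OF elim(2)] i by (simp add: ip_eq[of "V t" "B t"])
    finally have ft: "(LINT x|I01. (wt (V t) x - wt (B t) x)\<^sup>2) = f t" .
    have "integrable I01 (\<lambda>x. (wt (V t) x - wt (B t) x)\<^sup>2)"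
      by (rule sqint_integrable[OF sqint_diff[OF L2w_sqint(2)[OF elim(2)] L2w_sqint(2)[OF R(5)]]])
    then have "integrable I01 (\<lambda>x. h x t)" "(LINT x|I01. h x t) = s * \<phi> t * e t * f t"
      by (simp_all add: h_def ft)
    moreover have "0 \<le> h x t" for x unfolding h_def by (rule mult_nonneg_nonneg[OF nn(3)]) simp
    ultimately have "(\<integral>\<^sup>+x. ennreal (h x t) \<partial>I01) = ennreal (s * \<phi> t * e t * f t)"
      using nn_integral_eq_integral[of I01 "\<lambda>x. h x t"] by simp
    moreover have "0 \<le> f t" unfolding ft[symmetric] by simp
    ultimately show ?case by blast
  qed
  have "?rhs = (\<integral>\<^sup>+ (x, t). ennreal (h x t) \<partial>cyl T)"
  proof (rule nn_integral_cong_AE)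
    have "AE z in cyl T. z \<in> {0<..<1} \<times> {0<..<T}" by (rule AE_I2) simp
    with F show "AE z in cyl T. (case z of (x, t) \<Rightarrow> ennreal (s * \<phi> t * (1 / a x) * \<bar>F x t\<bar>\<^sup>2 * exp (2 * s * \<phi> t)))
        = (case z of (x, t) \<Rightarrow> ennreal (h x t))"
    proof eventually_elim
      case (elim z)
      obtain x t where z: "z = (x, t)" by (cases z)
      have ax: "0 < a x" using elim(2) pos by (auto simp: z)
      \<comment> \<open>The minus sign in \<open>B\<close> turns this difference into
        \<open>u_t + a u_xx\<close>.\<close>
      have "wt (V t) x - wt (B t) x = F x t / sqrt (a x)" using elim(1) by (simp add: wt_def z flip: add_divide_distrib)
      then have "(wt (V t) x - wt (B t) x)\<^sup>2 = (F x t)\<^sup>2 / a x" using ax by (simp add: power_divide)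
      then show ?case by (simp add: z h_def e_def mult_ac)
    qed
  qed
  also have "\<dots> = (\<integral>\<^sup>+t. \<integral>\<^sup>+x. ennreal (h x t) \<partial>I01 \<partial>timeM)"
  proof (rule nn_integral_cyl)
    have "(\<lambda>z. (\<lambda>(x, t). s * \<phi> t * e t) z * ((\<lambda>(x, t). wt (V t) x) z - (\<lambda>(x, t). wt (B t) x) z)\<^sup>2) \<in> borel_measurable (cyl T)"
      by (intro borel_measurable_times borel_measurable_diff borel_measurable_power time_function_measurable_cyl cont_w
          wt_measurable_cyl u_measurable_cyl B_measurable_cyl)
    then have "(\<lambda>(x, t). h x t) \<in> borel_measurable (cyl T)"
      by (rule measurable_cong[THEN iffD1, rotated]) (auto simp: h_def)
    then have "(\<lambda>z. ennreal ((\<lambda>(x, t). h x t) z)) \<in> borel_measurable (cyl T)" by simp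
    then show "(\<lambda>(x, t). ennreal (h x t)) \<in> borel_measurable (cyl T)" by (simp add: case_prod_beta')
  qed
  also have "\<dots> = (\<integral>\<^sup>+t. ennreal (s * \<phi> t * e t * f t) \<partial>timeM)"
    by (rule nn_integral_cong_AE) (use f0 in eventually_elim, simp)
  also have "\<dots> = ennreal (LINT t|timeM. s * \<phi> t * e t * f t)"
  proof (rule nn_integral_eq_integral[OF main(2)], use f0 in eventually_elim)
    case (elim t)
    then show ?case by (intro mult_nonneg_nonneg[OF nn(3)]) simp
  qed
  finally have R: "?rhs = ennreal (LINT t|timeM. s * \<phi> t * e t * f t)" .
  have F0: "0 \<le> (LINT t|timeM. s * \<phi> t * e t * f t)"
  proof (rule integral_nonneg_AE, use f0 in eventually_elim)
    case (elim t)
    then show ?case by (intro mult_nonneg_nonneg[OF nn(3)]) simp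
  qed
  \<comment> \<open>The boundary term has the weight \<open>s * \<phi> T\<close>, so
    \<open>\<phi> T\<close> goes into the constant; being at least 1 it may also multiply the term
    with \<open>F\<close>, and one constant serves both. The full \<open>H1w_norm\<close> exceeds
    the gradient energy by \<open>N\<close>, which is nonnegative.\<close>
  have \<phi>T: "1 \<le> \<phi> T" using l T by (simp add: \<phi>_def)
  define N where "N = ip (U T) (U T)"
  define E where "E = (LINT x|I01. (wderiv (U T) x)\<^sup>2)"
  have NE: "0 \<le> N" "0 \<le> E" by (simp_all add: N_def E_def ip_nonneg)
  have bdry: "?bdry = 3 * (s * \<phi> T * e T * (N + E + p T * N))"
    using NE by (simp add: H1w_norm_def L2w_norm_power2 e_def p_def algebra_simps flip: N_def E_def)
  have "(LINT t|timeM. \<Psi> t) \<le> 3 * (LINT t|timeM. s * \<phi> t * e t * f t) + 3 * (s * \<phi> T * e T * (E + p T * N))"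
    using main(3) by (simp add: E_def N_def)
  also have "\<dots> \<le> (3 * \<phi> T) * (LINT t|timeM. s * \<phi> t * e t * f t) + ?bdry"
    unfolding bdry using \<phi>T F0 NE nn(3)[of T] by (intro add_mono mult_right_mono mult_left_mono) auto
  finally have "ennreal (LINT t|timeM. \<Psi> t) \<le> ennreal ((3 * \<phi> T) * (LINT t|timeM. s * \<phi> t * e t * f t) + ?bdry)"
    by (rule ennreal_leI)
  also have "\<dots> = ennreal (3 * \<phi> T) * ?rhs + ennreal ?bdry"
  proof -
    have "0 \<le> ?bdry" unfolding bdry using NE nn[of T] by (intro mult_nonneg_nonneg[of 3] mult_nonneg_nonneg[OF nn(3)]) auto
    then show ?thesis unfolding R using \<phi>T F0 by (simp add: ennreal_plus ennreal_mult)
  qed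
  finally show ?thesis unfolding L .
qed

end

theorem lemma2p1:
  fixes T :: real and a :: "real \<Rightarrow> real"
  assumes "T > 0"
    and "continuous_on {0..1} a"
    and "a C1_differentiable_on {0<..<1}"
    and "\<And>x. x \<in> {0<..<1} \<Longrightarrow> a x > 0"
    and "a 0 = 0" and "a 1 = 0"
  shows "\<exists>l0>0. \<forall>l>l0. \<exists>s0>0. \<exists>C>0. \<forall>s\<ge>s0. \<forall>u ut ux uxx F uT.
    strong_fun a T u ut ux uxx \<and> solves_backward a T u ut uxx F uT \<longrightarrow>
    (let \<phi> = (\<lambda>t::real. exp (l * t)) in
      (\<integral>\<^sup>+ (x, t). ennreal
          ((1 / a x * \<bar>ut x t\<bar>\<^sup>2 + a x * \<bar>uxx x t\<bar>\<^sup>2 + s * l * \<phi> t * \<bar>ux x t\<bar>\<^sup>2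
             + s\<^sup>2 * l\<^sup>2 * (\<phi> t)\<^sup>2 / a x * \<bar>u x t\<bar>\<^sup>2) * exp (2 * s * \<phi> t)) \<partial>cyl T)
      \<le> ennreal C *
          (\<integral>\<^sup>+ (x, t). ennreal (s * \<phi> t * (1 / a x) * \<bar>F x t\<bar>\<^sup>2 * exp (2 * s * \<phi> t)) \<partial>cyl T)
        + ennreal (C * s * (s * l * \<phi> T * (L2w_norm a (\<lambda>x. u x T))\<^sup>2
                              + (H1w_norm a (\<lambda>x. u x T))\<^sup>2) * exp (2 * s * \<phi> T))
        + ennreal (C * s * (s * l * (L2w_norm a (\<lambda>x. u x 0))\<^sup>2
                              + (H1w_norm a (\<lambda>x. u x 0))\<^sup>2) * exp (2 * s)))"
proof (rule exI[of _ "1::real"], rule conjI, simp, intro allI impI)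
  fix l :: real assume l: "1 < l"
  show "\<exists>s0>0. \<exists>C>0. \<forall>s\<ge>s0. \<forall>u ut ux uxx F uT.
    strong_fun a T u ut ux uxx \<and> solves_backward a T u ut uxx F uT \<longrightarrow>
    (let \<phi> = (\<lambda>t::real. exp (l * t)) in
      (\<integral>\<^sup>+ (x, t). ennreal
          ((1 / a x * \<bar>ut x t\<bar>\<^sup>2 + a x * \<bar>uxx x t\<bar>\<^sup>2 + s * l * \<phi> t * \<bar>ux x t\<bar>\<^sup>2
             + s\<^sup>2 * l\<^sup>2 * (\<phi> t)\<^sup>2 / a x * \<bar>u x t\<bar>\<^sup>2) * exp (2 * s * \<phi> t)) \<partial>cyl T)
      \<le> ennreal C *
          (\<integral>\<^sup>+ (x, t). ennreal (s * \<phi> t * (1 / a x) * \<bar>F x t\<bar>\<^sup>2 * exp (2 * s * \<phi> t)) \<partial>cyl T)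
        + ennreal (C * s * (s * l * \<phi> T * (L2w_norm a (\<lambda>x. u x T))\<^sup>2
                              + (H1w_norm a (\<lambda>x. u x T))\<^sup>2) * exp (2 * s * \<phi> T))
        + ennreal (C * s * (s * l * (L2w_norm a (\<lambda>x. u x 0))\<^sup>2
                              + (H1w_norm a (\<lambda>x. u x 0))\<^sup>2) * exp (2 * s)))"
  \<comment> \<open>The threshold 1 for \<open>s\<close> is the one at which the weights become
    comparable, and the constant depends on \<open>l\<close> and \<open>T\<close> only.\<close>
  proof (rule exI[of _ "1::real"], rule conjI, simp, rule exI[of _ "3 * exp (l * T)"], rule conjI, simp, intro allI impI)
    fix s :: real and u ut ux uxx F uT
    assume s: "1 \<le> s" and sol: "strong_fun a T u ut ux uxx \<and> solves_backward a T u ut uxx F uT"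
    interpret strong_solution a T u ut ux uxx
      using assms sol by unfold_locales auto
    have F: "AE (x, t) in cyl T. ut x t + a x * uxx x t = F x t" using sol by (simp add: solves_backward_def)
    show "let \<phi> = (\<lambda>t::real. exp (l * t)) in
      (\<integral>\<^sup>+ (x, t). ennreal
          ((1 / a x * \<bar>ut x t\<bar>\<^sup>2 + a x * \<bar>uxx x t\<bar>\<^sup>2 + s * l * \<phi> t * \<bar>ux x t\<bar>\<^sup>2
             + s\<^sup>2 * l\<^sup>2 * (\<phi> t)\<^sup>2 / a x * \<bar>u x t\<bar>\<^sup>2) * exp (2 * s * \<phi> t)) \<partial>cyl T)
      \<le> ennreal (3 * exp (l * T)) *
          (\<integral>\<^sup>+ (x, t). ennreal (s * \<phi> t * (1 / a x) * \<bar>F x t\<bar>\<^sup>2 * exp (2 * s * \<phi> t)) \<partial>cyl T)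
        + ennreal (3 * exp (l * T) * s * (s * l * \<phi> T * (L2w_norm a (\<lambda>x. u x T))\<^sup>2
                              + (H1w_norm a (\<lambda>x. u x T))\<^sup>2) * exp (2 * s * \<phi> T))
        + ennreal (3 * exp (l * T) * s * (s * l * (L2w_norm a (\<lambda>x. u x 0))\<^sup>2
                              + (H1w_norm a (\<lambda>x. u x 0))\<^sup>2) * exp (2 * s))"
      \<comment> \<open>The terms at time 0 entered the energy inequalities with the good sign and
        were dropped; on the right-hand side of the claim they only add a nonnegative
        amount.\<close>
      unfolding Let_def by (rule add_increasing2[OF zero_le Carleman_estimate[OF _ s F]]) (use l in simp)
  qed
qed

end
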